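(* Let $X_t=\int_{-\infty}^tK(t,s)\sigma_s\,dB_s$, $t\in\mathbb{R}$, be a volatility modulated Volterra process on the real line with kernel $K$ (satisfying the standing assumptions on $K$ and $\sigma$ given in the context), and let $t\in\mathbb{R}$. Let $f:\mathbb{R}\to\mathbb{R}$ be a continuous function of local bounded variation such that for almost all $s<t$ $$\lim_{u\downarrow s}[f(u)-f(s)]K(u,s)=0.$$ Then $f\in\mathcal{H}_t^K$ if and only if the mapping $s\mapsto\int_s^tK(r,s)\,df(r)$ is square integrable (on $(-\infty,t]$). If in addition $$\int_{-\infty}^t\left(\int_{-\infty}^sK(s,r)^2\,dr\right)^{1/2}d|f|(s)<\infty,$$ where $d|f|$ is the total variation measure of $f$, then almost surely $$\int_{-\infty}^tf(s)\,dX_s=f(t)X_t-\int_{-\infty}^tX_s\,df(s),$$ i.e. $\int_{-\infty}^tf(s)\,dX_s$ coincides with the Lebesgue–Stieltjes integral of $f$ with respect to $X$.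
   Context: $(\Omega,\mathcal{F},(\mathcal{F}_t)_{t\in\mathbb{R}},\mathbb{P})$ is a filtered probability space satisfying the usual conditions. $B=(B_t)_{t\in\mathbb{R}}$ is a two-sided Brownian motion on it: a continuous centered Gaussian process with $B_0=0$ such that for all $t\ge 0$, $s\in\mathbb{R}$, $B_{t+s}-B_s$ has variance $t$, is $\mathcal{F}_{t+s}$-measurable and is independent of $\mathcal{F}_s$. Standing assumptions: $K:\mathbb{R}^2\to\mathbb{R}$ is measurable with $K(t,s)=0$ for $s>t$; $\int_{-\infty}^tK^2(t,s)\,ds<\infty$ for every $t\in\mathbb{R}$; $t\mapsto K(t,s)$ is continuously differentiable on $(s,\infty)$ for almost all $s$; $K(0,s)=0$ for almost all $s$; and $K(t,\cdot)\to K(u,\cdot)$ in $\mathcal{L}^2(ds)$ as $t\to u$, for every $u$. The process $\sigma$ is adapted, càglàd (left-continuous with right limits) and satisfies $\sup_t\mathbb{E}(\sigma_t^2)<\infty$. A volatility modulated Volterra process is a process $X_t=\int_{-\infty}^tK(t,s)\sigma_s\,dB_s$ of this form (Itô integral); it is continuous in probability, and a measurable modification is used. Wiener-type integral: for measurable $f$ and $s<t$ put $$\mathcal{K}_Kf(t,s):=f(s)K(t,s)+\int_s^t[f(u)-f(s)]\frac{\partial}{\partial u}K(u,s)\,du,$$ $$\mathcal{H}_t^K:=\{f\text{ measurable}:\ \mathcal{K}_Kf(t,\cdot)\in\mathcal{L}^2((-\infty,t])\},$$ and for $f\in\mathcal{H}_t^K$ define $\int_{-\infty}^tf(s)\,d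X_s:=\int_{-\infty}^t\mathcal{K}_Kf(t,s)\,\sigma_s\,dB_s$.
   Formalization: The integral of [f(u)-f(s)] ∂K(u,s)/∂u over (s,t] in the definition of K_K f and H_t^K is read as an improper (Henstock–Kurzweil) integral at u=s; with absolutely convergent Lebesgue integrals the stated equivalence fails for oscillating kernels. *)

theory Defs
  imports "HOL-Probability.Probability"
begin

section \<open>Filtered probability spaces and two-sided Brownian motion\<close>

locale usual_filtered_prob_space = prob_space M + filtration "space M" F
  for M :: "'a measure" and F :: "real \<Rightarrow> 'a measure" +
  assumes sets_F_subset: "\<And>t. sets (F t) \<subseteq> sets M"
    and complete: "complete_measure M"
    and null_sets_F: "\<And>t. null_sets M \<subseteq> sets (F t)"
    and right_continuous: "\<And>t. sets (F t) = (\<Inter>s\<in>{t<..}. sets (F s))"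

text \<open>Constants count as (degenerate) Gaussian variables, since \<open>B 0 = 0\<close> has to be allowed.\<close>

definition gaussian_rv :: "'a measure \<Rightarrow> ('a \<Rightarrow> real) \<Rightarrow> bool" where
  "gaussian_rv M Y \<longleftrightarrow> Y \<in> borel_measurable M \<and>
     (\<exists>m. (AE \<omega> in M. Y \<omega> = m) \<or>
          (\<exists>s>0. distributed M lborel Y (\<lambda>x. ennreal (normal_density m s x))))"

definition gaussian_process :: "'a measure \<Rightarrow> (real \<Rightarrow> 'a \<Rightarrow> real) \<Rightarrow> bool" where
  "gaussian_process M X \<longleftrightarrow>
     (\<forall>I c. finite I \<longrightarrow> gaussian_rv M (\<lambda>\<omega>. \<Sum>t\<in>I. c t * X t \<omega>))"

text \<open>Only the increments of \<open>B\<close> are adapted: for \<open>t < 0\<close> the normalisation \<open>B 0 = 0\<close> prevents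
  \<open>B t\<close> itself from being \<open>F t\<close>-measurable.\<close>

locale two_sided_brownian_motion = usual_filtered_prob_space M F
  for M :: "'a measure" and F :: "real \<Rightarrow> 'a measure" +
  fixes B :: "real \<Rightarrow> 'a \<Rightarrow> real"
  assumes continuous_paths: "\<And>\<omega>. \<omega> \<in> space M \<Longrightarrow> continuous_on UNIV (\<lambda>t. B t \<omega>)"
    and gaussian: "gaussian_process M B"
    and centered: "\<And>t. expectation (B t) = 0"
    and zero: "\<And>\<omega>. \<omega> \<in> space M \<Longrightarrow> B 0 \<omega> = 0"
    and increment_variance: "\<And>s t. 0 \<le> t \<Longrightarrow> variance (\<lambda>\<omega>. B (t + s) \<omega> - B s \<omega>) = t"
    and increment_adapted:
      "\<And>s t. 0 \<le> t \<Longrightarrow> (\<lambda>\<omega>. B (t + s) \<omega> - B s \<omega>) \<in> borel_measurable (F (t + s))"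
    and increment_indep: "\<And>s t. 0 \<le> t \<Longrightarrow>
      indep_set (sets (vimage_algebra (space M) (\<lambda>\<omega>. B (t + s) \<omega> - B s \<omega>) borel)) (sets (F s))"


section \<open>The Ito integral over the real line\<close>

text \<open>A list of triples \<open>(a, b, \<xi>)\<close> represents the elementary process
  \<open>\<Sum> \<xi> 1\<^bsub>(a, b]\<^esub>\<close>.\<close>

type_synonym 'a elementary = "(real \<times> real \<times> ('a \<Rightarrow> real)) list"

definition elementary_integrand :: "'a measure \<Rightarrow> (real \<Rightarrow> 'a measure) \<Rightarrow> 'a elementary \<Rightarrow> bool" where
  "elementary_integrand M F S \<longleftrightarrow> (\<forall>(a, b, \<xi>) \<in> set S.
     a \<le> b \<and> \<xi> \<in> borel_measurable (F a) \<and> bounded (\<xi> ` space M))"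

definition elementary_process :: "'a elementary \<Rightarrow> real \<Rightarrow> 'a \<Rightarrow> real" where
  "elementary_process S s \<omega> = (\<Sum>(a, b, \<xi>)\<leftarrow>S. indicator {a<..b} s * \<xi> \<omega>)"

definition elementary_integral :: "(real \<Rightarrow> 'a \<Rightarrow> real) \<Rightarrow> 'a elementary \<Rightarrow> 'a \<Rightarrow> real" where
  "elementary_integral B S \<omega> = (\<Sum>(a, b, \<xi>)\<leftarrow>S. \<xi> \<omega> * (B b \<omega> - B a \<omega>))"

text \<open>\<open>Y\<close> is a version of the Ito integral of \<open>H\<close> over the whole line: \<open>H\<close> is a limit of
  elementary processes in \<open>L\<^sup>2(ds \<otimes> P)\<close> and \<open>Y\<close> is the \<open>L\<^sup>2(P)\<close>-limit of their integrals. The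
  measure \<open>lebesgue\<close> (instead of \<open>lborel\<close>) allows deterministic factors of \<open>H\<close> that are only
  Lebesgue measurable.\<close>

definition has_ito_integral ::
    "'a measure \<Rightarrow> (real \<Rightarrow> 'a measure) \<Rightarrow> (real \<Rightarrow> 'a \<Rightarrow> real) \<Rightarrow> (real \<Rightarrow> 'a \<Rightarrow> real) \<Rightarrow> ('a \<Rightarrow> real) \<Rightarrow> bool" where
  "has_ito_integral M F B H Y \<longleftrightarrow>
     (\<lambda>(s, \<omega>). H s \<omega>) \<in> borel_measurable (lebesgue \<Otimes>\<^sub>M M) \<and>
     Y \<in> borel_measurable M \<and>
     (\<exists>S. (\<forall>n. elementary_integrand M F (S n)) \<and>
        (\<lambda>n. \<integral>\<^sup>+(s, \<omega>). ennreal ((H s \<omega> - elementary_process (S n) s \<omega>)\<^sup>2) \<partial>(lebesgue \<Otimes>\<^sub>M M))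
          \<longlonglongrightarrow> 0 \<and>
        (\<lambda>n. \<integral>\<^sup>+\<omega>. ennreal ((Y \<omega> - elementary_integral B (S n) \<omega>)\<^sup>2) \<partial>M) \<longlonglongrightarrow> 0)"

text \<open>The integral of \<open>H\<close> over \<open>(-\<infinity>, t]\<close>; it is determined up to almost sure equality only.\<close>

definition ito_integral ::
    "'a measure \<Rightarrow> (real \<Rightarrow> 'a measure) \<Rightarrow> (real \<Rightarrow> 'a \<Rightarrow> real) \<Rightarrow> real \<Rightarrow> (real \<Rightarrow> 'a \<Rightarrow> real) \<Rightarrow> 'a \<Rightarrow> real" where
  "ito_integral M F B t H =
     (SOME Y. has_ito_integral M F B (\<lambda>s \<omega>. indicator {..t} s * H s \<omega>) Y)"


section \<open>Volatility modulated Volterra processes\<close>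

definition square_integrable_upto :: "real \<Rightarrow> (real \<Rightarrow> real) \<Rightarrow> bool" where
  "square_integrable_upto t g \<longleftrightarrow>
     g \<in> borel_measurable (lebesgue_on {..t}) \<and> integrable (lebesgue_on {..t}) (\<lambda>s. (g s)\<^sup>2)"

definition volterra_kernel :: "(real \<Rightarrow> real \<Rightarrow> real) \<Rightarrow> bool" where
  "volterra_kernel K \<longleftrightarrow>
     (\<lambda>(t, s). K t s) \<in> borel_measurable borel \<and>
     (\<forall>t s. t < s \<longrightarrow> K t s = 0) \<and>
     (\<forall>t. square_integrable_upto t (K t)) \<and>
     (AE s in lborel. (\<lambda>t. K t s) C1_differentiable_on {s<..}) \<and>
     (AE s in lborel. K 0 s = 0) \<and>
     (\<forall>u. ((\<lambda>t. \<integral>\<^sup>+s. ennreal ((K t s - K u s)\<^sup>2) \<partial>lborel) \<longlongrightarrow> 0) (at u))"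

definition volatility_process ::
    "'a measure \<Rightarrow> (real \<Rightarrow> 'a measure) \<Rightarrow> (real \<Rightarrow> 'a \<Rightarrow> real) \<Rightarrow> bool" where
  "volatility_process M F \<sigma> \<longleftrightarrow>
     (\<forall>t. \<sigma> t \<in> borel_measurable (F t)) \<and>
     (\<forall>\<omega>\<in>space M. \<forall>t. continuous (at_left t) (\<lambda>s. \<sigma> s \<omega>) \<and>
        (\<exists>l. ((\<lambda>s. \<sigma> s \<omega>) \<longlongrightarrow> l) (at_right t))) \<and>
     (SUP t. \<integral>\<^sup>+\<omega>. ennreal ((\<sigma> t \<omega>)\<^sup>2) \<partial>M) < \<infinity>"

text \<open>\<open>X\<close> is a jointly measurable modification of \<open>t \<mapsto> \<integral>\<^bsub>(-\<infinity>, t]\<^esub> K t s \<sigma> s dB s\<close>.\<close>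

definition vmv_process ::
    "'a measure \<Rightarrow> (real \<Rightarrow> 'a measure) \<Rightarrow> (real \<Rightarrow> 'a \<Rightarrow> real) \<Rightarrow> (real \<Rightarrow> real \<Rightarrow> real) \<Rightarrow>
      (real \<Rightarrow> 'a \<Rightarrow> real) \<Rightarrow> (real \<Rightarrow> 'a \<Rightarrow> real) \<Rightarrow> bool" where
  "vmv_process M F B K \<sigma> X \<longleftrightarrow>
     (\<lambda>(t, \<omega>). X t \<omega>) \<in> borel_measurable (borel \<Otimes>\<^sub>M M) \<and>
     (\<forall>t. AE \<omega> in M. X t \<omega> = ito_integral M F B t (\<lambda>s \<omega>. K t s * \<sigma> s \<omega>) \<omega>)"


section \<open>The Wiener-type integral\<close>

text \<open>The inner integral over \<open>[s, t]\<close> is the Henstock-Kurzweil integral, which on functions that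
  are continuous on \<open>(s, t]\<close> is the improper integral at the possible singularity of the kernel
  at \<open>u = s\<close>. Absolute (Lebesgue) integrability would be too restrictive: for
  \<open>K t s = g (t - s) - g (- s)\<close> with \<open>g x = x powr a * sin (x powr (- b))\<close> near \<open>0+\<close>,
  \<open>-1/2 < a \<le> b - 1\<close>, and \<open>f u = u\<close>, it fails although \<open>\<integral> K r s df(r)\<close> converges absolutely.\<close>

definition kernel_integrand ::
    "(real \<Rightarrow> real \<Rightarrow> real) \<Rightarrow> (real \<Rightarrow> real) \<Rightarrow> real \<Rightarrow> real \<Rightarrow> real" where
  "kernel_integrand K f s u = (f u - f s) * deriv (\<lambda>v. K v s) u"

definition kernel_operator ::
    "(real \<Rightarrow> real \<Rightarrow> real) \<Rightarrow> (real \<Rightarrow> real) \<Rightarrow> real \<Rightarrow> real \<Rightarrow> real" where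
  "kernel_operator K f t s = f s * K t s + integral {s..t} (kernel_integrand K f s)"

definition wiener_integrands :: "(real \<Rightarrow> real \<Rightarrow> real) \<Rightarrow> real \<Rightarrow> (real \<Rightarrow> real) set" where
  "wiener_integrands K t = {f. f \<in> borel_measurable borel \<and>
     (AE s in lborel. s < t \<longrightarrow> kernel_integrand K f s integrable_on {s..t}) \<and>
     square_integrable_upto t (kernel_operator K f t)}"

definition vmv_integral ::
    "'a measure \<Rightarrow> (real \<Rightarrow> 'a measure) \<Rightarrow> (real \<Rightarrow> 'a \<Rightarrow> real) \<Rightarrow> (real \<Rightarrow> real \<Rightarrow> real) \<Rightarrow>
      (real \<Rightarrow> 'a \<Rightarrow> real) \<Rightarrow> real \<Rightarrow> (real \<Rightarrow> real) \<Rightarrow> 'a \<Rightarrow> real" where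
  "vmv_integral M F B K \<sigma> t f = ito_integral M F B t (\<lambda>s \<omega>. kernel_operator K f t s * \<sigma> s \<omega>)"


section \<open>Lebesgue-Stieltjes integrals\<close>

definition variation_sums :: "(real \<Rightarrow> real) \<Rightarrow> real \<Rightarrow> real \<Rightarrow> real set" where
  "variation_sums f a b = {\<Sum>i<n. \<bar>f (x (Suc i)) - f (x i)\<bar> | n x.
     mono_on {..n} x \<and> x ` {..n} \<subseteq> {a..b}}"

definition locally_bounded_variation :: "(real \<Rightarrow> real) \<Rightarrow> bool" where
  "locally_bounded_variation f \<longleftrightarrow> (\<forall>a b. bdd_above (variation_sums f a b))"

definition variation_function :: "(real \<Rightarrow> real) \<Rightarrow> real \<Rightarrow> real" where
  "variation_function f x =
     (if 0 \<le> x then Sup (variation_sums f 0 x) else - Sup (variation_sums f x 0))"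

definition total_variation_measure :: "(real \<Rightarrow> real) \<Rightarrow> real measure" where
  "total_variation_measure f = interval_measure (variation_function f)"

definition positive_variation_measure :: "(real \<Rightarrow> real) \<Rightarrow> real measure" where
  "positive_variation_measure f = interval_measure (\<lambda>x. (variation_function f x + f x) / 2)"

definition negative_variation_measure :: "(real \<Rightarrow> real) \<Rightarrow> real measure" where
  "negative_variation_measure f = interval_measure (\<lambda>x. (variation_function f x - f x) / 2)"

text \<open>Meant for continuous \<open>f\<close> of locally bounded variation, where the total variation measure is
  the sum of the positive and the negative one and has no atoms. Since \<open>df\<close> may have infinite
  total variation on \<open>(-\<infinity>, t]\<close>, it need not be a signed measure and the integral is defined through
  the two parts.\<close>

definition stieltjes_integrable :: "(real \<Rightarrow> real) \<Rightarrow> real set \<Rightarrow> (real \<Rightarrow> real) \<Rightarrow> bool" where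
  "stieltjes_integrable f A g \<longleftrightarrow> set_integrable (total_variation_measure f) A g"

definition stieltjes_integral :: "(real \<Rightarrow> real) \<Rightarrow> real set \<Rightarrow> (real \<Rightarrow> real) \<Rightarrow> real" where
  "stieltjes_integral f A g =
     (LINT x:A|positive_variation_measure f. g x) - (LINT x:A|negative_variation_measure f. g x)"

end

theory Submission
  imports Defs
begin

text \<open>
  Both halves rest on integration by parts against the kernel. For almost every \<open>s\<close> the function \<open>K u s\<close>
  is \<open>C\<^sup>1\<close> in \<open>u\<close> on \<open>(s, \<infinity>)\<close>, so on \<open>[a, t]\<close> with \<open>a > s\<close> the integral of
  \<open>(f u - f s) * \<partial>K u s\<close> equals boundary terms minus the Stieltjes integral of \<open>K u s\<close> with
  respect to \<open>f\<close>. The boundary term at \<open>a\<close> vanishes as \<open>a\<close> decreases to \<open>s\<close> by hypothesis. The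
  Stieltjes integral over \<open>(s, t]\<close> converges absolutely for almost every \<open>s\<close>, by Tonelli and because the \<open>L\<^sup>2\<close>-norm of
  \<open>K r\<close> is continuous in \<open>r\<close>, hence bounded on compact sets. Therefore the improper integral exists and
  \<open>kernel_operator K f t s = f t * K t s - G s\<close> for almost every \<open>s\<close>, where \<open>G s\<close> is the Stieltjes
  integral of \<open>K r s\<close> over \<open>(s, t]\<close> (\<open>has_integral_by_parts_singular\<close>, \<open>kernel_operator_eq\<close>). As
  \<open>K t\<close> is square integrable, this gives the equivalence.

  Under the additional condition, Minkowski's integral inequality makes \<open>G\<close> square integrable, and
  it remains to see that the Ito integral of \<open>G s * \<sigma> s\<close> is the Stieltjes integral of \<open>X\<close>, a stochastic
  Fubini theorem. It follows from the Ito isometry alone. The positive and the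
  negative variation measure are treated separately; let \<open>\<mu>\<close> be one of them, \<open>Y\<close> the Ito integral of
  the \<open>\<mu>\<close>-average of \<open>K r s * \<sigma> s\<close> over \<open>r\<close>, and \<open>Z\<close> the pathwise \<open>\<mu>\<close>-integral of \<open>X\<close>. Fubini's
  theorem for ordinary integrals, together with the isometry, shows that
  \<open>E[Y\<^sup>2]\<close>, \<open>E[Y Z]\<close> and \<open>E[Z\<^sup>2]\<close> coincide, so \<open>E[(Y - Z)\<^sup>2] = 0\<close> (\<open>isometry_commutes_with_integral\<close>,
  \<open>stochastic_fubini\<close>).

  Because \<open>ito_integral\<close> is a choice among the random variables satisfying \<open>has_ito_integral\<close>, existence and
  almost sure uniqueness of the integral of \<open>g s * \<sigma> s\<close> for square integrable \<open>g\<close> are needed as well: uniqueness is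
  the isometry, existence is the density of elementary processes (\<open>ito_integrable_mult_volatility\<close>)
  and the completeness of \<open>L\<^sup>2\<close>.
\<close>

section \<open>Square integrable functions\<close>

text \<open>Functions in \<open>L\<^sup>2\<close>. They are kept as functions, not as classes modulo equality almost everywhere.\<close>
definition sq_integrable :: "'b measure \<Rightarrow> ('b \<Rightarrow> real) \<Rightarrow> bool" where
  "sq_integrable M f \<longleftrightarrow> f \<in> borel_measurable M \<and> integrable M (\<lambda>x. (f x)\<^sup>2)"

text \<open>The \<open>L\<^sup>2\<close>-seminorm; it is meaningful only for \<open>sq_integrable\<close> functions, since the Bochner integral
  of a non-integrable function is zero.\<close>
definition l2_norm :: "'b measure \<Rightarrow> ('b \<Rightarrow> real) \<Rightarrow> real" where
  "l2_norm M f = sqrt (\<integral>x. (f x)\<^sup>2 \<partial>M)"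

lemma sq_integrable_measurable: "sq_integrable M f \<Longrightarrow> f \<in> borel_measurable M"
  by (simp add: sq_integrable_def)

lemma sq_integrable_iff_nn_integral:
  "sq_integrable M f \<longleftrightarrow> f \<in> borel_measurable M \<and> (\<integral>\<^sup>+x. ennreal ((f x)\<^sup>2) \<partial>M) < \<infinity>"
  by (auto simp: sq_integrable_def integrable_iff_bounded)

lemma l2_norm_nonneg [simp]: "0 \<le> l2_norm M f"
  by (simp add: l2_norm_def)

lemma l2_norm_power2: "(l2_norm M f)\<^sup>2 = (\<integral>x. (f x)\<^sup>2 \<partial>M)"
  by (simp add: l2_norm_def)

lemma nn_integral_power2_eq:
  "sq_integrable M f \<Longrightarrow> (\<integral>\<^sup>+x. ennreal ((f x)\<^sup>2) \<partial>M) = ennreal ((l2_norm M f)\<^sup>2)"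
  by (simp add: sq_integrable_def l2_norm_power2 nn_integral_eq_integral)

lemma sq_integrable_mult:
  assumes "sq_integrable M f" "sq_integrable M g"
  shows "integrable M (\<lambda>x. f x * g x)"
proof (rule Bochner_Integration.integrable_bound)
  show "integrable M (\<lambda>x. (f x)\<^sup>2 + (g x)\<^sup>2)"
    using assms by (simp add: sq_integrable_def)
  have [measurable]: "f \<in> borel_measurable M" "g \<in> borel_measurable M"
    using assms by (simp_all add: sq_integrable_def)
  show "(\<lambda>x. f x * g x) \<in> borel_measurable M" by measurable
  have "\<bar>f x * g x\<bar> \<le> (f x)\<^sup>2 + (g x)\<^sup>2" for x
  proof -
    have "0 \<le> (\<bar>f x\<bar> - \<bar>g x\<bar>)\<^sup>2" by simp
    then have "2 * \<bar>f x * g x\<bar> \<le> (f x)\<^sup>2 + (g x)\<^sup>2"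
      by (simp add: power2_diff abs_mult)
    then show ?thesis by linarith
  qed
  then show "AE x in M. norm (f x * g x) \<le> norm ((f x)\<^sup>2 + (g x)\<^sup>2)"
    by simp
qed

lemma sq_integrable_cmult:
  "sq_integrable M f \<Longrightarrow> sq_integrable M (\<lambda>x. c * f x)"
  by (auto simp: sq_integrable_def power_mult_distrib)

lemma sq_integrable_add:
  assumes "sq_integrable M f" "sq_integrable M g"
  shows "sq_integrable M (\<lambda>x. f x + g x)"
  using assms sq_integrable_mult[OF assms]
  by (auto simp: sq_integrable_def power2_sum mult.assoc)

lemma sq_integrable_diff:
  assumes "sq_integrable M f" "sq_integrable M g"
  shows "sq_integrable M (\<lambda>x. f x - g x)"
  using sq_integrable_add[OF assms(1) sq_integrable_cmult[OF assms(2), of "-1"]] by simp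

lemma sq_integrable_zero [simp]: "sq_integrable M (\<lambda>x. 0)"
  by (simp add: sq_integrable_def)

lemma sq_integrable_bound:
  assumes "sq_integrable M g" "f \<in> borel_measurable M" "AE x in M. \<bar>f x\<bar> \<le> \<bar>g x\<bar>"
  shows "sq_integrable M f"
  unfolding sq_integrable_def
proof
  show "integrable M (\<lambda>x. (f x)\<^sup>2)"
  proof (rule Bochner_Integration.integrable_bound)
    show "integrable M (\<lambda>x. (g x)\<^sup>2)" using assms(1) by (simp add: sq_integrable_def)
    show "AE x in M. norm ((f x)\<^sup>2) \<le> norm ((g x)\<^sup>2)"
      using assms(3) by eventually_elim (simp add: abs_le_square_iff)
  qed (use assms(2) in simp)
qed fact

lemma l2_norm_cong_AE:
  assumes "f \<in> borel_measurable M" "g \<in> borel_measurable M" "AE x in M. f x = g x"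
  shows "l2_norm M f = l2_norm M g"
  unfolding l2_norm_def using assms by (intro arg_cong[where f=sqrt] integral_cong_AE) auto

lemma l2_norm_eq_0_AE:
  assumes "sq_integrable M f" "l2_norm M f = 0"
  shows "AE x in M. f x = 0"
proof -
  have "(\<integral>x. (f x)\<^sup>2 \<partial>M) = 0" using assms(2) by (simp add: l2_norm_def)
  then have "AE x in M. (f x)\<^sup>2 = 0"
    using assms(1) integral_nonneg_eq_0_iff_AE[of M "\<lambda>x. (f x)\<^sup>2"] by (simp add: sq_integrable_def)
  then show ?thesis by simp
qed

lemma Cauchy_Schwarz_integral_abs:
  assumes f: "sq_integrable M f" and g: "sq_integrable M g"
  shows "(\<integral>x. \<bar>f x * g x\<bar> \<partial>M) \<le> l2_norm M f * l2_norm M g"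
proof (cases "l2_norm M f = 0 \<or> l2_norm M g = 0")
  case True
  have [measurable]: "f \<in> borel_measurable M" "g \<in> borel_measurable M"
    using f g by (simp_all add: sq_integrable_def)
  from True have "AE x in M. \<bar>f x * g x\<bar> = 0"
    using l2_norm_eq_0_AE[OF f] l2_norm_eq_0_AE[OF g] by auto
  then have "(\<integral>x. \<bar>f x * g x\<bar> \<partial>M) = (\<integral>x. 0 \<partial>M)"
    by (intro integral_cong_AE) auto
  then show ?thesis using True by auto
next
  case False
  define a where "a = l2_norm M f"
  define b where "b = l2_norm M g"
  have ab: "0 < a" "0 < b" using False by (simp_all add: a_def b_def order_less_le)
  \<comment> \<open>the weighted arithmetic-geometric mean inequality, with weights that balance the two norms\<close>
  have "(\<integral>x. \<bar>f x * g x\<bar> \<partial>M) \<le> (\<integral>x. (b / a) / 2 * (f x)\<^sup>2 + (a / b) / 2 * (g x)\<^sup>2 \<partial>M)"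
  proof (rule integral_mono)
    show "integrable M (\<lambda>x. \<bar>f x * g x\<bar>)" using sq_integrable_mult[OF f g] by simp
    show "integrable M (\<lambda>x. (b / a) / 2 * (f x)\<^sup>2 + (a / b) / 2 * (g x)\<^sup>2)"
      using f g by (simp add: sq_integrable_def)
    fix x
    have "0 \<le> (b * \<bar>f x\<bar> - a * \<bar>g x\<bar>)\<^sup>2" by simp
    then have "2 * (a * b) * \<bar>f x * g x\<bar> \<le> b\<^sup>2 * (f x)\<^sup>2 + a\<^sup>2 * (g x)\<^sup>2"
      by (simp add: power2_diff power_mult_distrib abs_mult algebra_simps)
    then show "\<bar>f x * g x\<bar> \<le> (b / a) / 2 * (f x)\<^sup>2 + (a / b) / 2 * (g x)\<^sup>2"
      using ab by (simp add: field_simps power2_eq_square)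
  qed
  also have "\<dots> = (b / a) / 2 * a\<^sup>2 + (a / b) / 2 * b\<^sup>2"
    using f g by (simp add: sq_integrable_def a_def b_def l2_norm_power2)
  also have "\<dots> = a * b" using ab by (simp add: power2_eq_square)
  finally show ?thesis by (simp add: a_def b_def)
qed

lemma Cauchy_Schwarz_integral:
  assumes f: "sq_integrable M f" and g: "sq_integrable M g"
  shows "\<bar>\<integral>x. f x * g x \<partial>M\<bar> \<le> l2_norm M f * l2_norm M g"
  using Cauchy_Schwarz_integral_abs[OF assms] integral_abs_bound[of M "\<lambda>x. f x * g x"] by linarith

lemma l2_norm_add_power2:
  assumes f: "sq_integrable M f" and g: "sq_integrable M g"
  shows "(l2_norm M (\<lambda>x. f x + g x))\<^sup>2
    = (l2_norm M f)\<^sup>2 + 2 * (\<integral>x. f x * g x \<partial>M) + (l2_norm M g)\<^sup>2"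
  using sq_integrable_mult[OF f g] f g
  by (simp add: l2_norm_power2 power2_sum sq_integrable_def mult.assoc)

lemma l2_norm_cmult: "l2_norm M (\<lambda>x. c * f x) = \<bar>c\<bar> * l2_norm M f"
  by (simp add: l2_norm_def power_mult_distrib real_sqrt_mult)

lemma l2_norm_minus_commute: "l2_norm M (\<lambda>x. f x - g x) = l2_norm M (\<lambda>x. g x - f x)"
  by (simp add: l2_norm_def power2_commute)

lemma l2_norm_triangle:
  assumes f: "sq_integrable M f" and g: "sq_integrable M g"
  shows "l2_norm M (\<lambda>x. f x + g x) \<le> l2_norm M f + l2_norm M g"
proof (rule power2_le_imp_le)
  show "(l2_norm M (\<lambda>x. f x + g x))\<^sup>2 \<le> (l2_norm M f + l2_norm M g)\<^sup>2"
    using Cauchy_Schwarz_integral[OF f g] by (simp add: l2_norm_add_power2[OF f g] power2_sum)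
qed simp

lemma l2_norm_triangle_dist:
  assumes "sq_integrable M f" "sq_integrable M g" "sq_integrable M h"
  shows "l2_norm M (\<lambda>x. f x - h x) \<le> l2_norm M (\<lambda>x. f x - g x) + l2_norm M (\<lambda>x. g x - h x)"
  using l2_norm_triangle[OF sq_integrable_diff[OF assms(1,2)] sq_integrable_diff[OF assms(2,3)]]
  by simp

lemma l2_norm_triangle_diff:
  assumes "sq_integrable M f" "sq_integrable M g"
  shows "l2_norm M f \<le> l2_norm M g + l2_norm M (\<lambda>x. f x - g x)"
  using l2_norm_triangle[OF assms(2) sq_integrable_diff[OF assms]] by simp

lemma l2_norm_tendsto:
  assumes f: "sq_integrable M f" and g: "\<And>n. sq_integrable M (g n)"
    and lim: "(\<lambda>n. l2_norm M (\<lambda>x. f x - g n x)) \<longlonglongrightarrow> 0"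
  shows "(\<lambda>n. l2_norm M (g n)) \<longlonglongrightarrow> l2_norm M f"
proof (rule LIM_zero_cancel, rule Lim_null_comparison[OF always_eventually lim], rule allI)
  fix n
  show "norm (l2_norm M (g n) - l2_norm M f) \<le> l2_norm M (\<lambda>x. f x - g n x)"
    using l2_norm_triangle_diff[OF f g[of n]] l2_norm_triangle_diff[OF g[of n] f]
      l2_norm_minus_commute[of M f "g n"] by auto
qed

text \<open>Convergence of squared distances stated with the non-negative integral, as in the definition of the
  Ito integral, implies that the limit is square integrable.\<close>
lemma nn_integral_power2_tendsto_0:
  assumes f: "f \<in> borel_measurable M" and g: "\<And>n. sq_integrable M (g n)"
    and lim: "(\<lambda>n. \<integral>\<^sup>+x. ennreal ((f x - g n x)\<^sup>2) \<partial>M) \<longlonglongrightarrow> 0"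
  shows "sq_integrable M f" "(\<lambda>n. l2_norm M (\<lambda>x. f x - g n x)) \<longlonglongrightarrow> 0"
proof -
  have "\<forall>\<^sub>F n in sequentially. (\<integral>\<^sup>+x. ennreal ((f x - g n x)\<^sup>2) \<partial>M) < 1"
    by (rule order_tendstoD(2)[OF lim]) simp
  then obtain n where n: "(\<integral>\<^sup>+x. ennreal ((f x - g n x)\<^sup>2) \<partial>M) < 1"
    by (auto simp: eventually_sequentially)
  have m: "(\<lambda>x. f x - g n x) \<in> borel_measurable M" for n
    using f g[THEN sq_integrable_measurable] by simp
  have "sq_integrable M (\<lambda>x. f x - g n x)"
    unfolding sq_integrable_iff_nn_integral using m n by (auto intro: less_trans)
  from sq_integrable_add[OF this g[of n]] show f': "sq_integrable M f" by simp
  have "(\<lambda>n. ennreal ((l2_norm M (\<lambda>x. f x - g n x))\<^sup>2)) \<longlonglongrightarrow> ennreal 0"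
    using lim by (simp add: nn_integral_power2_eq[OF sq_integrable_diff[OF f' g]])
  then have "(\<lambda>n. (l2_norm M (\<lambda>x. f x - g n x))\<^sup>2) \<longlonglongrightarrow> 0"
    by (subst (asm) tendsto_ennreal_iff) auto
  from tendsto_real_sqrt[OF this] show "(\<lambda>n. l2_norm M (\<lambda>x. f x - g n x)) \<longlonglongrightarrow> 0"
    by simp
qed

lemma l2_norm_tendsto_0_nn_integral:
  assumes f: "sq_integrable M f" and g: "\<And>n. sq_integrable M (g n)"
    and lim: "(\<lambda>n. l2_norm M (\<lambda>x. f x - g n x)) \<longlonglongrightarrow> 0"
  shows "(\<lambda>n. \<integral>\<^sup>+x. ennreal ((f x - g n x)\<^sup>2) \<partial>M) \<longlonglongrightarrow> 0"
proof -
  have "(\<lambda>n. ennreal ((l2_norm M (\<lambda>x. f x - g n x))\<^sup>2)) \<longlonglongrightarrow> ennreal (0\<^sup>2)"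
    by (intro tendsto_ennrealI tendsto_power lim)
  then show ?thesis by (simp add: nn_integral_power2_eq[OF sq_integrable_diff[OF f g]])
qed

lemma l2_norm_dominated_convergence:
  assumes f: "f \<in> borel_measurable M" and g: "\<And>n. g n \<in> borel_measurable M"
    and w: "sq_integrable M w"
    and lim: "AE x in M. (\<lambda>n. g n x) \<longlonglongrightarrow> f x"
    and bound: "\<And>n. AE x in M. \<bar>g n x\<bar> \<le> \<bar>w x\<bar>"
  shows "sq_integrable M f" "\<And>n. sq_integrable M (g n)"
    "(\<lambda>n. l2_norm M (\<lambda>x. f x - g n x)) \<longlonglongrightarrow> 0"
proof -
  have bf: "AE x in M. \<bar>f x\<bar> \<le> \<bar>w x\<bar>"
  proof -
    have "AE x in M. \<forall>n. \<bar>g n x\<bar> \<le> \<bar>w x\<bar>" using bound by (simp add: AE_all_countable)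
    with lim show ?thesis
    proof eventually_elim
      case (elim x)
      then show ?case by (intro LIMSEQ_le_const2[OF tendsto_rabs]) auto
    qed
  qed
  show sf: "sq_integrable M f" by (rule sq_integrable_bound[OF w f bf])
  show sg: "sq_integrable M (g n)" for n by (rule sq_integrable_bound[OF w g bound])
  have "(\<lambda>n. \<integral>x. (f x - g n x)\<^sup>2 \<partial>M) \<longlonglongrightarrow> (\<integral>x. 0 \<partial>M)"
  proof (rule integral_dominated_convergence[where w="\<lambda>x. (2 * w x)\<^sup>2"])
    show "integrable M (\<lambda>x. (2 * w x)\<^sup>2)"
      using w by (simp add: sq_integrable_def power_mult_distrib)
    show "AE x in M. (\<lambda>n. (f x - g n x)\<^sup>2) \<longlonglongrightarrow> 0"
      using lim
    proof eventually_elim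
      case (elim x)
      have "(\<lambda>n. (f x - g n x)\<^sup>2) \<longlonglongrightarrow> (f x - f x)\<^sup>2" by (intro tendsto_intros elim)
      then show ?case by simp
    qed
    show "AE x in M. norm ((f x - g n x)\<^sup>2) \<le> (2 * w x)\<^sup>2" for n
      using bf bound[of n]
    proof eventually_elim
      case (elim x)
      then have "\<bar>f x - g n x\<bar> \<le> \<bar>2 * w x\<bar>" by linarith
      then show ?case by (simp add: abs_le_square_iff del: power_mult_distrib)
    qed
  qed (use f g in simp_all)
  from tendsto_real_sqrt[OF this] show "(\<lambda>n. l2_norm M (\<lambda>x. f x - g n x)) \<longlonglongrightarrow> 0"
    by (simp add: l2_norm_def)
qed

text \<open>Completeness of \<open>L\<^sup>2\<close> for sequences with a geometric Cauchy rate. On a probability space the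
  \<open>L\<^sup>1\<close>-norm is at most the \<open>L\<^sup>2\<close>-norm, so the increments are almost surely summable; Fatou identifies
  the pointwise limit as the \<open>L\<^sup>2\<close>-limit.\<close>
lemma (in prob_space) l2_complete:
  assumes Y: "\<And>n. sq_integrable M (Y n)"
    and C: "\<And>m n. n \<le> m \<Longrightarrow> l2_norm M (\<lambda>x. Y m x - Y n x) \<le> (1/2)^n"
  shows "\<exists>Z. sq_integrable M Z \<and> (\<lambda>n. l2_norm M (\<lambda>x. Z x - Y n x)) \<longlonglongrightarrow> 0"
proof -
  have Ym[measurable]: "Y n \<in> borel_measurable M" for n using Y by (simp add: sq_integrable_def)
  have one: "sq_integrable M (\<lambda>x. 1)" "l2_norm M (\<lambda>x. 1) = 1"
    by (simp_all add: sq_integrable_def l2_norm_def prob_space)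
  have d1: "(\<integral>\<^sup>+x. ennreal \<bar>Y (Suc n) x - Y n x\<bar> \<partial>M) \<le> ennreal ((1/2)^n)" for n
  proof -
    have s: "sq_integrable M (\<lambda>x. Y (Suc n) x - Y n x)" by (intro sq_integrable_diff Y)
    have "(\<integral>\<^sup>+x. ennreal \<bar>Y (Suc n) x - Y n x\<bar> \<partial>M) = ennreal (\<integral>x. \<bar>(Y (Suc n) x - Y n x) * 1\<bar> \<partial>M)"
      using sq_integrable_mult[OF s one(1)] by (subst nn_integral_eq_integral) auto
    also have "\<dots> \<le> ennreal ((1/2)^n)"
      using Cauchy_Schwarz_integral_abs[OF s one(1)] C[of n "Suc n"] by (intro ennreal_leI) (simp add: one)
    finally show ?thesis .
  qed
  have "(\<integral>\<^sup>+x. (\<Sum>n. ennreal \<bar>Y (Suc n) x - Y n x\<bar>) \<partial>M) = (\<Sum>n. \<integral>\<^sup>+x. ennreal \<bar>Y (Suc n) x - Y n x\<bar> \<partial>M)"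
    by (rule nn_integral_suminf) simp
  also have "\<dots> \<le> (\<Sum>n. ennreal ((1/2)^n))" by (intro suminf_le d1) auto
  also have "\<dots> < \<infinity>" by (subst suminf_ennreal2) (auto simp: summable_geometric)
  finally have "AE x in M. (\<Sum>n. ennreal \<bar>Y (Suc n) x - Y n x\<bar>) \<noteq> \<infinity>"
    by (intro nn_integral_PInf_AE) auto
  then have conv: "AE x in M. convergent (\<lambda>n. Y n x)"
  proof eventually_elim
    case (elim x)
    then have "summable (\<lambda>n. \<bar>Y (Suc n) x - Y n x\<bar>)"
      by (intro summable_suminf_not_top) auto
    then have "summable (\<lambda>n. Y (Suc n) x - Y n x)" by (rule summable_rabs_cancel)
    then have "convergent (\<lambda>n. \<Sum>i<n. Y (Suc i) x - Y i x)"
      by (simp add: summable_iff_convergent)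
    then have "convergent (\<lambda>n. Y n x - Y 0 x)"
      by (simp add: sum_lessThan_telescope[of "\<lambda>n. Y n x"])
    then show ?case by (simp add: convergent_diff_const_right_iff)
  qed
  define Z where "Z x = lim (\<lambda>n. Y n x)" for x
  have [measurable]: "Z \<in> borel_measurable M" unfolding Z_def by measurable
  have lim: "AE x in M. (\<lambda>n. Y n x) \<longlonglongrightarrow> Z x"
    using conv by eventually_elim (simp add: Z_def convergent_LIMSEQ_iff)
  have bd: "(\<integral>\<^sup>+x. ennreal ((Z x - Y n x)\<^sup>2) \<partial>M) \<le> ennreal (((1/2)^n)\<^sup>2)" for n
  proof -
    have "(\<integral>\<^sup>+x. ennreal ((Z x - Y n x)\<^sup>2) \<partial>M) = (\<integral>\<^sup>+x. liminf (\<lambda>m. ennreal ((Y m x - Y n x)\<^sup>2)) \<partial>M)"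
      using lim
    proof (intro nn_integral_cong_AE, eventually_elim)
      case (elim x)
      have "(\<lambda>m. ennreal ((Y m x - Y n x)\<^sup>2)) \<longlonglongrightarrow> ennreal ((Z x - Y n x)\<^sup>2)"
        by (intro tendsto_ennrealI tendsto_intros elim)
      then show ?case by (intro lim_imp_Liminf[symmetric]) auto
    qed
    also have "\<dots> \<le> liminf (\<lambda>m. \<integral>\<^sup>+x. ennreal ((Y m x - Y n x)\<^sup>2) \<partial>M)"
      by (rule nn_integral_liminf) simp
    also have "\<dots> \<le> ennreal (((1/2)^n)\<^sup>2)"
    proof (rule Liminf_le)
      show "\<forall>\<^sub>F m in sequentially. (\<integral>\<^sup>+x. ennreal ((Y m x - Y n x)\<^sup>2) \<partial>M) \<le> ennreal (((1/2)^n)\<^sup>2)"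
        using eventually_ge_at_top[of n]
        by eventually_elim
          (auto simp: nn_integral_power2_eq[OF sq_integrable_diff[OF Y Y]] intro!: ennreal_leI power_mono C)
    qed simp
    finally show ?thesis .
  qed
  have lim0: "(\<lambda>n. \<integral>\<^sup>+x. ennreal ((Z x - Y n x)\<^sup>2) \<partial>M) \<longlonglongrightarrow> 0"
  proof (rule tendsto_sandwich[OF always_eventually always_eventually tendsto_const])
    have "(\<lambda>n. ennreal (((1/2::real)^n)\<^sup>2)) \<longlonglongrightarrow> ennreal (0\<^sup>2)"
      by (intro tendsto_ennrealI tendsto_power LIMSEQ_power_zero) simp
    then show "(\<lambda>n. ennreal (((1/2::real)^n)\<^sup>2)) \<longlonglongrightarrow> 0" by simp
  qed (use bd in auto)
  show ?thesis
    using nn_integral_power2_tendsto_0[OF _ Y lim0] by (intro exI[of _ Z]) auto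
qed

text \<open>Minkowski's integral inequality in qualitative form: if the norms of \<open>h r\<close> are integrable in \<open>r\<close>, then
  the pointwise integral over \<open>r\<close> converges absolutely almost everywhere, lies in \<open>L\<^sup>2\<close>, and commutes with
  inner products.\<close>
lemma l2_norm_integral_bound:
  fixes h :: "'r \<Rightarrow> 'b \<Rightarrow> real"
  assumes mu: "sigma_finite_measure \<mu>" and N: "sigma_finite_measure N"
    and h[measurable]: "(\<lambda>(r, x). h r x) \<in> borel_measurable (\<mu> \<Otimes>\<^sub>M N)"
    and sq: "\<And>r. r \<in> space \<mu> \<Longrightarrow> sq_integrable N (h r)"
    and fin: "(\<integral>\<^sup>+r. ennreal (l2_norm N (h r)) \<partial>\<mu>) < \<infinity>"
  shows "AE x in N. integrable \<mu> (\<lambda>r. h r x)"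
    and "sq_integrable N (\<lambda>x. \<integral>r. h r x \<partial>\<mu>)"
    and "\<And>W. sq_integrable N W \<Longrightarrow>
      (\<integral>x. W x * (\<integral>r. h r x \<partial>\<mu>) \<partial>N) = (\<integral>r. (\<integral>x. W x * h r x \<partial>N) \<partial>\<mu>)"
proof -
  interpret mu: sigma_finite_measure \<mu> by fact
  interpret N: sigma_finite_measure N by fact
  interpret P: pair_sigma_finite \<mu> N ..
  define c where "c r = l2_norm N (h r)" for r
  have [measurable]: "c \<in> borel_measurable \<mu>"
    unfolding c_def l2_norm_def by measurable
  define H where "H x = (\<integral>\<^sup>+r. ennreal \<bar>h r x\<bar> \<partial>\<mu>)" for x
  have [measurable]: "H \<in> borel_measurable N" unfolding H_def by measurable
  have hx[measurable]: "(\<lambda>r. h r x) \<in> borel_measurable \<mu>" if "x \<in> space N" for x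
    using that by measurable
  have inner: "(\<integral>\<^sup>+x. ennreal \<bar>h r x\<bar> * ennreal \<bar>h r' x\<bar> \<partial>N) \<le> ennreal (c r) * ennreal (c r')"
    if "r \<in> space \<mu>" "r' \<in> space \<mu>" for r r'
  proof -
    have "(\<integral>\<^sup>+x. ennreal \<bar>h r x\<bar> * ennreal \<bar>h r' x\<bar> \<partial>N) = ennreal (\<integral>x. \<bar>h r x * h r' x\<bar> \<partial>N)"
      using integrable_abs[OF sq_integrable_mult[OF sq sq, OF that]]
      by (subst nn_integral_eq_integral[symmetric]) (auto simp: abs_mult ennreal_mult)
    also have "\<dots> \<le> ennreal (c r * c r')"
      unfolding c_def by (intro ennreal_leI Cauchy_Schwarz_integral_abs sq that)
    finally show ?thesis by (simp add: ennreal_mult c_def)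
  qed
  \<comment> \<open>write the square of an integral over \<open>r\<close> as a double integral and apply Tonelli and Cauchy-Schwarz\<close>
  have "(\<integral>\<^sup>+x. (H x)\<^sup>2 \<partial>N) = (\<integral>\<^sup>+x. (\<integral>\<^sup>+r. ennreal \<bar>h r x\<bar> * H x \<partial>\<mu>) \<partial>N)"
    by (intro nn_integral_cong, subst nn_integral_multc) (auto simp: H_def power2_eq_square)
  also have "\<dots> = (\<integral>\<^sup>+r. (\<integral>\<^sup>+x. ennreal \<bar>h r x\<bar> * H x \<partial>N) \<partial>\<mu>)"
    by (rule P.Fubini') measurable
  also have "\<dots> = (\<integral>\<^sup>+r. (\<integral>\<^sup>+x. (\<integral>\<^sup>+r'. ennreal \<bar>h r x\<bar> * ennreal \<bar>h r' x\<bar> \<partial>\<mu>) \<partial>N) \<partial>\<mu>)"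
    unfolding H_def by (intro nn_integral_cong nn_integral_cmult[symmetric]) auto
  also have "\<dots> = (\<integral>\<^sup>+r. (\<integral>\<^sup>+r'. (\<integral>\<^sup>+x. ennreal \<bar>h r x\<bar> * ennreal \<bar>h r' x\<bar> \<partial>N) \<partial>\<mu>) \<partial>\<mu>)"
    by (intro nn_integral_cong P.Fubini') measurable
  also have "\<dots> \<le> (\<integral>\<^sup>+r. (\<integral>\<^sup>+r'. ennreal (c r) * ennreal (c r') \<partial>\<mu>) \<partial>\<mu>)"
    by (intro nn_integral_mono inner) auto
  also have "\<dots> = (\<integral>\<^sup>+r. ennreal (c r) * (\<integral>\<^sup>+r'. ennreal (c r') \<partial>\<mu>) \<partial>\<mu>)"
    by (intro nn_integral_cong nn_integral_cmult) auto
  also have "\<dots> = (\<integral>\<^sup>+r. ennreal (c r) \<partial>\<mu>) * (\<integral>\<^sup>+r'. ennreal (c r') \<partial>\<mu>)"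
    by (rule nn_integral_multc) auto
  also have "\<dots> < \<infinity>" using fin by (simp add: c_def ennreal_mult_less_top)
  finally have H2: "(\<integral>\<^sup>+x. (H x)\<^sup>2 \<partial>N) < \<infinity>" .
  then have "AE x in N. (H x)\<^sup>2 \<noteq> \<infinity>" by (intro nn_integral_PInf_AE) auto
  then have Hfin: "AE x in N. H x < \<infinity>"
    by eventually_elim (auto simp: less_top power2_eq_square ennreal_mult_eq_top_iff)
  show AE: "AE x in N. integrable \<mu> (\<lambda>r. h r x)"
    using Hfin AE_space by eventually_elim (auto simp: integrable_iff_bounded H_def)
  have [measurable]: "(\<lambda>x. \<integral>r. h r x \<partial>\<mu>) \<in> borel_measurable N" by measurable
  show G: "sq_integrable N (\<lambda>x. \<integral>r. h r x \<partial>\<mu>)"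
    unfolding sq_integrable_iff_nn_integral
  proof
    have "(\<integral>\<^sup>+x. ennreal ((\<integral>r. h r x \<partial>\<mu>)\<^sup>2) \<partial>N) \<le> (\<integral>\<^sup>+x. (H x)\<^sup>2 \<partial>N)"
      using AE
    proof (intro nn_integral_mono_AE, eventually_elim)
      case (elim x)
      have "ennreal \<bar>\<integral>r. h r x \<partial>\<mu>\<bar> \<le> H x"
        using integral_norm_bound_ennreal[OF elim(2)] by (simp add: H_def)
      then have "(ennreal \<bar>\<integral>r. h r x \<partial>\<mu>\<bar>)\<^sup>2 \<le> (H x)\<^sup>2" by (rule power_mono) simp
      then show ?case by (simp add: ennreal_power)
    qed
    also note H2
    finally show "(\<integral>\<^sup>+x. ennreal ((\<integral>r. h r x \<partial>\<mu>)\<^sup>2) \<partial>N) < \<infinity>" .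
  qed measurable
  show "(\<integral>x. W x * (\<integral>r. h r x \<partial>\<mu>) \<partial>N) = (\<integral>r. (\<integral>x. W x * h r x \<partial>N) \<partial>\<mu>)"
    if W: "sq_integrable N W" for W
  proof -
    have [measurable]: "W \<in> borel_measurable N" using W by (simp add: sq_integrable_def)
    have "integrable (\<mu> \<Otimes>\<^sub>M N) (\<lambda>(r, x). W x * h r x)"
      unfolding integrable_iff_bounded
    proof
      have "(\<integral>\<^sup>+z. ennreal (norm (case z of (r, x) \<Rightarrow> W x * h r x)) \<partial>(\<mu> \<Otimes>\<^sub>M N))
        = (\<integral>\<^sup>+r. (\<integral>\<^sup>+x. ennreal \<bar>W x * h r x\<bar> \<partial>N) \<partial>\<mu>)"
        by (subst N.nn_integral_fst[symmetric]) auto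
      also have "\<dots> \<le> (\<integral>\<^sup>+r. ennreal (l2_norm N W) * ennreal (c r) \<partial>\<mu>)"
      proof (rule nn_integral_mono)
        fix r assume r: "r \<in> space \<mu>"
        have "(\<integral>\<^sup>+x. ennreal \<bar>W x * h r x\<bar> \<partial>N) = ennreal (\<integral>x. \<bar>W x * h r x\<bar> \<partial>N)"
          using sq_integrable_mult[OF W sq, OF r] by (subst nn_integral_eq_integral) auto
        also have "\<dots> \<le> ennreal (l2_norm N W * c r)"
          unfolding c_def by (intro ennreal_leI Cauchy_Schwarz_integral_abs W sq r)
        finally show "(\<integral>\<^sup>+x. ennreal \<bar>W x * h r x\<bar> \<partial>N) \<le> ennreal (l2_norm N W) * ennreal (c r)"
          by (simp add: ennreal_mult c_def)
      qed
      also have "\<dots> = ennreal (l2_norm N W) * (\<integral>\<^sup>+r. ennreal (c r) \<partial>\<mu>)"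
        by (rule nn_integral_cmult) simp
      also have "\<dots> < \<infinity>" using fin by (simp add: c_def ennreal_mult_less_top)
      finally show "(\<integral>\<^sup>+z. ennreal (norm (case z of (r, x) \<Rightarrow> W x * h r x)) \<partial>(\<mu> \<Otimes>\<^sub>M N)) < \<infinity>" .
    qed measurable
    from P.Fubini_integral[OF this]
    show ?thesis by simp
  qed
qed

text \<open>An isometry between \<open>L\<^sup>2(N)\<close> and \<open>L\<^sup>2(M)\<close> that sends \<open>h r\<close> to \<open>X r\<close> and \<open>\<integral>r. h r \<partial>\<mu>\<close> to \<open>Y\<close> commutes with the
  integral: \<open>Y\<close> is almost everywhere the pathwise integral of \<open>X\<close>. Only the inner products of these
  particular functions enter.\<close>
lemma isometry_commutes_with_integral:
  fixes h :: "'r \<Rightarrow> 'b \<Rightarrow> real" and X :: "'r \<Rightarrow> 'c \<Rightarrow> real"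
  assumes mu: "sigma_finite_measure \<mu>" and N: "sigma_finite_measure N" and M: "sigma_finite_measure M"
    and h: "(\<lambda>(r, x). h r x) \<in> borel_measurable (\<mu> \<Otimes>\<^sub>M N)"
    and X: "(\<lambda>(r, x). X r x) \<in> borel_measurable (\<mu> \<Otimes>\<^sub>M M)"
    and sqh: "\<And>r. r \<in> space \<mu> \<Longrightarrow> sq_integrable N (h r)"
    and sqX: "\<And>r. r \<in> space \<mu> \<Longrightarrow> sq_integrable M (X r)"
    and fin: "(\<integral>\<^sup>+r. ennreal (l2_norm N (h r)) \<partial>\<mu>) < \<infinity>"
    and iso: "\<And>r r'. r \<in> space \<mu> \<Longrightarrow> r' \<in> space \<mu> \<Longrightarrow>
      (\<integral>x. X r x * X r' x \<partial>M) = (\<integral>x. h r x * h r' x \<partial>N)"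
    and sqY: "sq_integrable M Y"
    and isoY: "\<And>r. r \<in> space \<mu> \<Longrightarrow>
      (\<integral>x. Y x * X r x \<partial>M) = (\<integral>x. (\<integral>r. h r x \<partial>\<mu>) * h r x \<partial>N)"
    and isoYY: "(\<integral>x. Y x * Y x \<partial>M) = (\<integral>x. (\<integral>r. h r x \<partial>\<mu>) * (\<integral>r. h r x \<partial>\<mu>) \<partial>N)"
  shows "AE x in M. integrable \<mu> (\<lambda>r. X r x) \<and> Y x = (\<integral>r. X r x \<partial>\<mu>)"
proof -
  define G where "G x = (\<integral>r. h r x \<partial>\<mu>)" for x
  define Z where "Z x = (\<integral>r. X r x \<partial>\<mu>)" for x
  have "l2_norm M (X r) = l2_norm N (h r)" if "r \<in> space \<mu>" for r
    using iso[OF that that] by (simp add: l2_norm_def power2_eq_square)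
  then have fin': "(\<integral>\<^sup>+r. ennreal (l2_norm M (X r)) \<partial>\<mu>) < \<infinity>"
    using fin by (simp cong: nn_integral_cong)
  have sqG: "sq_integrable N G"
    unfolding G_def[abs_def] by (rule l2_norm_integral_bound(2)[OF mu N h _ fin]) (fact sqh)
  have sqZ: "sq_integrable M Z"
    unfolding Z_def[abs_def] by (rule l2_norm_integral_bound(2)[OF mu M X _ fin']) (fact sqX)
  have hh: "(\<integral>x. W x * G x \<partial>N) = (\<integral>r. (\<integral>x. W x * h r x \<partial>N) \<partial>\<mu>)" if "sq_integrable N W" for W
    unfolding G_def by (rule l2_norm_integral_bound(3)[OF mu N h _ fin that]) (fact sqh)
  have XX: "(\<integral>x. W x * Z x \<partial>M) = (\<integral>r. (\<integral>x. W x * X r x \<partial>M) \<partial>\<mu>)" if "sq_integrable M W" for W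
    unfolding Z_def by (rule l2_norm_integral_bound(3)[OF mu M X _ fin' that]) (fact sqX)
  have X1: "AE x in M. integrable \<mu> (\<lambda>r. X r x)"
    by (rule l2_norm_integral_bound(1)[OF mu M X _ fin']) (fact sqX)
  have GG: "(\<integral>r. (\<integral>x. G x * h r x \<partial>N) \<partial>\<mu>) = (\<integral>x. G x * G x \<partial>N)"
    using hh[OF sqG] by simp
  have YZ: "(\<integral>x. Y x * Z x \<partial>M) = (\<integral>x. G x * G x \<partial>N)"
    unfolding XX[OF sqY] GG[symmetric]
    by (intro Bochner_Integration.integral_cong refl) (simp add: isoY G_def)
  have XZ: "(\<integral>x. Z x * X r x \<partial>M) = (\<integral>x. G x * h r x \<partial>N)" if r: "r \<in> space \<mu>" for r
  proof -
    have "(\<integral>x. Z x * X r x \<partial>M) = (\<integral>x. X r x * Z x \<partial>M)" by (simp add: mult.commute)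
    also have "\<dots> = (\<integral>r'. (\<integral>x. h r x * h r' x \<partial>N) \<partial>\<mu>)"
      unfolding XX[OF sqX[OF r]]
      by (intro Bochner_Integration.integral_cong refl) (simp add: iso r)
    also have "\<dots> = (\<integral>x. h r x * G x \<partial>N)" by (rule hh[OF sqh[OF r], symmetric])
    finally show ?thesis by (simp add: mult.commute)
  qed
  have ZZ: "(\<integral>x. Z x * Z x \<partial>M) = (\<integral>x. G x * G x \<partial>N)"
    unfolding XX[OF sqZ] GG[symmetric]
    by (intro Bochner_Integration.integral_cong refl) (simp add: XZ)
  have "(l2_norm M (\<lambda>x. Y x + (- 1) * Z x))\<^sup>2 = 0"
    unfolding l2_norm_add_power2[OF sqY sq_integrable_cmult[OF sqZ]]
    unfolding l2_norm_cmult power_mult_distrib l2_norm_power2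
    using YZ ZZ isoYY by (simp add: power2_eq_square G_def)
  then have "AE x in M. Y x + (- 1) * Z x = 0"
    by (intro l2_norm_eq_0_AE sq_integrable_add sqY sq_integrable_cmult[OF sqZ]) simp
  with X1 show ?thesis by eventually_elim (simp add: Z_def)
qed

section \<open>The variation function\<close>

lemma variation_sumsI:
  "mono_on {..n} x \<Longrightarrow> x ` {..n} \<subseteq> {a..b} \<Longrightarrow>
    (\<Sum>i<n. \<bar>f (x (Suc i)) - f (x i)\<bar>) \<in> variation_sums f a b"
  unfolding variation_sums_def by blast

lemma variation_sumsE:
  assumes "v \<in> variation_sums f a b"
  obtains n x where "mono_on {..n} x" "x ` {..n} \<subseteq> {a..b}" "v = (\<Sum>i<n. \<bar>f (x (Suc i)) - f (x i)\<bar>)"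
  using assms unfolding variation_sums_def by blast

lemma abs_diff_mem_variation_sums:
  assumes "a \<le> b"
  shows "\<bar>f b - f a\<bar> \<in> variation_sums f a b"
proof -
  have "(\<Sum>i<Suc 0. \<bar>f ((if Suc i = 0 then a else b)) - f (if i = 0 then a else b)\<bar>) \<in> variation_sums f a b"
    by (rule variation_sumsI) (use assms in \<open>auto simp: monotone_on_def\<close>)
  then show ?thesis by simp
qed

lemma zero_mem_variation_sums:
  assumes "a \<le> b"
  shows "0 \<in> variation_sums f a b"
  using variation_sumsI[of 0 "\<lambda>_. a" a b f] assms by (simp add: monotone_on_def)

lemma Sup_variation_sums_same [simp]: "Sup (variation_sums f a a) = 0"
proof -
  have "variation_sums f a a = {0}"
  proof (intro equalityI subsetI)
    fix v assume "v \<in> variation_sums f a a"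
    then obtain n x where x: "x ` {..n} \<subseteq> {a..a}" "v = (\<Sum>i<n. \<bar>f (x (Suc i)) - f (x i)\<bar>)"
      by (rule variation_sumsE)
    have "x i = a" if "i \<le> n" for i using x(1) that by auto
    then show "v \<in> {0}" unfolding x(2) by simp
  qed (simp add: zero_mem_variation_sums)
  then show ?thesis by simp
qed

lemma sum_lessThan_add:
  fixes g :: "nat \<Rightarrow> real"
  shows "(\<Sum>i<n + m. g i) = (\<Sum>i<n. g i) + (\<Sum>i<m. g (n + i))"
  by (induction m) (simp_all add: add.assoc)

lemma locally_bounded_variationD:
  "locally_bounded_variation f \<Longrightarrow> bdd_above (variation_sums f a b)"
  by (simp add: locally_bounded_variation_def)

text \<open>A partition of \<open>{a..c}\<close> is split at \<open>b\<close> by clipping its points with \<open>min\<close> and \<open>max\<close>. The identity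
  \<open>f x = f (min x b) + f (max x b) - f b\<close> replaces a search for the cell containing \<open>b\<close>.\<close>
lemma clip_variation_sum:
  fixes f :: "real \<Rightarrow> real"
  assumes "mono_on {..n} z" "z ` {..n} \<subseteq> {a..c}" "a \<le> b" "b \<le> c"
  shows "(\<Sum>i<n. \<bar>f (z (Suc i)) - f (z i)\<bar>)
      \<le> (\<Sum>i<n. \<bar>f (min (z (Suc i)) b) - f (min (z i) b)\<bar>) + (\<Sum>i<n. \<bar>f (max (z (Suc i)) b) - f (max (z i) b)\<bar>)"
    and "(\<Sum>i<n. \<bar>f (min (z (Suc i)) b) - f (min (z i) b)\<bar>) \<in> variation_sums f a b"
    and "(\<Sum>i<n. \<bar>f (max (z (Suc i)) b) - f (max (z i) b)\<bar>) \<in> variation_sums f b c"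
proof -
  have eq: "f x = f (min x b) + f (max x b) - f b" for x by (cases "x \<le> b") (auto simp: min_def max_def)
  show "(\<Sum>i<n. \<bar>f (z (Suc i)) - f (z i)\<bar>)
      \<le> (\<Sum>i<n. \<bar>f (min (z (Suc i)) b) - f (min (z i) b)\<bar>) + (\<Sum>i<n. \<bar>f (max (z (Suc i)) b) - f (max (z i) b)\<bar>)"
    unfolding sum.distrib[symmetric]
  proof (rule sum_mono)
    fix i
    show "\<bar>f (z (Suc i)) - f (z i)\<bar>
      \<le> \<bar>f (min (z (Suc i)) b) - f (min (z i) b)\<bar> + \<bar>f (max (z (Suc i)) b) - f (max (z i) b)\<bar>"
      using eq[of "z (Suc i)"] eq[of "z i"] by linarith
  qed
  have in_ac: "a \<le> z i \<and> z i \<le> c" if "i \<le> n" for i using assms(2) that by auto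
  show "(\<Sum>i<n. \<bar>f (min (z (Suc i)) b) - f (min (z i) b)\<bar>) \<in> variation_sums f a b"
  proof (rule variation_sumsI[of n "\<lambda>i. min (z i) b"])
    show "mono_on {..n} (\<lambda>i. min (z i) b)"
      using assms(1) by (intro mono_onI min.mono order_refl) (auto intro: mono_onD)
    show "(\<lambda>i. min (z i) b) ` {..n} \<subseteq> {a..b}" using in_ac assms(3) by auto
  qed
  show "(\<Sum>i<n. \<bar>f (max (z (Suc i)) b) - f (max (z i) b)\<bar>) \<in> variation_sums f b c"
  proof (rule variation_sumsI[of n "\<lambda>i. max (z i) b"])
    show "mono_on {..n} (\<lambda>i. max (z i) b)"
      using assms(1) by (intro mono_onI max.mono order_refl) (auto intro: mono_onD)
    show "(\<lambda>i. max (z i) b) ` {..n} \<subseteq> {b..c}" using in_ac assms(4) by auto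
  qed
qed

lemma variation_additive:
  assumes bv: "locally_bounded_variation f" and "a \<le> b" "b \<le> c"
  shows "Sup (variation_sums f a c) = Sup (variation_sums f a b) + Sup (variation_sums f b c)"
proof (rule antisym)
  note bdd = locally_bounded_variationD[OF bv]
  show "Sup (variation_sums f a c) \<le> Sup (variation_sums f a b) + Sup (variation_sums f b c)"
  proof (rule cSup_least)
    show "variation_sums f a c \<noteq> {}" using zero_mem_variation_sums[of a c f] assms by auto
    fix v assume "v \<in> variation_sums f a c"
    then obtain n z where z: "mono_on {..n} z" "z ` {..n} \<subseteq> {a..c}"
      "v = (\<Sum>i<n. \<bar>f (z (Suc i)) - f (z i)\<bar>)" by (rule variation_sumsE)
    note clip = clip_variation_sum[OF z(1,2) assms(2,3), of f]
    show "v \<le> Sup (variation_sums f a b) + Sup (variation_sums f b c)"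
      using clip(1) cSup_upper[OF clip(2) bdd] cSup_upper[OF clip(3) bdd] z(3) by linarith
  qed
  have le: "v + w \<le> Sup (variation_sums f a c)"
    if v: "v \<in> variation_sums f a b" and w: "w \<in> variation_sums f b c" for v w
  proof -
    obtain n x where x: "mono_on {..n} x" "x ` {..n} \<subseteq> {a..b}"
      "v = (\<Sum>i<n. \<bar>f (x (Suc i)) - f (x i)\<bar>)" using v by (rule variation_sumsE)
    obtain m y where y: "mono_on {..m} y" "y ` {..m} \<subseteq> {b..c}"
      "w = (\<Sum>i<m. \<bar>f (y (Suc i)) - f (y i)\<bar>)" using w by (rule variation_sumsE)
    \<comment> \<open>the concatenation of the two partitions; its extra step, from \<open>x n\<close> to \<open>y 0\<close>, only adds variation\<close>
    define z where "z i = (if i \<le> n then x i else y (i - Suc n))" for i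
    have xab: "a \<le> x i \<and> x i \<le> b" if "i \<le> n" for i using x(2) that by auto
    have ybc: "b \<le> y i \<and> y i \<le> c" if "i \<le> m" for i using y(2) that by auto
    have "(\<Sum>i<Suc n + m. \<bar>f (z (Suc i)) - f (z i)\<bar>) \<in> variation_sums f a c"
    proof (rule variation_sumsI)
      show "mono_on {..Suc n + m} z"
      proof (rule mono_onI)
        fix i j assume ij: "i \<in> {..Suc n + m}" "j \<in> {..Suc n + m}" "i \<le> j"
        consider "j \<le> n" | "i \<le> n" "n < j" | "n < i" using ij by linarith
        then show "z i \<le> z j"
        proof cases
          case 1 then show ?thesis using x(1) ij by (auto simp: z_def monotone_on_def)
        next
          case 2
          have "j - Suc n \<le> m" using ij(2) by auto
          then have "x i \<le> y (j - Suc n)"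
            using xab[OF 2(1)] ybc[of "j - Suc n"] by linarith
          then show ?thesis using 2 by (simp add: z_def)
        next
          case 3
          then have "y (i - Suc n) \<le> y (j - Suc n)"
            using ij by (intro mono_onD[OF y(1)]) auto
          then show ?thesis using 3 ij by (auto simp: z_def)
        qed
      qed
      have "z i \<in> {a..c}" if "i \<le> Suc n + m" for i
      proof (cases "i \<le> n")
        case False
        then have "i - Suc n \<le> m" using that by auto
        from ybc[OF this] show ?thesis using False assms(2) by (simp add: z_def)
      qed (use xab[of i] assms(3) in \<open>simp add: z_def\<close>)
      then show "z ` {..Suc n + m} \<subseteq> {a..c}" by auto
    qed
    then have "(\<Sum>i<Suc n + m. \<bar>f (z (Suc i)) - f (z i)\<bar>) \<le> Sup (variation_sums f a c)"
      by (rule cSup_upper) (rule bdd)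
    moreover have "(\<Sum>i<Suc n + m. \<bar>f (z (Suc i)) - f (z i)\<bar>)
      = v + \<bar>f (z (Suc n)) - f (z n)\<bar> + w"
    proof -
      have "(\<Sum>i<n. \<bar>f (z (Suc i)) - f (z i)\<bar>) = v"
        unfolding x(3) by (intro sum.cong) (auto simp: z_def)
      moreover have "(\<Sum>i<m. \<bar>f (z (Suc (Suc n + i))) - f (z (Suc n + i))\<bar>) = w"
        unfolding y(3) by (intro sum.cong) (auto simp: z_def)
      ultimately show ?thesis
        unfolding sum_lessThan_add sum.lessThan_Suc by simp
    qed
    ultimately show ?thesis by linarith
  qed
  have "Sup (variation_sums f a b) \<le> Sup (variation_sums f a c) - w" if w: "w \<in> variation_sums f b c" for w
  proof (rule cSup_least)
    show "variation_sums f a b \<noteq> {}" using zero_mem_variation_sums[OF assms(2), of f] by auto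
    show "v \<le> Sup (variation_sums f a c) - w" if "v \<in> variation_sums f a b" for v
      using le[OF that w] by linarith
  qed
  then have "w \<le> Sup (variation_sums f a c) - Sup (variation_sums f a b)" if "w \<in> variation_sums f b c" for w
    using that by (simp add: le_diff_eq add.commute)
  then have "Sup (variation_sums f b c) \<le> Sup (variation_sums f a c) - Sup (variation_sums f a b)"
    using zero_mem_variation_sums[of b c f] assms(3) by (intro cSup_least) auto
  then show "Sup (variation_sums f a b) + Sup (variation_sums f b c) \<le> Sup (variation_sums f a c)"
    by simp
qed

lemma variation_function_diff:
  assumes bv: "locally_bounded_variation f" and "x \<le> y"
  shows "variation_function f y - variation_function f x = Sup (variation_sums f x y)"
proof -
  consider "0 \<le> x" | "x < 0" "0 \<le> y" | "y < 0" using assms by linarith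
  then show ?thesis
  proof cases
    case 1
    then show ?thesis using variation_additive[OF bv, of 0 x y] assms(2)
      unfolding variation_function_def by simp
  next
    case 2
    then show ?thesis using variation_additive[OF bv, of x 0 y]
      unfolding variation_function_def by simp
  next
    case 3
    then show ?thesis using variation_additive[OF bv, of x y 0] assms(2)
      unfolding variation_function_def by simp
  qed
qed

lemma abs_diff_le_variation_function:
  assumes bv: "locally_bounded_variation f" and "x \<le> y"
  shows "\<bar>f y - f x\<bar> \<le> variation_function f y - variation_function f x"
  unfolding variation_function_diff[OF assms]
  by (intro cSup_upper abs_diff_mem_variation_sums locally_bounded_variationD assms)

lemma mono_variation_function:
  assumes "locally_bounded_variation f" "x \<le> y"
  shows "variation_function f x \<le> variation_function f y"
  using abs_diff_le_variation_function[OF assms] by linarith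

text \<open>A partition of \<open>{c..c + 1}\<close> whose sum is almost the total variation can be clipped at a point
  \<open>d > c\<close>; the part below \<open>d\<close> has a fixed number of terms, each of which vanishes as \<open>d\<close> tends to
  \<open>c\<close>, so nearly all of the variation is carried by \<open>{d..c + 1}\<close>.\<close>
lemma variation_function_right_continuous:
  assumes bv: "locally_bounded_variation f" and cont: "continuous_on UNIV f"
  shows "continuous (at_right c) (variation_function f)"
  unfolding continuous_within
proof (rule order_tendstoI)
  fix l assume "l < variation_function f c"
  then have "l < variation_function f d" if "c < d" for d
    using mono_variation_function[OF bv, of c d] that by linarith
  then show "\<forall>\<^sub>F d in at_right c. l < variation_function f d"
    using eventually_at_right_less[of c] by (auto elim: eventually_mono)
next
  fix u assume u: "variation_function f c < u"
  define e where "e = (u - variation_function f c) / 2"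
  have e: "0 < e" using u by (simp add: e_def)
  obtain v where v: "v \<in> variation_sums f c (c + 1)" "Sup (variation_sums f c (c + 1)) - e < v"
    using less_cSup_iff[of "variation_sums f c (c + 1)" "Sup (variation_sums f c (c + 1)) - e"]
      zero_mem_variation_sums[of c "c + 1" f] locally_bounded_variationD[OF bv] e by auto
  obtain n z where z: "mono_on {..n} z" "z ` {..n} \<subseteq> {c..c + 1}"
    "v = (\<Sum>i<n. \<bar>f (z (Suc i)) - f (z i)\<bar>)" using v(1) by (rule variation_sumsE)
  have lim: "((\<lambda>d. f (min (z i) d)) \<longlongrightarrow> f c) (at_right c)" if "i \<le> n" for i
  proof -
    have "c \<le> z i" using z(2) that by auto
    then have "min (z i) c = c" by simp
    moreover have "((\<lambda>d. min (z i) d) \<longlongrightarrow> min (z i) c) (at_right c)"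
      by (intro tendsto_min tendsto_const tendsto_ident_at)
    moreover have "isCont f c" using cont by (simp add: continuous_on_eq_continuous_at)
    ultimately show ?thesis
      using isCont_tendsto_compose[of c f "\<lambda>d. min (z i) d" "at_right c"] by simp
  qed
  have "((\<lambda>d. \<Sum>i<n. \<bar>f (min (z (Suc i)) d) - f (min (z i) d)\<bar>) \<longlongrightarrow> (\<Sum>i<n. \<bar>f c - f c\<bar>)) (at_right c)"
    by (intro tendsto_sum tendsto_rabs tendsto_diff lim) auto
  then have "\<forall>\<^sub>F d in at_right c. (\<Sum>i<n. \<bar>f (min (z (Suc i)) d) - f (min (z i) d)\<bar>) < e"
    using e by (intro order_tendstoD(2)) auto
  moreover have "\<forall>\<^sub>F d in at_right c. c < d \<and> d < c + 1"
    by (auto simp: eventually_at_right_field intro!: exI[of _ "c + 1"])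
  ultimately show "\<forall>\<^sub>F d in at_right c. variation_function f d < u"
  proof eventually_elim
    case (elim d)
    then have d: "c \<le> d" "d \<le> c + 1" by auto
    note clip = clip_variation_sum[OF z(1,2) d, of f]
    have "v < e + Sup (variation_sums f d (c + 1))"
      using clip(1) cSup_upper[OF clip(3) locally_bounded_variationD[OF bv]] elim z(3) by linarith
    then have "Sup (variation_sums f c d) < 2 * e"
      using v(2) variation_additive[OF bv d] by linarith
    then show ?case
      using variation_function_diff[OF bv d(1)] by (simp add: e_def)
  qed
qed

text \<open>The functions whose \<open>interval_measure\<close> has \<open>G b - G a\<close> as the measure of \<open>(a, b]\<close>. Neither boundedness nor a
  normalisation at infinity is required.\<close>
definition distribution_function :: "(real \<Rightarrow> real) \<Rightarrow> bool" where
  "distribution_function G \<longleftrightarrow> mono G \<and> (\<forall>a. continuous (at_right a) G)"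

lemma distribution_functions_bv:
  assumes bv: "locally_bounded_variation f" and cont: "continuous_on UNIV f"
  shows "distribution_function (variation_function f)"
    "distribution_function (\<lambda>x. (variation_function f x + f x) / 2)"
    "distribution_function (\<lambda>x. (variation_function f x - f x) / 2)"
proof -
  note rc = variation_function_right_continuous[OF bv cont]
  have cf: "continuous (at_right a) f" for a
    using cont continuous_on_eq_continuous_at[of UNIV f] by (auto intro: continuous_at_imp_continuous_at_within)
  show "distribution_function (variation_function f)"
    unfolding distribution_function_def
    using rc mono_variation_function[OF bv] by (auto simp: mono_def)
  have "(variation_function f x + f x) / 2 \<le> (variation_function f y + f y) / 2"
    "(variation_function f x - f x) / 2 \<le> (variation_function f y - f y) / 2" if "x \<le> y" for x y
    using abs_diff_le_variation_function[OF bv that] by (auto simp: abs_le_iff)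
  then show "distribution_function (\<lambda>x. (variation_function f x + f x) / 2)"
    "distribution_function (\<lambda>x. (variation_function f x - f x) / 2)"
    unfolding distribution_function_def
    by (auto simp: mono_def intro!: continuous_intros rc cf)
qed

lemma emeasure_distribution_function_Ioc:
  "distribution_function G \<Longrightarrow> a \<le> b \<Longrightarrow> emeasure (interval_measure G) {a<..b} = ennreal (G b - G a)"
  by (intro emeasure_interval_measure_Ioc) (auto simp: distribution_function_def mono_def)

lemma sigma_finite_distribution_function:
  "distribution_function G \<Longrightarrow> sigma_finite_measure (interval_measure G)"
  by (intro sigma_finite_interval_measure) (auto simp: distribution_function_def mono_def)

text \<open>For the total variation this says that it is the sum of the positive and the negative variation
  measure, as \<open>variation_function f\<close> is the sum of their distribution functions.\<close>
lemma emeasure_interval_measure_add: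
  assumes G: "distribution_function G" and H: "distribution_function H"
    and A: "A \<in> sets borel"
  shows "emeasure (interval_measure (\<lambda>x. G x + H x)) A
    = emeasure (interval_measure G) A + emeasure (interval_measure H) A"
proof -
  have GH: "distribution_function (\<lambda>x. G x + H x)"
    using G H by (auto simp: distribution_function_def mono_def intro!: add_mono continuous_intros)
  define P where "P = measure_of UNIV (sets borel)
    (\<lambda>A. emeasure (interval_measure G) A + emeasure (interval_measure H) A)"
  have setsP: "sets P = sets borel" and spaceP: "space P = UNIV"
    unfolding P_def using sets.sigma_sets_eq[of "borel :: real measure"] by (auto simp: sets_measure_of_conv space_measure_of_conv)
  have eP: "emeasure P A = emeasure (interval_measure G) A + emeasure (interval_measure H) A"
    if "A \<in> sets borel" for A
    unfolding P_def
  proof (rule emeasure_measure_of_sigma)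
    show "sigma_algebra (UNIV :: real set) (sets borel)"
      using sets.sigma_algebra_axioms[of "borel :: real measure"] by simp
    show "positive (sets borel) (\<lambda>A. emeasure (interval_measure G) A + emeasure (interval_measure H) A)"
      by (simp add: positive_def)
    show "countably_additive (sets borel) (\<lambda>A. emeasure (interval_measure G) A + emeasure (interval_measure H) A)"
    proof (rule countably_additiveI)
      fix A :: "nat \<Rightarrow> real set" assume A: "range A \<subseteq> sets borel" "disjoint_family A"
      show "(\<Sum>i. emeasure (interval_measure G) (A i) + emeasure (interval_measure H) (A i)) =
         emeasure (interval_measure G) (\<Union> (range A)) + emeasure (interval_measure H) (\<Union> (range A))"
        using A by (subst suminf_add[symmetric]) (auto simp: suminf_emeasure)
    qed
  qed fact
  have "interval_measure (\<lambda>x. G x + H x) = P"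
  proof (rule measure_eqI_generator_eq[where \<Omega>=UNIV and E="range (\<lambda>(a, b). {a<..b::real})"
        and A="\<lambda>n::nat. {- real n<..real n}"])
    show "Int_stable (range (\<lambda>(a, b). {a<..b::real}))"
      by (auto simp: Int_stable_def Int_greaterThanAtMost)
    show "emeasure (interval_measure (\<lambda>x. G x + H x)) X = emeasure P X"
      if X: "X \<in> range (\<lambda>(a, b). {a<..b::real})" for X
    proof -
      obtain a b where X: "X = {a<..b}" using X by auto
      show ?thesis
      proof (cases "a \<le> b")
        case True
        then have "G a \<le> G b" "H a \<le> H b" using G H by (auto simp: distribution_function_def mono_def)
        with True show ?thesis unfolding X
          by (simp add: eP emeasure_distribution_function_Ioc G H GH ennreal_plus[symmetric] del: ennreal_plus)
      qed (simp add: X)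
    qed
    show "sets (interval_measure (\<lambda>x. G x + H x)) = sigma_sets UNIV (range (\<lambda>(a, b). {a<..b::real}))"
      by (simp add: borel_sigma_sets_Ioc)
    show "sets P = sigma_sets UNIV (range (\<lambda>(a, b). {a<..b::real}))"
      by (simp add: setsP borel_sigma_sets_Ioc)
    show "(\<Union>i::nat. {- real i<..real i}) = UNIV"
    proof -
      have "\<exists>i::nat. - real i < x \<and> x \<le> real i" for x
      proof -
        obtain i :: nat where "\<bar>x\<bar> < real i" using reals_Archimedean2 by blast
        then show ?thesis by (intro exI[of _ i]) linarith
      qed
      then show ?thesis by auto
    qed
    show "emeasure (interval_measure (\<lambda>x. G x + H x)) {- real i<..real i} \<noteq> \<infinity>" for i :: nat
      by (simp add: emeasure_distribution_function_Ioc[OF GH])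
  qed auto
  then show ?thesis using eP[OF A] by simp
qed

lemma nn_integral_mono_measure_le:
  assumes sets: "sets M = sets N" and le: "\<And>A. A \<in> sets M \<Longrightarrow> emeasure M A \<le> emeasure N A"
  shows "integral\<^sup>N M f \<le> integral\<^sup>N N f"
proof -
  have sp: "space M = space N" using sets by (rule sets_eq_imp_space_eq)
  have sf: "simple_function M g = simple_function N g" for g :: "'a \<Rightarrow> ennreal"
    by (simp add: simple_function_def sets sp)
  have "integral\<^sup>S M g \<le> integral\<^sup>S N g" if "simple_function M g" for g
    unfolding simple_integral_def sp[symmetric]
    using that by (intro sum_mono mult_left_mono le simple_functionD) auto
  then show ?thesis
    unfolding nn_integral_def sf[symmetric] by (intro SUP_mono) auto
qed

lemma integrable_mono_measure_le:
  fixes f :: "'b \<Rightarrow> real"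
  assumes sets: "sets M = sets N" and le: "\<And>A. A \<in> sets M \<Longrightarrow> emeasure M A \<le> emeasure N A"
    and f: "integrable N f"
  shows "integrable M f"
  using f nn_integral_mono_measure_le[OF sets le, of "\<lambda>x. ennreal (norm (f x))"]
  by (auto simp: integrable_iff_bounded measurable_cong_sets[OF sets refl] intro: le_less_trans)

lemma variation_measure_le:
  assumes bv: "locally_bounded_variation f" and cont: "continuous_on UNIV f"
    and A: "A \<in> sets borel"
  shows "emeasure (positive_variation_measure f) A \<le> emeasure (total_variation_measure f) A"
    "emeasure (negative_variation_measure f) A \<le> emeasure (total_variation_measure f) A"
proof -
  have "(\<lambda>x. (variation_function f x + f x) / 2 + (variation_function f x - f x) / 2) = variation_function f"
    by (rule ext) (simp add: field_simps)
  then show "emeasure (positive_variation_measure f) A \<le> emeasure (total_variation_measure f) A"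
    "emeasure (negative_variation_measure f) A \<le> emeasure (total_variation_measure f) A"
    using emeasure_interval_measure_add[OF distribution_functions_bv(2,3)[OF bv cont] A]
    unfolding positive_variation_measure_def negative_variation_measure_def total_variation_measure_def
    by auto
qed

lemma variation_measure_simps [simp, measurable_cong]:
  "sets (total_variation_measure f) = sets borel"
  "sets (positive_variation_measure f) = sets borel"
  "sets (negative_variation_measure f) = sets borel"
  by (simp_all add: total_variation_measure_def positive_variation_measure_def negative_variation_measure_def)

lemma variation_measure_space [simp]:
  "space (total_variation_measure f) = UNIV"
  "space (positive_variation_measure f) = UNIV"
  "space (negative_variation_measure f) = UNIV"
  by (simp_all add: total_variation_measure_def positive_variation_measure_def negative_variation_measure_def)

lemma variation_measure_sigma_finite:
  assumes bv: "locally_bounded_variation f" and cont: "continuous_on UNIV f"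
  shows "sigma_finite_measure (total_variation_measure f)"
    "sigma_finite_measure (positive_variation_measure f)"
    "sigma_finite_measure (negative_variation_measure f)"
  using distribution_functions_bv[OF bv cont]
  unfolding positive_variation_measure_def negative_variation_measure_def total_variation_measure_def
  by (auto intro: sigma_finite_distribution_function)

lemma stieltjes_integrable_parts:
  assumes bv: "locally_bounded_variation f" and cont: "continuous_on UNIV f"
    and g: "stieltjes_integrable f A g"
  shows "set_integrable (positive_variation_measure f) A g"
    "set_integrable (negative_variation_measure f) A g"
  using g unfolding stieltjes_integrable_def set_integrable_def
  by (rule integrable_mono_measure_le[rotated 2]; simp add: variation_measure_le[OF bv cont])+

section \<open>Integration by parts for Stieltjes integrals\<close>

lemma distribution_function_measurable:
  "distribution_function G \<Longrightarrow> G \<in> borel_measurable borel"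
  by (intro borel_measurable_mono) (simp add: distribution_function_def)

lemma integrable_continuous_mult_mono:
  fixes g :: "real \<Rightarrow> real"
  assumes G: "distribution_function G" and g: "continuous_on {a..b} g"
  shows "integrable lborel (\<lambda>v. indicator {a..b} v * (g v * G v))"
proof -
  have [measurable]: "G \<in> borel_measurable borel" by (rule distribution_function_measurable[OF G])
  have [measurable]: "(\<lambda>v. indicator {a..b} v *\<^sub>R g v) \<in> borel_measurable borel"
    by (rule borel_measurable_continuous_on_indicator) (use g in auto)
  have gi: "integrable lborel (\<lambda>v. indicator {a..b} v *\<^sub>R g v)"
    by (rule borel_integrable_compact) (use g in auto)
  have "integrable lborel (\<lambda>v. (\<bar>G a\<bar> + \<bar>G b\<bar>) * (indicator {a..b} v *\<^sub>R g v))"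
    by (intro integrable_mult_right gi)
  then have "integrable lborel (\<lambda>v. G v * (indicator {a..b} v *\<^sub>R g v))"
  proof (rule Bochner_Integration.integrable_bound)
    show "AE v in lborel. norm (G v * (indicator {a..b} v *\<^sub>R g v))
      \<le> norm ((\<bar>G a\<bar> + \<bar>G b\<bar>) * (indicator {a..b} v *\<^sub>R g v))"
    proof (rule AE_I2)
      fix v
      show "norm (G v * (indicator {a..b} v *\<^sub>R g v)) \<le> norm ((\<bar>G a\<bar> + \<bar>G b\<bar>) * (indicator {a..b} v *\<^sub>R g v))"
      proof (cases "v \<in> {a..b}")
        case True
        then have "G a \<le> G v" "G v \<le> G b" using G by (auto simp: distribution_function_def mono_def)
        then have "\<bar>G v\<bar> \<le> \<bar>G a\<bar> + \<bar>G b\<bar>" by linarith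
        then show ?thesis unfolding norm_mult by (intro mult_right_mono) auto
      qed simp
    qed
  qed measurable
  then show ?thesis by (simp add: mult_ac)
qed

text \<open>Fubini applied to \<open>k' v\<close> on the triangle \<open>a < v < u \<le> b\<close>. With the strict inequality \<open>v < u\<close> the
  section in \<open>u\<close> is \<open>(v, b]\<close>, whose measure is exactly \<open>G b - G v\<close>, so that left continuity of \<open>G\<close> is not
  needed.\<close>
lemma interval_measure_by_parts:
  assumes G: "distribution_function G" and ab: "a \<le> b"
    and deriv: "\<And>x. x \<in> {a..b} \<Longrightarrow> (k has_vector_derivative k' x) (at x within {a..b})"
    and cont: "continuous_on {a..b} k'"
  shows "set_integrable (interval_measure G) {a<..b} k"
    and "(LINT u:{a<..b}|interval_measure G. k u)
      = k b * G b - k a * G a - (\<integral>v. indicator {a..b} v * (k' v * G v) \<partial>lborel)"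
proof -
  define \<mu> where "\<mu> = interval_measure G"
  have sets_mu[simp, measurable_cong]: "sets \<mu> = sets borel" and space_mu[simp]: "space \<mu> = UNIV"
    by (simp_all add: \<mu>_def)
  interpret mu: sigma_finite_measure \<mu> unfolding \<mu>_def by (rule sigma_finite_distribution_function[OF G])
  interpret P: pair_sigma_finite lborel \<mu> ..
  have mono: "G x \<le> G y" if "x \<le> y" for x y using G that by (auto simp: distribution_function_def mono_def)
  have Ioc: "emeasure \<mu> {x<..y} = ennreal (G y - G x)" if "x \<le> y" for x y
    unfolding \<mu>_def by (rule emeasure_distribution_function_Ioc[OF G that])
  have Ioc': "measure \<mu> {x<..y} = G y - G x" if "x \<le> y" for x y
    using Ioc[OF that] mono[OF that] by (simp add: measure_def)
  have contk: "continuous_on {a..b} k"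
    using deriv by (intro continuous_on_vector_derivative)
  have [measurable]: "G \<in> borel_measurable borel" by (rule distribution_function_measurable[OF G])
  define kk where "kk v = indicator {a..b} v *\<^sub>R k' v" for v
  have [measurable]: "kk \<in> borel_measurable borel"
    unfolding kk_def[abs_def] by (rule borel_measurable_continuous_on_indicator) (use cont in auto)
  obtain C where C: "\<And>v. v \<in> {a..b} \<Longrightarrow> norm (k' v) \<le> C"
    using compact_imp_bounded[OF compact_continuous_image[OF cont compact_Icc]]
    unfolding bounded_iff by (meson imageI)
  have kkC: "\<bar>kk v\<bar> \<le> \<bar>C\<bar>" for v
    using C[of v] by (auto simp: kk_def split: split_indicator)
  show int: "set_integrable (interval_measure G) {a<..b} k"
  proof -
    obtain D where D: "\<And>v. v \<in> {a..b} \<Longrightarrow> norm (k v) \<le> D"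
      using compact_imp_bounded[OF compact_continuous_image[OF contk compact_Icc]]
      unfolding bounded_iff by (meson imageI)
    have m: "(\<lambda>v. indicator {a<..b} v *\<^sub>R k v) \<in> borel_measurable borel"
      by (rule borel_measurable_continuous_on_indicator) (auto intro: continuous_on_subset[OF contk])
    have "integrable \<mu> (\<lambda>v. indicator {a<..b} v *\<^sub>R k v)"
    proof (rule Bochner_Integration.integrable_bound)
      show "integrable \<mu> (\<lambda>v. D * indicator {a<..b} v)"
        using Ioc[OF ab] by (intro integrable_mult_right integrable_real_indicator) auto
      show "(\<lambda>v. indicator {a<..b} v *\<^sub>R k v) \<in> borel_measurable \<mu>"
        using m by (simp add: measurable_cong_sets[OF sets_mu refl])
      show "AE v in \<mu>. norm (indicator {a<..b} v *\<^sub>R k v) \<le> norm (D * indicator {a<..b} v)"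
      proof (rule AE_I2)
        fix v
        show "norm (indicator {a<..b} v *\<^sub>R k v) \<le> norm (D * indicator {a<..b} v)"
          using D[of v] by (cases "v \<in> {a<..b}") auto
      qed
    qed
    then show ?thesis by (simp add: set_integrable_def \<mu>_def)
  qed
  define p where "p v u = indicator {a<..b} u * (indicator {a<..<u} v * kk v)" for v u :: real
  have pm[measurable]: "(\<lambda>(v, u). p v u) \<in> borel_measurable (lborel \<Otimes>\<^sub>M \<mu>)"
  proof -
    have eq: "(\<lambda>(v, u). p v u) = (\<lambda>(v, u). if a < u \<and> u \<le> b \<and> a < v \<and> v < u then kk v else 0)"
      by (auto simp: p_def fun_eq_iff split: split_indicator)
    show ?thesis unfolding eq by measurable
  qed
  have pint: "integrable (lborel \<Otimes>\<^sub>M \<mu>) (\<lambda>(v, u). p v u)"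
  proof (rule Bochner_Integration.integrable_bound[OF _ pm])
    have "emeasure (lborel \<Otimes>\<^sub>M \<mu>) ({a<..b} \<times> {a<..b}) < \<infinity>"
      using ab by (subst mu.emeasure_pair_measure_Times) (auto simp: Ioc ennreal_mult_less_top)
    then show "integrable (lborel \<Otimes>\<^sub>M \<mu>) (\<lambda>z. \<bar>C\<bar> * indicator ({a<..b} \<times> {a<..b}) z)"
      by (intro integrable_mult_right integrable_real_indicator) auto
    show "AE z in lborel \<Otimes>\<^sub>M \<mu>. norm (case z of (v, u) \<Rightarrow> p v u) \<le> norm (\<bar>C\<bar> * indicator ({a<..b} \<times> {a<..b}) z)"
    proof (rule AE_I2)
      fix z :: "real \<times> real"
      obtain v u where z: "z = (v, u)" by (cases z)
      show "norm (case z of (v, u) \<Rightarrow> p v u) \<le> norm (\<bar>C\<bar> * indicator ({a<..b} \<times> {a<..b}) z)"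
        unfolding z using kkC[of v]
        by (cases "u \<in> {a<..b}"; cases "v \<in> {a<..<u}") (auto simp: p_def)
    qed
  qed
  have inner1: "(\<integral>v. p v u \<partial>lborel) = indicator {a<..b} u * (k u - k a)" for u
  proof (cases "u \<in> {a<..b}")
    case True
    then have u: "a \<le> u" "u \<le> b" by auto
    have "(\<integral>v. p v u \<partial>lborel) = (\<integral>v. indicator {a..u} v *\<^sub>R k' v \<partial>lborel)"
    proof (rule integral_cong_AE)
      show "(\<lambda>v. p v u) \<in> borel_measurable lborel" unfolding p_def by measurable
      have "(\<lambda>v. indicator {a..u} v *\<^sub>R k' v) \<in> borel_measurable borel"
        by (rule borel_measurable_continuous_on_indicator)
          (use u in \<open>auto intro: continuous_on_subset[OF cont]\<close>)
      then show "(\<lambda>v. indicator {a..u} v *\<^sub>R k' v) \<in> borel_measurable lborel" by simp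
      show "AE v in lborel. p v u = indicator {a..u} v *\<^sub>R k' v"
        using AE_lborel_singleton[of a] AE_lborel_singleton[of u]
        by eventually_elim (use True in \<open>auto simp: p_def kk_def split: split_indicator\<close>)
    qed
    also have "\<dots> = k u - k a"
      by (rule integral_FTC_Icc[OF u(1)])
        (use u in \<open>auto intro!: has_vector_derivative_within_subset[OF deriv] continuous_on_subset[OF cont]\<close>)
    finally show ?thesis using True by simp
  qed (simp add: p_def)
  have inner2: "(\<integral>u. p v u \<partial>\<mu>) = indicator {a<..b} v * (kk v * (G b - G v))" for v
  proof (cases "v \<in> {a<..b}")
    case True
    then have "p v u = kk v * indicator {v<..b} u" for u
      by (auto simp: p_def split: split_indicator)
    then show ?thesis using True Ioc'[of v b] by simp
  next
    case False
    then have "p v u = 0" for u by (auto simp: p_def split: split_indicator)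
    then show ?thesis using False by simp
  qed
  have "(\<integral>u. (\<integral>v. p v u \<partial>lborel) \<partial>\<mu>) = (\<integral>v. (\<integral>u. p v u \<partial>\<mu>) \<partial>lborel)"
    by (rule P.Fubini_integral[OF pint])
  also have "(\<integral>u. (\<integral>v. p v u \<partial>lborel) \<partial>\<mu>) = (\<integral>u. indicator {a<..b} u *\<^sub>R k u - k a * indicator {a<..b} u \<partial>\<mu>)"
    unfolding inner1 by (intro Bochner_Integration.integral_cong refl) (simp add: algebra_simps)
  also have "\<dots> = (LINT u:{a<..b}|\<mu>. k u) - k a * (G b - G a)"
    using int Ioc[OF ab] Ioc'[OF ab]
    by (subst Bochner_Integration.integral_diff)
      (auto simp: set_integrable_def set_lebesgue_integral_def \<mu>_def[symmetric] intro!: integrable_mult_right)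
  also have "(\<integral>v. (\<integral>u. p v u \<partial>\<mu>) \<partial>lborel) = (\<integral>v. G b * kk v - indicator {a..b} v * (k' v * G v) \<partial>lborel)"
    unfolding inner2
  proof (rule integral_cong_AE)
    show "(\<lambda>v. G b * kk v - indicator {a..b} v * (k' v * G v)) \<in> borel_measurable lborel"
    proof -
      have "(\<lambda>v. G b * kk v - kk v * G v) \<in> borel_measurable lborel" by measurable
      then show ?thesis by (simp add: kk_def mult.assoc)
    qed
    show "AE v in lborel. indicator {a<..b} v * (kk v * (G b - G v)) = G b * kk v - indicator {a..b} v * (k' v * G v)"
      using AE_lborel_singleton[of a]
      by eventually_elim (auto simp: kk_def algebra_simps split: split_indicator)
  qed measurable
  also have "\<dots> = G b * (\<integral>v. kk v \<partial>lborel) - (\<integral>v. indicator {a..b} v * (k' v * G v) \<partial>lborel)"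
    using integrable_continuous_mult_mono[OF G cont] borel_integrable_compact[OF compact_Icc cont]
    by (subst Bochner_Integration.integral_diff) (auto simp: kk_def[abs_def])
  also have "(\<integral>v. kk v \<partial>lborel) = k b - k a"
    unfolding kk_def by (rule integral_FTC_Icc[OF ab deriv cont]) auto
  finally show "(LINT u:{a<..b}|interval_measure G. k u)
      = k b * G b - k a * G a - (\<integral>v. indicator {a..b} v * (k' v * G v) \<partial>lborel)"
    by (simp add: \<mu>_def algebra_simps)
qed

text \<open>The constant \<open>c\<close> is arbitrary because \<open>df\<close> does not see it; it is used with \<open>c = f s\<close>.\<close>
lemma stieltjes_integral_by_parts:
  assumes bv: "locally_bounded_variation f" and contf: "continuous_on UNIV f" and ab: "a \<le> b"
    and deriv: "\<And>x. x \<in> {a..b} \<Longrightarrow> (k has_vector_derivative k' x) (at x within {a..b})"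
    and cont: "continuous_on {a..b} k'"
  shows "stieltjes_integral f {a<..b} k = (f b - c) * k b - (f a - c) * k a - integral {a..b} (\<lambda>v. (f v - c) * k' v)"
proof -
  let ?G = "\<lambda>x. (variation_function f x + f x) / 2" and ?H = "\<lambda>x. (variation_function f x - f x) / 2"
  note G = distribution_functions_bv(2)[OF bv contf] and H = distribution_functions_bv(3)[OF bv contf]
  note df = distribution_functions_bv(2,3)[OF bv contf]
  have cf: "continuous_on {a..b} f" using contf continuous_on_subset by blast
  have diff: "?G x - ?H x = f x" for x by (simp add: field_simps)
  have "stieltjes_integral f {a<..b} k = (k b * ?G b - k a * ?G a - (\<integral>v. indicator {a..b} v * (k' v * ?G v) \<partial>lborel))
    - (k b * ?H b - k a * ?H a - (\<integral>v. indicator {a..b} v * (k' v * ?H v) \<partial>lborel))"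
    unfolding stieltjes_integral_def positive_variation_measure_def negative_variation_measure_def
    using interval_measure_by_parts(2)[OF G ab deriv cont] interval_measure_by_parts(2)[OF H ab deriv cont]
    by simp
  also have "\<dots> = k b * (?G b - ?H b) - k a * (?G a - ?H a)
     - ((\<integral>v. indicator {a..b} v * (k' v * ?G v) \<partial>lborel) - (\<integral>v. indicator {a..b} v * (k' v * ?H v) \<partial>lborel))"
    by (simp only: right_diff_distrib)
  also have "(\<integral>v. indicator {a..b} v * (k' v * ?G v) \<partial>lborel) - (\<integral>v. indicator {a..b} v * (k' v * ?H v) \<partial>lborel)
    = (\<integral>v. indicator {a..b} v * (k' v * ?G v) - indicator {a..b} v * (k' v * ?H v) \<partial>lborel)"
    by (rule Bochner_Integration.integral_diff[symmetric]; rule integrable_continuous_mult_mono; (rule df cont))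
  also have "\<dots> = (\<integral>v. indicator {a..b} v *\<^sub>R (k' v * f v) \<partial>lborel)"
    by (intro Bochner_Integration.integral_cong refl)
       (simp only: right_diff_distrib[symmetric] diff real_scaleR_def)
  also have "\<dots> = integral {a..b} (\<lambda>v. k' v * f v)"
    using set_borel_integral_eq_integral(2)[of "{a..b}" "\<lambda>v. k' v * f v"]
      borel_integrable_compact[OF compact_Icc, of a b "\<lambda>v. k' v * f v"] cf cont
    by (auto simp: set_integrable_def set_lebesgue_integral_def intro!: continuous_intros)
  finally have 1: "stieltjes_integral f {a<..b} k = k b * f b - k a * f a - integral {a..b} (\<lambda>v. k' v * f v)"
    unfolding diff .
  have "integral {a..b} (\<lambda>v. (f v - c) * k' v) = integral {a..b} (\<lambda>v. k' v * f v - c * k' v)"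
    by (simp add: algebra_simps)
  also have "\<dots> = integral {a..b} (\<lambda>v. k' v * f v) - c * integral {a..b} k'"
    using cf cont
    by (subst integral_diff) (auto intro!: integrable_continuous_interval continuous_intros)
  also have "integral {a..b} k' = k b - k a"
    using fundamental_theorem_of_calculus[OF ab deriv] by (rule integral_unique) auto
  finally show ?thesis using 1 by (simp add: algebra_simps)
qed

lemma stieltjes_integral_split:
  assumes bv: "locally_bounded_variation f" and contf: "continuous_on UNIV f"
    and int: "stieltjes_integrable f {a<..c} k" and "a \<le> b" "b \<le> c"
  shows "stieltjes_integral f {a<..c} k = stieltjes_integral f {a<..b} k + stieltjes_integral f {b<..c} k"
proof -
  have eq: "{a<..c} = {a<..b} \<union> {b<..c}" using assms by auto
  note parts = stieltjes_integrable_parts[OF bv contf int]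
  have "(LINT x:{a<..c}|m. k x) = (LINT x:{a<..b}|m. k x) + (LINT x:{b<..c}|m. k x)"
    if "set_integrable m {a<..c} k" "sets m = sets borel" for m :: "real measure"
    unfolding eq
  proof (rule set_integral_Un)
    show "set_integrable m {a<..b} k"
      by (rule set_integrable_subset[OF that(1)]) (use that(2) assms(4,5) in auto)
    show "set_integrable m {b<..c} k"
      by (rule set_integrable_subset[OF that(1)]) (use that(2) assms(4,5) in auto)
  qed auto
  from this[OF parts(1)] this[OF parts(2)] show ?thesis
    by (simp add: stieltjes_integral_def)
qed

lemma set_integral_Ioc_tendsto_0:
  fixes k :: "real \<Rightarrow> real"
  assumes int: "set_integrable m {s<..t} k" and sets: "sets m = sets borel" and st: "s < t"
  shows "((\<lambda>x. LINT u:{s<..x}|m. k u) \<longlongrightarrow> 0) (at_right s)"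
proof (rule tendsto_at_right_sequentially[OF st])
  fix S :: "nat \<Rightarrow> real" assume S: "\<And>n. s < S n" "\<And>n. S n < t" "decseq S" "S \<longlonglongrightarrow> s"
  have "(\<lambda>n. \<integral>u. indicator {s<..S n} u *\<^sub>R k u \<partial>m) \<longlonglongrightarrow> (\<integral>u. 0 \<partial>m)"
  proof (rule integral_dominated_convergence[where w="\<lambda>u. norm (indicator {s<..t} u *\<^sub>R k u)"])
    show "integrable m (\<lambda>u. norm (indicator {s<..t} u *\<^sub>R k u))"
      using int by (intro integrable_norm) (simp add: set_integrable_def)
    have "set_integrable m {s<..S n} k" for n
      by (rule set_integrable_subset[OF int]) (use S(2)[of n] sets in auto)
    then show "(\<lambda>u. indicator {s<..S n} u *\<^sub>R k u) \<in> borel_measurable m" for n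
      by (auto simp: set_integrable_def)
    show "AE u in m. norm (indicator {s<..S n} u *\<^sub>R k u) \<le> norm (indicator {s<..t} u *\<^sub>R k u)" for n
      using S(2)[of n] by (intro AE_I2) (auto split: split_indicator)
    show "AE u in m. (\<lambda>n. indicator {s<..S n} u *\<^sub>R k u) \<longlonglongrightarrow> 0"
    proof (rule AE_I2)
      fix u
      have "\<forall>\<^sub>F n in sequentially. indicator {s<..S n} u *\<^sub>R k u = 0"
      proof (cases "s < u")
        case True
        then have "\<forall>\<^sub>F n in sequentially. S n < u" using S(4) by (rule order_tendstoD(2)[rotated])
        then show ?thesis by eventually_elim simp
      qed simp
      then show "(\<lambda>n. indicator {s<..S n} u *\<^sub>R k u) \<longlonglongrightarrow> 0" by (rule tendsto_eventually)
    qed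
  qed simp
  then show "(\<lambda>n. LINT u:{s<..S n}|m. k u) \<longlonglongrightarrow> 0" by (simp add: set_lebesgue_integral_def)
qed

text \<open>Integration by parts on \<open>{a..t}\<close> with \<open>a\<close> decreasing to the singularity \<open>s\<close> of the kernel. The
  primitive \<open>\<Phi>\<close> is continuous at \<open>s\<close> because the boundary term vanishes there by assumption and the
  Stieltjes integral over \<open>(s, x]\<close> is absolutely convergent; the fundamental theorem of calculus,
  which needs the derivative only in the interior, then gives the improper integral.\<close>
lemma has_integral_by_parts_singular:
  fixes k :: "real \<Rightarrow> real"
  assumes bv: "locally_bounded_variation f" and contf: "continuous_on UNIV f" and st: "s < t"
    and C1: "k C1_differentiable_on {s<..}"
    and int: "stieltjes_integrable f {s<..t} k"
    and lim: "((\<lambda>u. (f u - f s) * k u) \<longlongrightarrow> 0) (at_right s)"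
  shows "((\<lambda>u. (f u - f s) * deriv k u) has_integral
    (f t - f s) * k t - stieltjes_integral f {s<..t} k) {s..t}"
proof -
  obtain D where D: "\<And>x. s < x \<Longrightarrow> (k has_vector_derivative D x) (at x)" "continuous_on {s<..} D"
    using C1 by (auto simp: C1_differentiable_on_def)
  have derivD: "deriv k x = D x" if "s < x" for x
    using D(1)[OF that] by (auto simp: has_real_derivative_iff_has_vector_derivative[symmetric] intro: DERIV_imp_deriv)
  define \<phi> where "\<phi> u = (f u - f s) * D u" for u
  define \<Phi> where "\<Phi> x = (if x \<le> s then 0 else (f x - f s) * k x - stieltjes_integral f {s<..x} k)" for x
  have cphi: "continuous_on {s<..} \<phi>"
    unfolding \<phi>_def by (intro continuous_intros continuous_on_subset[OF contf] D(2)) auto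
  have diff: "\<Phi> x = \<Phi> a + integral {a..x} \<phi>" if a: "s < a" "a \<le> x" "x \<le> t" for a x
  proof -
    have "stieltjes_integral f {a<..x} k = (f x - f s) * k x - (f a - f s) * k a - integral {a..x} \<phi>"
      unfolding \<phi>_def using a
      by (intro stieltjes_integral_by_parts bv contf has_vector_derivative_at_within[OF D(1)] continuous_on_subset[OF D(2)]) auto
    moreover have "stieltjes_integrable f {s<..x} k"
      using int a unfolding stieltjes_integrable_def by (intro set_integrable_subset[OF int[unfolded stieltjes_integrable_def]]) auto
    then have "stieltjes_integral f {s<..x} k = stieltjes_integral f {s<..a} k + stieltjes_integral f {a<..x} k"
      using a by (intro stieltjes_integral_split[OF bv contf]) auto
    ultimately show ?thesis using a by (simp add: \<Phi>_def)
  qed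
  have "((\<lambda>u. (f u - f s) * deriv k u) has_integral (\<Phi> t - \<Phi> s)) {s..t}"
  proof (rule fundamental_theorem_of_calculus_interior)
    show "s \<le> t" using st by simp
    show "(\<Phi> has_vector_derivative (f x - f s) * deriv k x) (at x)" if x: "x \<in> {s<..<t}" for x
    proof -
      obtain a where a: "s < a" "a < x" using x dense by auto
      have "((\<lambda>u. integral {a..u} \<phi>) has_vector_derivative \<phi> x) (at x within {a..t})"
        by (rule integral_has_vector_derivative) (use a x in \<open>auto intro: continuous_on_subset[OF cphi]\<close>)
      then have "((\<lambda>u. integral {a..u} \<phi>) has_vector_derivative \<phi> x) (at x)"
        using a x by (simp add: at_within_Icc_at)
      then have "((\<lambda>u. \<Phi> a + integral {a..u} \<phi>) has_vector_derivative 0 + \<phi> x) (at x)"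
        by (intro has_vector_derivative_add has_vector_derivative_const)
      then have "((\<lambda>u. \<Phi> a + integral {a..u} \<phi>) has_vector_derivative \<phi> x) (at x)" by simp
      then have "(\<Phi> has_vector_derivative \<phi> x) (at x)"
        by (rule has_vector_derivative_transform_within_open[where S="{a<..<t}"])
          (use a x in \<open>auto intro!: diff[OF a(1), symmetric]\<close>)
      then show ?thesis using x by (simp add: \<phi>_def derivD)
    qed
    have lim0: "(\<Phi> \<longlongrightarrow> 0) (at_right s)"
    proof -
      have "((\<lambda>x. stieltjes_integral f {s<..x} k) \<longlongrightarrow> 0 - 0) (at_right s)"
        unfolding stieltjes_integral_def
        by (intro tendsto_diff set_integral_Ioc_tendsto_0[OF _ _ st] stieltjes_integrable_parts[OF bv contf int]) auto
      then have "((\<lambda>x. (f x - f s) * k x - stieltjes_integral f {s<..x} k) \<longlongrightarrow> 0 - 0) (at_right s)"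
        by (intro tendsto_diff lim) simp
      then have *: "((\<lambda>x. (f x - f s) * k x - stieltjes_integral f {s<..x} k) \<longlongrightarrow> 0) (at_right s)" by simp
      show ?thesis
        by (rule Lim_transform_eventually[OF *])
          (rule eventually_mono[OF eventually_at_right_less[of s]], simp add: \<Phi>_def)
    qed
    show "continuous_on {s..t} \<Phi>"
      unfolding continuous_on_eq_continuous_within
    proof
      fix x assume x: "x \<in> {s..t}"
      show "continuous (at x within {s..t}) \<Phi>"
      proof (cases "x = s")
        case True
        have "at s within {s..t} \<le> at_right s"
          by (metis at_le at_within_Icc_at_right order_refl st)
        then have "(\<Phi> \<longlongrightarrow> 0) (at s within {s..t})" using lim0 tendsto_mono by blast
        then show ?thesis using True by (simp add: continuous_within \<Phi>_def)
      next
        case False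
        then obtain a where a: "s < a" "a < x" using x dense[of s x] by auto
        have "continuous_on {a..t} (\<lambda>u. \<Phi> a + integral {a..u} \<phi>)"
          by (intro continuous_intros indefinite_integral_continuous_1 integrable_continuous_interval)
            (use a in \<open>auto intro: continuous_on_subset[OF cphi]\<close>)
        then have "continuous_on {a..t} \<Phi>"
          by (rule continuous_on_eq) (auto intro!: diff[OF a(1), symmetric])
        then have "continuous (at x within {a..t}) \<Phi>"
          using a x by (auto simp: continuous_on_eq_continuous_within)
        moreover have "at x within {a..t} = at x within {s..t}"
          by (rule at_within_nhd[of _ "{a<..}"]) (use a in auto)
        ultimately show ?thesis by (simp add: continuous_within)
      qed
    qed
  qed
  then show ?thesis using st by (simp add: \<Phi>_def)
qed

section \<open>Volterra kernels and Wiener integrands\<close>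

lemma sq_integrable_lebesgue_cong_AE:
  fixes f g :: "real \<Rightarrow> real"
  assumes "AE x in lborel. f x = g x"
  shows "sq_integrable lebesgue f \<longleftrightarrow> sq_integrable lebesgue g"
proof -
  have *: "sq_integrable lebesgue g'" if "sq_integrable lebesgue f'" "AE x in lborel. f' x = g' x"
    for f' g' :: "real \<Rightarrow> real"
  proof (rule sq_integrable_bound[OF that(1)])
    have AE: "AE x in lebesgue. f' x = g' x" by (rule AE_completion[OF that(2)])
    show "g' \<in> borel_measurable lebesgue"
      by (rule borel_measurable_AE[OF sq_integrable_measurable[OF that(1)] AE])
    show "AE x in lebesgue. \<bar>g' x\<bar> \<le> \<bar>f' x\<bar>" using AE by eventually_elim simp
  qed
  from *[of f g] *[of g f] assms show ?thesis by (auto simp: eq_commute)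
qed

lemma sq_integrable_lborel_imp_lebesgue:
  "sq_integrable lborel f \<Longrightarrow> sq_integrable lebesgue f"
  by (auto simp: sq_integrable_def integrable_completion measurable_completion)

lemma square_integrable_upto_iff:
  "square_integrable_upto t g \<longleftrightarrow> sq_integrable lebesgue (\<lambda>s. indicator {..t} s * g s)"
proof -
  have "(indicator {..t} s * g s)\<^sup>2 = indicator {..t} s *\<^sub>R (g s)\<^sup>2" for s
    by (simp split: split_indicator)
  then show ?thesis
    by (simp add: square_integrable_upto_def sq_integrable_def borel_measurable_restrict_space_iff
      integrable_restrict_space)
qed

lemma volterra_kernel_measurable:
  assumes "volterra_kernel K"
  shows "(\<lambda>(t, s). K t s) \<in> borel_measurable (borel \<Otimes>\<^sub>M borel)"
  using assms by (simp add: volterra_kernel_def borel_prod)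

lemma volterra_kernel_eq_0: "volterra_kernel K \<Longrightarrow> t < s \<Longrightarrow> K t s = 0"
  by (simp add: volterra_kernel_def)

lemma volterra_kernel_sq_integrable:
  assumes K: "volterra_kernel K"
  shows "sq_integrable lborel (K t)"
proof -
  note [measurable] = volterra_kernel_measurable[OF K]
  have m: "K t \<in> borel_measurable borel" by measurable
  have "square_integrable_upto t (K t)" using K by (simp add: volterra_kernel_def)
  moreover have "(\<lambda>s. indicator {..t} s * K t s) = K t"
    using volterra_kernel_eq_0[OF K] by (force simp: fun_eq_iff split: split_indicator)
  ultimately have "integrable lebesgue (\<lambda>s. (K t s)\<^sup>2)"
    by (simp add: square_integrable_upto_iff sq_integrable_def)
  then show ?thesis using m by (simp add: sq_integrable_def integrable_completion)
qed

lemma volterra_kernel_l2_continuous: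
  assumes K: "volterra_kernel K"
  shows "continuous_on UNIV (\<lambda>t. l2_norm lborel (K t))"
  unfolding continuous_on_eq_continuous_at[OF open_UNIV]
proof
  fix u
  note sq = volterra_kernel_sq_integrable[OF K]
  have "((\<lambda>t. \<integral>\<^sup>+s. ennreal ((K t s - K u s)\<^sup>2) \<partial>lborel) \<longlongrightarrow> 0) (at u)"
    using K by (simp add: volterra_kernel_def)
  then have "((\<lambda>t. ennreal ((l2_norm lborel (\<lambda>s. K t s - K u s))\<^sup>2)) \<longlongrightarrow> ennreal 0) (at u)"
    by (simp add: nn_integral_power2_eq[OF sq_integrable_diff[OF sq sq]])
  then have "((\<lambda>t. (l2_norm lborel (\<lambda>s. K t s - K u s))\<^sup>2) \<longlongrightarrow> 0) (at u)"
    by (subst (asm) tendsto_ennreal_iff) auto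
  from tendsto_real_sqrt[OF this]
  have lim: "((\<lambda>t. l2_norm lborel (\<lambda>s. K t s - K u s)) \<longlongrightarrow> 0) (at u)" by simp
  have "((\<lambda>t. l2_norm lborel (K t) - l2_norm lborel (K u)) \<longlongrightarrow> 0) (at u)"
  proof (rule Lim_null_comparison[OF always_eventually lim], rule allI)
    fix t
    show "norm (l2_norm lborel (K t) - l2_norm lborel (K u)) \<le> l2_norm lborel (\<lambda>s. K t s - K u s)"
      using l2_norm_triangle_diff[OF sq[of t] sq[of u]] l2_norm_triangle_diff[OF sq[of u] sq[of t]]
        l2_norm_minus_commute[of lborel "K t" "K u"] by auto
  qed
  then show "isCont (\<lambda>t. l2_norm lborel (K t)) u"
    by (simp add: isCont_def LIM_zero_iff)
qed

text \<open>Since \<open>r \<mapsto> K r\<close> is continuous into \<open>L\<^sup>2\<close>, its norm is bounded on compact sets, and Tonelli's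
  theorem gives the absolute convergence of the Stieltjes integral for almost every \<open>s\<close>.\<close>
lemma volterra_kernel_stieltjes_integrable:
  assumes K: "volterra_kernel K" and bv: "locally_bounded_variation f" and contf: "continuous_on UNIV f"
  shows "AE s in lborel. s < t \<longrightarrow> stieltjes_integrable f {s<..t} (\<lambda>r. K r s)"
proof -
  note [measurable] = volterra_kernel_measurable[OF K]
  define \<nu> where "\<nu> = total_variation_measure f"
  have sets_nu[simp, measurable_cong]: "sets \<nu> = sets borel" by (simp add: \<nu>_def)
  interpret nu: sigma_finite_measure \<nu>
    unfolding \<nu>_def by (rule variation_measure_sigma_finite[OF bv contf])
  interpret P: pair_sigma_finite lborel \<nu> ..
  have fin: "AE s in lborel. a < s \<and> s < t \<longrightarrow> (\<integral>\<^sup>+r. indicator {a<..t} r * ennreal \<bar>K r s\<bar> \<partial>\<nu>) < \<infinity>" if a: "a < t" for a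
  proof -
    define I :: "real \<Rightarrow> real" where "I s = indicator {a<..<t} s" for s
    have I: "sq_integrable lborel I"
    proof -
      have "(I s)\<^sup>2 = indicator {a<..<t} s" for s by (simp add: I_def split: split_indicator)
      then show ?thesis using a by (simp add: sq_integrable_def) (simp add: I_def[abs_def])
    qed
    obtain C where C: "\<And>r. r \<in> {a..t} \<Longrightarrow> norm (l2_norm lborel (K r)) \<le> C"
      using compact_imp_bounded[OF compact_continuous_image[OF
          continuous_on_subset[OF volterra_kernel_l2_continuous[OF K]] compact_Icc]]
      unfolding bounded_iff by (metis imageI subset_UNIV)
    have bd: "(\<integral>\<^sup>+s. ennreal \<bar>I s * K r s\<bar> \<partial>lborel) \<le> ennreal (l2_norm lborel I * C)" if "r \<in> {a..t}" for r
    proof -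
      have "(\<integral>\<^sup>+s. ennreal \<bar>I s * K r s\<bar> \<partial>lborel) = ennreal (\<integral>s. \<bar>I s * K r s\<bar> \<partial>lborel)"
        by (intro nn_integral_eq_integral integrable_abs sq_integrable_mult I volterra_kernel_sq_integrable K) simp
      also have "\<dots> \<le> ennreal (l2_norm lborel I * C)"
        using Cauchy_Schwarz_integral_abs[OF I volterra_kernel_sq_integrable[OF K], of r] C[OF that]
        by (intro ennreal_leI) (auto elim!: order_trans intro!: mult_left_mono)
      finally show ?thesis .
    qed
    have [measurable]: "I \<in> borel_measurable borel" by (simp add: I_def[abs_def])
    have "(\<integral>\<^sup>+s. (\<integral>\<^sup>+r. indicator {a<..t} r * ennreal \<bar>I s * K r s\<bar> \<partial>\<nu>) \<partial>lborel)
      = (\<integral>\<^sup>+r. (\<integral>\<^sup>+s. indicator {a<..t} r * ennreal \<bar>I s * K r s\<bar> \<partial>lborel) \<partial>\<nu>)"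
      by (rule P.Fubini'[symmetric]) measurable
    also have "\<dots> \<le> (\<integral>\<^sup>+r. ennreal (l2_norm lborel I * C) * indicator {a<..t} r \<partial>\<nu>)"
      by (intro nn_integral_mono) (use bd in \<open>auto split: split_indicator\<close>)
    also have "\<dots> = ennreal (l2_norm lborel I * C) * emeasure \<nu> {a<..t}"
      by (rule nn_integral_cmult_indicator) simp
    also have "\<dots> < \<infinity>"
      using emeasure_distribution_function_Ioc[OF distribution_functions_bv(1)[OF bv contf], of a t] a
      by (simp add: \<nu>_def total_variation_measure_def ennreal_mult_less_top)
    finally have "AE s in lborel. (\<integral>\<^sup>+r. indicator {a<..t} r * ennreal \<bar>I s * K r s\<bar> \<partial>\<nu>) \<noteq> \<infinity>"
      by (intro nn_integral_PInf_AE) auto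
    then show ?thesis
      by eventually_elim (auto simp: I_def less_top)
  qed
  have "AE s in lborel. \<forall>n::nat. t - real (Suc n) < s \<and> s < t \<longrightarrow>
    (\<integral>\<^sup>+r. indicator {t - real (Suc n)<..t} r * ennreal \<bar>K r s\<bar> \<partial>\<nu>) < \<infinity>"
    unfolding AE_all_countable by (intro allI fin) simp
  then show ?thesis
  proof eventually_elim
    case (elim s)
    show ?case
    proof
      assume st: "s < t"
      obtain n where n: "t - s < real n" using reals_Archimedean2 by blast
      have "(\<integral>\<^sup>+r. ennreal (norm (indicator {s<..t} r *\<^sub>R K r s)) \<partial>\<nu>)
        \<le> (\<integral>\<^sup>+r. indicator {t - real (Suc n)<..t} r * ennreal \<bar>K r s\<bar> \<partial>\<nu>)"
        using n by (intro nn_integral_mono) (auto split: split_indicator)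
      also have "\<dots> < \<infinity>" using elim st n by simp
      finally show "stieltjes_integrable f {s<..t} (\<lambda>r. K r s)"
        unfolding stieltjes_integrable_def set_integrable_def \<nu>_def[symmetric] integrable_iff_bounded
        by simp
    qed
  qed
qed

text \<open>The boundary value \<open>- f s * K t s\<close> from the integration by parts cancels the first term of the kernel
  operator.\<close>
lemma kernel_operator_eq:
  assumes K: "volterra_kernel K" and bv: "locally_bounded_variation f" and contf: "continuous_on UNIV f"
    and lim: "AE s in lborel. s < t \<longrightarrow> ((\<lambda>u. (f u - f s) * K u s) \<longlongrightarrow> 0) (at_right s)"
  shows "AE s in lborel. s < t \<longrightarrow> kernel_integrand K f s integrable_on {s..t} \<and>
    kernel_operator K f t s = f t * K t s - stieltjes_integral f {s<..t} (\<lambda>r. K r s)"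
proof -
  have "AE s in lborel. (\<lambda>t. K t s) C1_differentiable_on {s<..}"
    using K by (simp add: volterra_kernel_def)
  with lim volterra_kernel_stieltjes_integrable[OF K bv contf, of t] show ?thesis
  proof eventually_elim
    case (elim s)
    show ?case
    proof
      assume st: "s < t"
      have *: "(kernel_integrand K f s has_integral
          (f t - f s) * K t s - stieltjes_integral f {s<..t} (\<lambda>r. K r s)) {s..t}"
        using has_integral_by_parts_singular[OF bv contf st elim(3)] elim(1,2) st
        by (simp add: kernel_integrand_def[abs_def])
      then show "kernel_integrand K f s integrable_on {s..t} \<and>
        kernel_operator K f t s = f t * K t s - stieltjes_integral f {s<..t} (\<lambda>r. K r s)"
        by (auto simp: kernel_operator_def has_integral_integrable integral_unique algebra_simps)
    qed
  qed
qed

lemma wiener_integrands_iff: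
  assumes K: "volterra_kernel K" and bv: "locally_bounded_variation f" and contf: "continuous_on UNIV f"
    and lim: "AE s in lborel. s < t \<longrightarrow> ((\<lambda>u. (f u - f s) * K u s) \<longlongrightarrow> 0) (at_right s)"
  shows "f \<in> wiener_integrands K t \<longleftrightarrow>
    square_integrable_upto t (\<lambda>s. stieltjes_integral f {s<..t} (\<lambda>r. K r s))"
proof -
  define G where "G s = indicator {..t} s * stieltjes_integral f {s<..t} (\<lambda>r. K r s)" for s
  have K1: "sq_integrable lebesgue (\<lambda>s. f t * K t s)"
    by (intro sq_integrable_cmult sq_integrable_lborel_imp_lebesgue volterra_kernel_sq_integrable K)
  note ko = kernel_operator_eq[OF K bv contf lim]
  have fb: "f \<in> borel_measurable borel" using contf by (rule borel_measurable_continuous_onI)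
  have int: "AE s in lborel. s < t \<longrightarrow> kernel_integrand K f s integrable_on {s..t}"
    using ko by eventually_elim simp
  have "AE s in lborel. indicator {..t} s * kernel_operator K f t s = f t * K t s - G s"
    using ko AE_lborel_singleton[of t]
  proof eventually_elim
    case (elim s)
    then show ?case
      using volterra_kernel_eq_0[OF K, of t s] by (cases "s < t") (auto simp: G_def)
  qed
  from sq_integrable_lebesgue_cong_AE[OF this]
  have "f \<in> wiener_integrands K t \<longleftrightarrow> sq_integrable lebesgue (\<lambda>s. f t * K t s - G s)"
    using fb int by (simp add: wiener_integrands_def square_integrable_upto_iff)
  also have "\<dots> \<longleftrightarrow> sq_integrable lebesgue G"
    using sq_integrable_diff[OF K1, of "\<lambda>s. f t * K t s - G s"] sq_integrable_diff[OF K1, of G] by auto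
  finally show ?thesis by (simp add: square_integrable_upto_iff G_def[abs_def])
qed

section \<open>Elementary processes\<close>

lemma sigma_finite_lebesgue: "sigma_finite_measure (lebesgue :: real measure)"
proof -
  obtain A :: "real set set" where A: "countable A" "A \<subseteq> sets lborel" "\<Union>A = space lborel" "\<forall>a\<in>A. emeasure lborel a \<noteq> \<infinity>"
    using lborel.sigma_finite_countable by blast
  show ?thesis
  proof
    show "\<exists>A::real set set. countable A \<and> A \<subseteq> sets lebesgue \<and> \<Union>A = space lebesgue \<and> (\<forall>a\<in>A. emeasure lebesgue a \<noteq> \<infinity>)"
      using A by (intro exI[of _ A]) (auto simp: subset_iff)
  qed
qed

lemma measurable_lebesgue_pair:
  assumes "\<phi> \<in> measurable (borel \<Otimes>\<^sub>M M) L"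
  shows "\<phi> \<in> measurable (lebesgue \<Otimes>\<^sub>M M) L"
proof -
  have "(\<lambda>z. (fst z, snd z)) \<in> measurable (lebesgue \<Otimes>\<^sub>M M) (borel \<Otimes>\<^sub>M M)"
  proof (rule measurable_Pair)
    have "(\<lambda>x. x) \<in> measurable lebesgue borel" by (rule measurable_completion) simp
    from measurable_compose[OF measurable_fst this]
    show "fst \<in> measurable (lebesgue \<Otimes>\<^sub>M M) borel" .
  qed simp
  from measurable_compose[OF this assms] show ?thesis by simp
qed

lemma sq_integrable_indicator:
  "A \<in> sets M \<Longrightarrow> emeasure M A < \<infinity> \<Longrightarrow> sq_integrable M (indicator A :: _ \<Rightarrow> real)"
proof -
  assume A: "A \<in> sets M" "emeasure M A < \<infinity>"
  have "(indicator A x :: real)\<^sup>2 = indicator A x" for x by (simp split: split_indicator)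
  then show ?thesis using A by (simp add: sq_integrable_def)
qed

lemma elementary_integrand_simps [simp]:
  "elementary_integrand M F []"
  "elementary_integrand M F ((a, b, \<xi>) # S) \<longleftrightarrow>
    (a \<le> b \<and> \<xi> \<in> borel_measurable (F a) \<and> bounded (\<xi> ` space M)) \<and> elementary_integrand M F S"
  "elementary_integrand M F (S @ S') \<longleftrightarrow> elementary_integrand M F S \<and> elementary_integrand M F S'"
  by (simp_all add: elementary_integrand_def ball_Un)

lemma elementary_process_simps [simp]:
  "elementary_process [] s \<omega> = 0"
  "elementary_process ((a, b, \<xi>) # S) s \<omega> = indicator {a<..b} s * \<xi> \<omega> + elementary_process S s \<omega>"
  "elementary_process (S @ S') s \<omega> = elementary_process S s \<omega> + elementary_process S' s \<omega>"
  by (simp_all add: elementary_process_def)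

lemma elementary_integral_simps [simp]:
  "elementary_integral B [] \<omega> = 0"
  "elementary_integral B ((a, b, \<xi>) # S) \<omega> = \<xi> \<omega> * (B b \<omega> - B a \<omega>) + elementary_integral B S \<omega>"
  "elementary_integral B (S @ S') \<omega> = elementary_integral B S \<omega> + elementary_integral B S' \<omega>"
  by (simp_all add: elementary_integral_def)

text \<open>Scalar multiples of elementary processes; sums are concatenations of lists.\<close>
definition scale_elementary :: "real \<Rightarrow> 'a elementary \<Rightarrow> 'a elementary" where
  "scale_elementary c S = map (\<lambda>(a, b, \<xi>). (a, b, \<lambda>\<omega>. c * \<xi> \<omega>)) S"

lemma scale_elementary:
  "elementary_process (scale_elementary c S) s \<omega> = c * elementary_process S s \<omega>"
  "elementary_integral B (scale_elementary c S) \<omega> = c * elementary_integral B S \<omega>"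
  "elementary_integrand M F S \<Longrightarrow> elementary_integrand M F (scale_elementary c S)"
proof -
  show "elementary_process (scale_elementary c S) s \<omega> = c * elementary_process S s \<omega>"
    "elementary_integral B (scale_elementary c S) \<omega> = c * elementary_integral B S \<omega>"
    by (induction S) (auto simp: scale_elementary_def algebra_simps)
  assume "elementary_integrand M F S"
  then show "elementary_integrand M F (scale_elementary c S)"
  proof (induction S)
    case (Cons x S)
    obtain a b \<xi> where x: "x = (a, b, \<xi>)" by (cases x) auto
    have "bounded ((\<lambda>\<omega>. c * \<xi> \<omega>) ` space M)"
      using Cons.prems bounded_scaling[of "\<xi> ` space M" c] by (simp add: x image_image)
    then show ?case using Cons by (auto simp: x scale_elementary_def)
  qed (simp add: scale_elementary_def)
qed

context two_sided_brownian_motion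
begin

text \<open>The measure space of integrands, \<open>ds \<otimes> P\<close>.\<close>
abbreviation N :: "(real \<times> 'a) measure" where "N \<equiv> lebesgue \<Otimes>\<^sub>M M"

lemma sigma_finite_N: "sigma_finite_measure N"
proof -
  interpret L: sigma_finite_measure "lebesgue :: real measure" by (rule sigma_finite_lebesgue)
  interpret P: pair_sigma_finite "lebesgue :: real measure" M ..
  show ?thesis by (rule P.sigma_finite_measure_axioms)
qed

lemma F_measurable: "\<xi> \<in> borel_measurable (F a) \<Longrightarrow> \<xi> \<in> borel_measurable M"
  by (rule borel_measurable_subalgebra[OF sets_F_subset space_F])

lemma F_measurable_mono: "\<xi> \<in> borel_measurable (F a) \<Longrightarrow> a \<le> b \<Longrightarrow> \<xi> \<in> borel_measurable (F b)"
  by (rule borel_measurable_subalgebra[of "F a" "F b"]) (auto simp: space_F dest: sets_F_mono)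

section \<open>Increments\<close>

lemma increment_measurable:
  "a \<le> b \<Longrightarrow> (\<lambda>\<omega>. B b \<omega> - B a \<omega>) \<in> borel_measurable (F b)"
  using increment_adapted[of "b - a" a] by simp

text \<open>Square integrability is read off from the variance: the Bochner integral of a non-integrable function is
  zero, whereas the variance of a nontrivial increment is positive.\<close>
lemma increment_sq_integrable:
  assumes "a \<le> b"
  shows "sq_integrable M (\<lambda>\<omega>. B b \<omega> - B a \<omega>)"
proof (cases "a = b")
  case False
  define D where "D \<omega> = B b \<omega> - B a \<omega>" for \<omega>
  have [measurable]: "D \<in> borel_measurable M"
    unfolding D_def by (rule F_measurable[OF increment_measurable[OF assms]])
  have "variance D = b - a" using increment_variance[of "b - a" a] assms by (simp add: D_def[abs_def])
  then have "integrable M (\<lambda>\<omega>. (D \<omega> - expectation D)\<^sup>2)"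
    using False not_integrable_integral_eq[of M "\<lambda>\<omega>. (D \<omega> - expectation D)\<^sup>2"] by auto
  then have "sq_integrable M (\<lambda>\<omega>. D \<omega> - expectation D)" by (simp add: sq_integrable_def)
  from sq_integrable_add[OF this, of "\<lambda>_. expectation D"] show ?thesis
    by (simp add: sq_integrable_def D_def)
qed simp

lemma sq_integrable_imp_integrable: "sq_integrable M f \<Longrightarrow> integrable M f"
  using sq_integrable_mult[of M f "\<lambda>_. 1"] by (simp add: sq_integrable_def)

lemma B_integrable: "integrable M (B t)"
proof (cases "0 \<le> t")
  case True
  have "integrable M (\<lambda>\<omega>. B t \<omega> - B 0 \<omega>)"
    by (rule sq_integrable_imp_integrable[OF increment_sq_integrable[OF True]])
  then show ?thesis by (rule Bochner_Integration.integrable_cong[THEN iffD1, rotated -1]) (simp_all add: zero)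
next
  case False
  then have "integrable M (\<lambda>\<omega>. - (B 0 \<omega> - B t \<omega>))"
    by (intro Bochner_Integration.integrable_minus sq_integrable_imp_integrable increment_sq_integrable) simp
  then show ?thesis by (rule Bochner_Integration.integrable_cong[THEN iffD1, rotated -1]) (simp_all add: zero)
qed

lemma increment_expectation: "expectation (\<lambda>\<omega>. B b \<omega> - B a \<omega>) = 0"
  using centered by (simp add: B_integrable)

lemma increment_second_moment:
  "a \<le> b \<Longrightarrow> expectation (\<lambda>\<omega>. (B b \<omega> - B a \<omega>)\<^sup>2) = b - a"
  using increment_variance[of "b - a" a] increment_expectation[of b a] by simp

lemma increment_indep_var:
  assumes "a \<le> b" and Z: "Z \<in> borel_measurable (F a)"
  shows "indep_var borel (\<lambda>\<omega>. B b \<omega> - B a \<omega>) borel Z"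
  unfolding indep_var_eq
proof (intro conjI)
  define D where "D \<omega> = B b \<omega> - B a \<omega>" for \<omega>
  show "random_variable borel (\<lambda>\<omega>. B b \<omega> - B a \<omega>)"
    by (rule F_measurable[OF increment_measurable[OF assms(1)]])
  show "random_variable borel Z" by (rule F_measurable[OF Z])
  have 1: "indep_set (sets (vimage_algebra (space M) D borel)) (sets (F a))"
    using increment_indep[of "b - a" a] assms(1) by (simp add: D_def[abs_def])
  have 2: "{Z -` A \<inter> space M | A. A \<in> sets borel} \<subseteq> sets (F a)"
    using measurable_sets[OF Z] by (auto simp: space_F)
  have "sigma_sets (space M) {Z -` A \<inter> space M | A. A \<in> sets borel} \<subseteq> sets (F a)"
    using sets.sigma_sets_subset[OF 2] by (simp add: space_F)
  moreover have "sigma_sets (space M) {D -` A \<inter> space M | A. A \<in> sets borel} \<subseteq> sets (vimage_algebra (space M) D borel)"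
    unfolding vimage_algebra_def by (subst sets_measure_of) auto
  ultimately show "indep_set (sigma_sets (space M) {(\<lambda>\<omega>. B b \<omega> - B a \<omega>) -` A \<inter> space M |A. A \<in> sets borel})
     (sigma_sets (space M) {Z -` A \<inter> space M |A. A \<in> sets borel})"
    using 1 unfolding indep_set_def D_def
    by (elim indep_sets_mono_sets) (auto split: bool.split)
qed

lemma increment_orthogonal:
  assumes "a \<le> b" "Z \<in> borel_measurable (F a)" "integrable M Z"
  shows "expectation (\<lambda>\<omega>. Z \<omega> * (B b \<omega> - B a \<omega>)) = 0"
  using indep_var_lebesgue_integral[OF increment_indep_var[OF assms(1,2)]
      sq_integrable_imp_integrable[OF increment_sq_integrable[OF assms(1)]] assms(3)]
  by (simp only: increment_expectation mult.commute mult_zero_left)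

lemma increment_square_factor:
  assumes "a \<le> b" "Z \<in> borel_measurable (F a)" "integrable M Z"
  shows "expectation (\<lambda>\<omega>. Z \<omega> * (B b \<omega> - B a \<omega>)\<^sup>2) = expectation Z * (b - a)"
proof -
  have "indep_var borel ((\<lambda>x. x\<^sup>2) \<circ> (\<lambda>\<omega>. B b \<omega> - B a \<omega>)) borel ((\<lambda>x. x) \<circ> Z)"
    by (rule indep_var_compose[OF increment_indep_var[OF assms(1,2)]]) simp_all
  then have "indep_var borel (\<lambda>\<omega>. (B b \<omega> - B a \<omega>)\<^sup>2) borel Z" by (simp add: comp_def)
  from indep_var_lebesgue_integral[OF this _ assms(3)] increment_sq_integrable[OF assms(1)]
  show ?thesis by (simp add: increment_second_moment[OF assms(1)] sq_integrable_def mult.commute)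
qed

section \<open>The isometry for elementary processes\<close>

text \<open>The coefficients allowed for an interval starting at \<open>a\<close> in an elementary process.\<close>
definition weight :: "real \<Rightarrow> ('a \<Rightarrow> real) \<Rightarrow> bool" where
  "weight a \<xi> \<longleftrightarrow> \<xi> \<in> borel_measurable (F a) \<and> bounded (\<xi> ` space M)"

lemma weight_mono: "weight a \<xi> \<Longrightarrow> a \<le> b \<Longrightarrow> weight b \<xi>"
  by (auto simp: weight_def intro: F_measurable_mono)

lemma weight_bound:
  assumes "weight a \<xi>"
  obtains C where "\<And>\<omega>. \<omega> \<in> space M \<Longrightarrow> \<bar>\<xi> \<omega>\<bar> \<le> C" "0 \<le> C"
proof -
  obtain C where "\<forall>x\<in>\<xi> ` space M. norm x \<le> C" using assms by (auto simp: weight_def bounded_iff)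
  then have "\<bar>\<xi> \<omega>\<bar> \<le> \<bar>C\<bar>" if "\<omega> \<in> space M" for \<omega> using that by force
  then show ?thesis using that[of "\<bar>C\<bar>"] by simp
qed

lemma weight_mult_sq_integrable:
  assumes w: "weight a \<xi>" and f: "sq_integrable M f"
  shows "sq_integrable M (\<lambda>\<omega>. \<xi> \<omega> * f \<omega>)"
proof -
  obtain C where C: "\<And>\<omega>. \<omega> \<in> space M \<Longrightarrow> \<bar>\<xi> \<omega>\<bar> \<le> C" "0 \<le> C" using w by (rule weight_bound) blast
  have [measurable]: "\<xi> \<in> borel_measurable M" "f \<in> borel_measurable M"
    using w f F_measurable by (auto simp: weight_def sq_integrable_def)
  show ?thesis
  proof (rule sq_integrable_bound[OF sq_integrable_cmult[OF f, of C]])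
    show "AE \<omega> in M. \<bar>\<xi> \<omega> * f \<omega>\<bar> \<le> \<bar>C * f \<omega>\<bar>"
      using C by (intro AE_I2) (auto simp: abs_mult intro!: mult_right_mono)
  qed measurable
qed

lemma weight_sq_integrable: "weight a \<xi> \<Longrightarrow> sq_integrable M \<xi>"
  using weight_mult_sq_integrable[of a \<xi> "\<lambda>_. 1"] by (simp add: sq_integrable_def)

lemma elementary_term_sq_integrable:
  "weight a \<xi> \<Longrightarrow> c \<le> d \<Longrightarrow> sq_integrable M (\<lambda>\<omega>. \<xi> \<omega> * (B d \<omega> - B c \<omega>))"
  by (intro weight_mult_sq_integrable increment_sq_integrable)

lemma elementary_terms_disjoint:
  assumes ab: "a \<le> b" "b \<le> c" "c \<le> d" and w: "weight b \<xi>" "weight c \<eta>"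
  shows "expectation (\<lambda>\<omega>. (\<xi> \<omega> * (B b \<omega> - B a \<omega>)) * (\<eta> \<omega> * (B d \<omega> - B c \<omega>))) = 0"
proof -
  define Z where "Z \<omega> = (\<xi> \<omega> * (B b \<omega> - B a \<omega>)) * \<eta> \<omega>" for \<omega>
  have "\<xi> \<in> borel_measurable (F c)" "\<eta> \<in> borel_measurable (F c)" "(\<lambda>\<omega>. B b \<omega> - B a \<omega>) \<in> borel_measurable (F c)"
    using w F_measurable_mono[OF _ ab(2)] increment_measurable[OF ab(1)] by (auto simp: weight_def)
  then have "Z \<in> borel_measurable (F c)" unfolding Z_def by simp
  moreover have "integrable M Z"
    unfolding Z_def by (intro sq_integrable_mult elementary_term_sq_integrable[OF w(1) ab(1)] weight_sq_integrable[OF w(2)])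
  ultimately have "expectation (\<lambda>\<omega>. Z \<omega> * (B d \<omega> - B c \<omega>)) = 0"
    using increment_orthogonal[OF ab(3)] by blast
  then show ?thesis by (simp add: Z_def mult.assoc)
qed

lemma elementary_terms_same:
  assumes "c \<le> d" and w: "weight c \<xi>" "weight c \<eta>"
  shows "expectation (\<lambda>\<omega>. (\<xi> \<omega> * (B d \<omega> - B c \<omega>)) * (\<eta> \<omega> * (B d \<omega> - B c \<omega>)))
    = expectation (\<lambda>\<omega>. \<xi> \<omega> * \<eta> \<omega>) * (d - c)"
proof -
  have "(\<lambda>\<omega>. \<xi> \<omega> * \<eta> \<omega>) \<in> borel_measurable (F c)" using w by (auto simp: weight_def)
  from increment_square_factor[OF assms(1) this sq_integrable_mult[OF w[THEN weight_sq_integrable]]]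
  show ?thesis by (simp add: power2_eq_square mult_ac)
qed

text \<open>Overlapping intervals are cut at the endpoints of both; by independence and centering only the pair of equal
  pieces contributes.\<close>
lemma elementary_terms_ordered:
  assumes ab: "a \<le> b" "c \<le> d" "a \<le> c" and w: "weight a \<xi>" "weight c \<eta>"
  shows "expectation (\<lambda>\<omega>. (\<xi> \<omega> * (B b \<omega> - B a \<omega>)) * (\<eta> \<omega> * (B d \<omega> - B c \<omega>)))
    = measure lborel ({a<..b} \<inter> {c<..d}) * expectation (\<lambda>\<omega>. \<xi> \<omega> * \<eta> \<omega>)"
proof -
  define T where "T x y \<omega> = \<xi> \<omega> * (B y \<omega> - B x \<omega>)" for x y \<omega>
  define U where "U x y \<omega> = \<eta> \<omega> * (B y \<omega> - B x \<omega>)" for x y \<omega>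
  have int: "integrable M (\<lambda>\<omega>. T x y \<omega> * U x' y' \<omega>)" if "x \<le> y" "x' \<le> y'" for x y x' y'
    unfolding T_def U_def using that by (intro sq_integrable_mult elementary_term_sq_integrable[OF w(1)] elementary_term_sq_integrable[OF w(2)])
  have w': "weight c \<xi>" using weight_mono[OF w(1) ab(3)] .
  consider "b \<le> c" | "c < b" "b \<le> d" | "d < b" by linarith
  then have "expectation (\<lambda>\<omega>. T a b \<omega> * U c d \<omega>) = measure lborel ({a<..b} \<inter> {c<..d}) * expectation (\<lambda>\<omega>. \<xi> \<omega> * \<eta> \<omega>)"
  proof cases
    case 1
    then have eq: "{a<..b} \<inter> {c<..d} = {}" by auto
    show ?thesis unfolding eq
      using elementary_terms_disjoint[OF ab(1) 1 ab(2) weight_mono[OF w(1) ab(1)] w(2)]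
      by (simp add: T_def U_def)
  next
    case 2
    have eq: "{a<..b} \<inter> {c<..d} = {c<..b}" using 2 ab by auto
    have "T a b \<omega> * U c d \<omega> = T a c \<omega> * U c d \<omega> + (T c b \<omega> * U c b \<omega> + T c b \<omega> * U b d \<omega>)" for \<omega>
      by (simp add: T_def U_def algebra_simps)
    then have "expectation (\<lambda>\<omega>. T a b \<omega> * U c d \<omega>)
      = expectation (\<lambda>\<omega>. T a c \<omega> * U c d \<omega>) + (expectation (\<lambda>\<omega>. T c b \<omega> * U c b \<omega>) + expectation (\<lambda>\<omega>. T c b \<omega> * U b d \<omega>))"
      using 2 ab by (simp add: int)
    also have "expectation (\<lambda>\<omega>. T a c \<omega> * U c d \<omega>) = 0"
      unfolding T_def U_def using 2 ab by (intro elementary_terms_disjoint w w') auto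
    also have "expectation (\<lambda>\<omega>. T c b \<omega> * U b d \<omega>) = 0"
      unfolding T_def U_def using 2 ab
      by (intro elementary_terms_disjoint weight_mono[OF w(1)] weight_mono[OF w(2)]) auto
    also have "expectation (\<lambda>\<omega>. T c b \<omega> * U c b \<omega>) = expectation (\<lambda>\<omega>. \<xi> \<omega> * \<eta> \<omega>) * (b - c)"
      unfolding T_def U_def using 2 by (intro elementary_terms_same w w') auto
    finally show ?thesis unfolding eq using 2 by simp
  next
    case 3
    have eq: "{a<..b} \<inter> {c<..d} = {c<..d}" using 3 ab by auto
    have "T a b \<omega> * U c d \<omega> = T a c \<omega> * U c d \<omega> + (T c d \<omega> * U c d \<omega> + T d b \<omega> * U c d \<omega>)" for \<omega>
      by (simp add: T_def U_def algebra_simps)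
    then have "expectation (\<lambda>\<omega>. T a b \<omega> * U c d \<omega>)
      = expectation (\<lambda>\<omega>. T a c \<omega> * U c d \<omega>) + (expectation (\<lambda>\<omega>. T c d \<omega> * U c d \<omega>) + expectation (\<lambda>\<omega>. T d b \<omega> * U c d \<omega>))"
      using 3 ab by (simp add: int)
    also have "expectation (\<lambda>\<omega>. T a c \<omega> * U c d \<omega>) = 0"
      unfolding T_def U_def using 3 ab by (intro elementary_terms_disjoint w w') auto
    also have "expectation (\<lambda>\<omega>. T d b \<omega> * U c d \<omega>) = expectation (\<lambda>\<omega>. U c d \<omega> * T d b \<omega>)"
      by (simp add: mult.commute)
    also have "\<dots> = 0"
      unfolding T_def U_def using 3 ab
      by (intro elementary_terms_disjoint weight_mono[OF w(1)] weight_mono[OF w(2)]) auto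
    also have "expectation (\<lambda>\<omega>. T c d \<omega> * U c d \<omega>) = expectation (\<lambda>\<omega>. \<xi> \<omega> * \<eta> \<omega>) * (d - c)"
      unfolding T_def U_def using ab by (intro elementary_terms_same w w') auto
    finally show ?thesis unfolding eq using ab by simp
  qed
  then show ?thesis by (simp add: T_def U_def)
qed

lemma elementary_terms:
  assumes ab: "a \<le> b" "c \<le> d" and w: "weight a \<xi>" "weight c \<eta>"
  shows "expectation (\<lambda>\<omega>. (\<xi> \<omega> * (B b \<omega> - B a \<omega>)) * (\<eta> \<omega> * (B d \<omega> - B c \<omega>)))
    = measure lborel ({a<..b} \<inter> {c<..d}) * expectation (\<lambda>\<omega>. \<xi> \<omega> * \<eta> \<omega>)"
proof (cases "a \<le> c")
  case False
  then have "expectation (\<lambda>\<omega>. (\<eta> \<omega> * (B d \<omega> - B c \<omega>)) * (\<xi> \<omega> * (B b \<omega> - B a \<omega>)))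
    = measure lborel ({c<..d} \<inter> {a<..b}) * expectation (\<lambda>\<omega>. \<eta> \<omega> * \<xi> \<omega>)"
    using elementary_terms_ordered[OF ab(2,1) _ w(2,1)] by simp
  then show ?thesis by (simp only: mult.commute Int_commute)
qed (use elementary_terms_ordered[OF ab _ w] in simp)

lemma elementary_step_sq_integrable:
  assumes w: "weight a \<xi>"
  shows "sq_integrable N (\<lambda>z. indicator {c<..d} (fst z) * \<xi> (snd z))"
proof -
  obtain C where C: "\<And>\<omega>. \<omega> \<in> space M \<Longrightarrow> \<bar>\<xi> \<omega>\<bar> \<le> C" "0 \<le> C" using w by (rule weight_bound) blast
  have [measurable]: "\<xi> \<in> borel_measurable M" using w F_measurable by (auto simp: weight_def)
  have "emeasure lborel {c<..d} < \<infinity>" by (cases "c \<le> d") auto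
  then have fin: "emeasure N ({c<..d} \<times> space M) < \<infinity>"
    by (subst emeasure_pair_measure_Times) (auto simp: emeasure_space_1)
  have "sq_integrable N (\<lambda>z. C * indicator ({c<..d} \<times> space M) z)"
    by (intro sq_integrable_cmult sq_integrable_indicator fin) auto
  then show ?thesis
  proof (rule sq_integrable_bound)
    have "(\<lambda>z. indicator {c<..d} (fst z) * \<xi> (snd z)) \<in> borel_measurable (borel \<Otimes>\<^sub>M M)" by measurable
    then show "(\<lambda>z. indicator {c<..d} (fst z) * \<xi> (snd z)) \<in> borel_measurable N"
      by (rule measurable_lebesgue_pair)
    show "AE z in N. \<bar>indicator {c<..d} (fst z) * \<xi> (snd z)\<bar> \<le> \<bar>C * indicator ({c<..d} \<times> space M) z\<bar>"
      using C by (intro AE_I2) (auto simp: space_pair_measure split: split_indicator)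
  qed
qed

lemma elementary_steps:
  assumes w: "weight a \<xi>" "weight c \<eta>"
  shows "(\<integral>z. (indicator {a<..b} (fst z) * \<xi> (snd z)) * (indicator {c<..d} (fst z) * \<eta> (snd z)) \<partial>N)
    = measure lborel ({a<..b} \<inter> {c<..d}) * expectation (\<lambda>\<omega>. \<xi> \<omega> * \<eta> \<omega>)"
proof -
  interpret L: sigma_finite_measure "lebesgue :: real measure" by (rule sigma_finite_lebesgue)
  interpret P: pair_sigma_finite "lebesgue :: real measure" M ..
  have "(\<integral>z. (indicator {a<..b} (fst z) * \<xi> (snd z)) * (indicator {c<..d} (fst z) * \<eta> (snd z)) \<partial>N)
    = (\<integral>s. (\<integral>\<omega>. (indicator {a<..b} s * \<xi> \<omega>) * (indicator {c<..d} s * \<eta> \<omega>) \<partial>M) \<partial>lebesgue)"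
    using P.integral_fst'[OF sq_integrable_mult[OF elementary_step_sq_integrable[OF w(1)] elementary_step_sq_integrable[OF w(2)]]]
    by simp
  also have "\<dots> = (\<integral>s. indicator ({a<..b} \<inter> {c<..d}) s * expectation (\<lambda>\<omega>. \<xi> \<omega> * \<eta> \<omega>) \<partial>lebesgue)"
    by (intro Bochner_Integration.integral_cong refl) (simp split: split_indicator)
  also have "\<dots> = measure lborel ({a<..b} \<inter> {c<..d}) * expectation (\<lambda>\<omega>. \<xi> \<omega> * \<eta> \<omega>)"
    by simp
  finally show ?thesis .
qed

lemma elementary_sq_integrable:
  assumes "elementary_integrand M F S"
  shows "sq_integrable M (elementary_integral B S)"
    and "sq_integrable N (\<lambda>z. elementary_process S (fst z) (snd z))"
proof -
  have "sq_integrable M (elementary_integral B S) \<and> sq_integrable N (\<lambda>z. elementary_process S (fst z) (snd z))"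
    using assms
  proof (induction S)
    case (Cons x S)
    obtain a b \<xi> where x: "x = (a, b, \<xi>)" by (cases x) auto
    from Cons.prems have w: "weight a \<xi>" and ab: "a \<le> b" and S: "elementary_integrand M F S"
      by (auto simp: x weight_def)
    have "sq_integrable M (elementary_integral B (x # S))"
      unfolding x elementary_integral_simps[abs_def]
      using Cons.IH[OF S] by (intro sq_integrable_add elementary_term_sq_integrable[OF w ab]) auto
    moreover have "sq_integrable N (\<lambda>z. elementary_process (x # S) (fst z) (snd z))"
      unfolding x elementary_process_simps
      using Cons.IH[OF S] by (intro sq_integrable_add elementary_step_sq_integrable[OF w]) auto
    ultimately show ?case ..
  qed (simp_all add: elementary_integral_def[abs_def] elementary_process_def)
  then show "sq_integrable M (elementary_integral B S)"
    "sq_integrable N (\<lambda>z. elementary_process S (fst z) (snd z))" by auto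
qed

lemma elementary_isometry_single:
  assumes "a \<le> b" "weight a \<xi>" "elementary_integrand M F S"
  shows "expectation (\<lambda>\<omega>. (\<xi> \<omega> * (B b \<omega> - B a \<omega>)) * elementary_integral B S \<omega>)
    = (\<integral>z. (indicator {a<..b} (fst z) * \<xi> (snd z)) * elementary_process S (fst z) (snd z) \<partial>N)"
  using assms(3)
proof (induction S)
  case (Cons x S)
  obtain c d \<eta> where x: "x = (c, d, \<eta>)" by (cases x) auto
  from Cons.prems have w: "weight c \<eta>" and cd: "c \<le> d" and S: "elementary_integrand M F S"
    by (auto simp: x weight_def)
  note t = elementary_term_sq_integrable[OF assms(2,1)] and p = elementary_step_sq_integrable[OF assms(2), of a b]
  show ?case
    unfolding x elementary_integral_simps elementary_process_simps distrib_left
    using sq_integrable_mult[OF t elementary_term_sq_integrable[OF w cd]]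
      sq_integrable_mult[OF t elementary_sq_integrable(1)[OF S]]
      sq_integrable_mult[OF p elementary_step_sq_integrable[OF w, of c d]]
      sq_integrable_mult[OF p elementary_sq_integrable(2)[OF S]]
      elementary_terms[OF assms(1) cd assms(2) w] elementary_steps[OF assms(2) w, of b d] Cons.IH[OF S]
    by simp
qed simp

lemma elementary_isometry:
  assumes "elementary_integrand M F S" "elementary_integrand M F S'"
  shows "expectation (\<lambda>\<omega>. elementary_integral B S \<omega> * elementary_integral B S' \<omega>)
    = (\<integral>z. elementary_process S (fst z) (snd z) * elementary_process S' (fst z) (snd z) \<partial>N)"
  using assms(1)
proof (induction S)
  case (Cons x S)
  obtain a b \<xi> where x: "x = (a, b, \<xi>)" by (cases x) auto
  from Cons.prems have w: "weight a \<xi>" and ab: "a \<le> b" and S: "elementary_integrand M F S"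
    by (auto simp: x weight_def)
  show ?case
    unfolding x elementary_integral_simps elementary_process_simps distrib_right
    using sq_integrable_mult[OF elementary_term_sq_integrable[OF w ab] elementary_sq_integrable(1)[OF assms(2)]]
      sq_integrable_mult[OF elementary_sq_integrable(1)[OF S] elementary_sq_integrable(1)[OF assms(2)]]
      sq_integrable_mult[OF elementary_step_sq_integrable[OF w, of a b] elementary_sq_integrable(2)[OF assms(2)]]
      sq_integrable_mult[OF elementary_sq_integrable(2)[OF S] elementary_sq_integrable(2)[OF assms(2)]]
      elementary_isometry_single[OF ab w assms(2)] Cons.IH[OF S]
    by simp
qed simp

lemma elementary_isometry_norm:
  assumes "elementary_integrand M F S"
  shows "l2_norm M (elementary_integral B S) = l2_norm N (\<lambda>z. elementary_process S (fst z) (snd z))"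
  using elementary_isometry[OF assms assms] by (simp add: l2_norm_def power2_eq_square)

lemma elementary_isometry_dist:
  assumes "elementary_integrand M F S" "elementary_integrand M F S'"
  shows "l2_norm M (\<lambda>\<omega>. elementary_integral B S \<omega> - elementary_integral B S' \<omega>)
    = l2_norm N (\<lambda>z. elementary_process S (fst z) (snd z) - elementary_process S' (fst z) (snd z))"
  using elementary_isometry_norm[of "S @ scale_elementary (- 1) S'"] assms
  by (simp add: scale_elementary elementary_integral_simps[abs_def])

section \<open>The Ito integral as an isometry\<close>

lemma has_ito_integralI:
  assumes "sq_integrable N (\<lambda>z. H (fst z) (snd z))" "sq_integrable M Y"
    and S: "\<And>n. elementary_integrand M F (S n)"
    and "(\<lambda>n. l2_norm N (\<lambda>z. H (fst z) (snd z) - elementary_process (S n) (fst z) (snd z))) \<longlonglongrightarrow> 0"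
    and "(\<lambda>n. l2_norm M (\<lambda>\<omega>. Y \<omega> - elementary_integral B (S n) \<omega>)) \<longlonglongrightarrow> 0"
  shows "has_ito_integral M F B H Y"
  unfolding has_ito_integral_def
  using assms l2_norm_tendsto_0_nn_integral[OF assms(1) elementary_sq_integrable(2)[OF S] assms(4)]
    l2_norm_tendsto_0_nn_integral[OF assms(2) elementary_sq_integrable(1)[OF S] assms(5)]
  by (auto simp: split_beta' sq_integrable_def)

lemma has_ito_integralE:
  assumes "has_ito_integral M F B H Y"
  obtains S where "sq_integrable N (\<lambda>z. H (fst z) (snd z))" "sq_integrable M Y"
    and "\<And>n. elementary_integrand M F (S n)"
    and "(\<lambda>n. l2_norm N (\<lambda>z. H (fst z) (snd z) - elementary_process (S n) (fst z) (snd z))) \<longlonglongrightarrow> 0"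
    and "(\<lambda>n. l2_norm M (\<lambda>\<omega>. Y \<omega> - elementary_integral B (S n) \<omega>)) \<longlonglongrightarrow> 0"
proof -
  obtain S where S: "\<And>n. elementary_integrand M F (S n)"
    "(\<lambda>n. \<integral>\<^sup>+z. ennreal ((H (fst z) (snd z) - elementary_process (S n) (fst z) (snd z))\<^sup>2) \<partial>N) \<longlonglongrightarrow> 0"
    "(\<lambda>n. \<integral>\<^sup>+\<omega>. ennreal ((Y \<omega> - elementary_integral B (S n) \<omega>)\<^sup>2) \<partial>M) \<longlonglongrightarrow> 0"
    using assms by (auto simp: has_ito_integral_def split_beta')
  have m: "(\<lambda>z. H (fst z) (snd z)) \<in> borel_measurable N" "Y \<in> borel_measurable M"
    using assms by (auto simp: has_ito_integral_def split_beta')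
  show ?thesis
    using that nn_integral_power2_tendsto_0[OF m(1) elementary_sq_integrable(2)[OF S(1)] S(2)]
      nn_integral_power2_tendsto_0[OF m(2) elementary_sq_integrable(1)[OF S(1)] S(3)] S(1) by blast
qed

lemma has_ito_integral_sq_integrable:
  assumes "has_ito_integral M F B H Y"
  shows "sq_integrable N (\<lambda>z. H (fst z) (snd z))" "sq_integrable M Y"
  using has_ito_integralE[OF assms] by blast+

lemma has_ito_integral_norm:
  assumes "has_ito_integral M F B H Y"
  shows "l2_norm M Y = l2_norm N (\<lambda>z. H (fst z) (snd z))"
proof -
  obtain S where S: "sq_integrable N (\<lambda>z. H (fst z) (snd z))" "sq_integrable M Y"
    "\<And>n. elementary_integrand M F (S n)"
    "(\<lambda>n. l2_norm N (\<lambda>z. H (fst z) (snd z) - elementary_process (S n) (fst z) (snd z))) \<longlonglongrightarrow> 0"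
    "(\<lambda>n. l2_norm M (\<lambda>\<omega>. Y \<omega> - elementary_integral B (S n) \<omega>)) \<longlonglongrightarrow> 0"
    using assms by (rule has_ito_integralE) blast
  have "(\<lambda>n. l2_norm M (elementary_integral B (S n))) \<longlonglongrightarrow> l2_norm M Y"
    by (rule l2_norm_tendsto[OF S(2) elementary_sq_integrable(1)[OF S(3)] S(5)])
  moreover have "(\<lambda>n. l2_norm M (elementary_integral B (S n))) \<longlonglongrightarrow> l2_norm N (\<lambda>z. H (fst z) (snd z))"
    unfolding elementary_isometry_norm[OF S(3)]
    by (rule l2_norm_tendsto[OF S(1) elementary_sq_integrable(2)[OF S(3)] S(4)])
  ultimately show ?thesis by (rule LIMSEQ_unique)
qed

lemma has_ito_integral_lincomb:
  assumes "has_ito_integral M F B H Y" "has_ito_integral M F B H' Y'"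
  shows "has_ito_integral M F B (\<lambda>s \<omega>. H s \<omega> + c * H' s \<omega>) (\<lambda>\<omega>. Y \<omega> + c * Y' \<omega>)"
proof -
  have lim: "(\<lambda>n. l2_norm L (\<lambda>x. (p x + c * p' x) - (q n x + c * q' n x))) \<longlonglongrightarrow> 0"
    if sq: "sq_integrable L p" "sq_integrable L p'" "\<And>n. sq_integrable L (q n)" "\<And>n. sq_integrable L (q' n)"
      and "(\<lambda>n. l2_norm L (\<lambda>x. p x - q n x)) \<longlonglongrightarrow> 0" "(\<lambda>n. l2_norm L (\<lambda>x. p' x - q' n x)) \<longlonglongrightarrow> 0"
    for L :: "'b measure" and p p' q q'
  proof (rule tendsto_sandwich[OF always_eventually always_eventually tendsto_const])
    have "(\<lambda>n. l2_norm L (\<lambda>x. p x - q n x) + \<bar>c\<bar> * l2_norm L (\<lambda>x. p' x - q' n x)) \<longlonglongrightarrow> 0 + \<bar>c\<bar> * 0"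
      by (intro tendsto_intros that)
    then show "(\<lambda>n. l2_norm L (\<lambda>x. p x - q n x) + \<bar>c\<bar> * l2_norm L (\<lambda>x. p' x - q' n x)) \<longlonglongrightarrow> 0" by simp
    show "\<forall>n. l2_norm L (\<lambda>x. (p x + c * p' x) - (q n x + c * q' n x))
      \<le> l2_norm L (\<lambda>x. p x - q n x) + \<bar>c\<bar> * l2_norm L (\<lambda>x. p' x - q' n x)"
    proof
      fix n
      have "l2_norm L (\<lambda>x. (p x - q n x) + c * (p' x - q' n x))
        \<le> l2_norm L (\<lambda>x. p x - q n x) + l2_norm L (\<lambda>x. c * (p' x - q' n x))"
        by (intro l2_norm_triangle sq_integrable_diff sq_integrable_cmult sq)
      then show "l2_norm L (\<lambda>x. (p x + c * p' x) - (q n x + c * q' n x))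
        \<le> l2_norm L (\<lambda>x. p x - q n x) + \<bar>c\<bar> * l2_norm L (\<lambda>x. p' x - q' n x)"
        unfolding l2_norm_cmult by (simp add: algebra_simps)
    qed
  qed simp
  obtain S where S: "sq_integrable N (\<lambda>z. H (fst z) (snd z))" "sq_integrable M Y"
    "\<And>n. elementary_integrand M F (S n)"
    "(\<lambda>n. l2_norm N (\<lambda>z. H (fst z) (snd z) - elementary_process (S n) (fst z) (snd z))) \<longlonglongrightarrow> 0"
    "(\<lambda>n. l2_norm M (\<lambda>\<omega>. Y \<omega> - elementary_integral B (S n) \<omega>)) \<longlonglongrightarrow> 0"
    using assms(1) by (rule has_ito_integralE) blast
  obtain S' where S': "sq_integrable N (\<lambda>z. H' (fst z) (snd z))" "sq_integrable M Y'"
    "\<And>n. elementary_integrand M F (S' n)"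
    "(\<lambda>n. l2_norm N (\<lambda>z. H' (fst z) (snd z) - elementary_process (S' n) (fst z) (snd z))) \<longlonglongrightarrow> 0"
    "(\<lambda>n. l2_norm M (\<lambda>\<omega>. Y' \<omega> - elementary_integral B (S' n) \<omega>)) \<longlonglongrightarrow> 0"
    using assms(2) by (rule has_ito_integralE) blast
  show ?thesis
  proof (rule has_ito_integralI[where S="\<lambda>n. S n @ scale_elementary c (S' n)"])
    show "elementary_integrand M F (S n @ scale_elementary c (S' n))" for n
      using S(3) S'(3) by (simp add: scale_elementary)
    show "(\<lambda>n. l2_norm N (\<lambda>z. (H (fst z) (snd z) + c * H' (fst z) (snd z))
      - elementary_process (S n @ scale_elementary c (S' n)) (fst z) (snd z))) \<longlonglongrightarrow> 0"
      unfolding elementary_process_simps scale_elementary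
      by (rule lim[OF S(1) S'(1) elementary_sq_integrable(2)[OF S(3)] elementary_sq_integrable(2)[OF S'(3)] S(4) S'(4)])
    show "(\<lambda>n. l2_norm M (\<lambda>\<omega>. (Y \<omega> + c * Y' \<omega>)
      - elementary_integral B (S n @ scale_elementary c (S' n)) \<omega>)) \<longlonglongrightarrow> 0"
      unfolding elementary_integral_simps scale_elementary
      by (rule lim[OF S(2) S'(2) elementary_sq_integrable(1)[OF S(3)] elementary_sq_integrable(1)[OF S'(3)] S(5) S'(5)])
  qed (intro sq_integrable_add sq_integrable_cmult S(1,2) S'(1,2))+
qed

text \<open>Polarisation of the equality of norms.\<close>
lemma has_ito_integral_isometry:
  assumes H: "has_ito_integral M F B H Y" "has_ito_integral M F B H' Y'"
  shows "expectation (\<lambda>\<omega>. Y \<omega> * Y' \<omega>) = (\<integral>z. H (fst z) (snd z) * H' (fst z) (snd z) \<partial>N)"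
  using has_ito_integral_norm[OF has_ito_integral_lincomb[OF H, of 1]]
    l2_norm_add_power2[OF has_ito_integral_sq_integrable(2)[OF H(1)] has_ito_integral_sq_integrable(2)[OF H(2)]]
    l2_norm_add_power2[OF has_ito_integral_sq_integrable(1)[OF H(1)] has_ito_integral_sq_integrable(1)[OF H(2)]]
    has_ito_integral_norm[OF H(1)] has_ito_integral_norm[OF H(2)]
  by simp

lemma has_ito_integral_cong_AE:
  assumes H: "has_ito_integral M F B H Y"
    and H': "(\<lambda>z. H' (fst z) (snd z)) \<in> borel_measurable N" and Y': "Y' \<in> borel_measurable M"
    and AE: "AE z in N. H (fst z) (snd z) = H' (fst z) (snd z)" "AE \<omega> in M. Y \<omega> = Y' \<omega>"
  shows "has_ito_integral M F B H' Y'"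
proof -
  obtain S where S: "sq_integrable N (\<lambda>z. H (fst z) (snd z))" "sq_integrable M Y"
    "\<And>n. elementary_integrand M F (S n)"
    "(\<lambda>n. l2_norm N (\<lambda>z. H (fst z) (snd z) - elementary_process (S n) (fst z) (snd z))) \<longlonglongrightarrow> 0"
    "(\<lambda>n. l2_norm M (\<lambda>\<omega>. Y \<omega> - elementary_integral B (S n) \<omega>)) \<longlonglongrightarrow> 0"
    using H by (rule has_ito_integralE) blast
  have m: "(\<lambda>z. H (fst z) (snd z)) \<in> borel_measurable N" "Y \<in> borel_measurable M"
    using S(1,2) by (auto simp: sq_integrable_def)
  show ?thesis
  proof (rule has_ito_integralI[OF _ _ S(3)])
    show "sq_integrable N (\<lambda>z. H' (fst z) (snd z))"
      by (rule sq_integrable_bound[OF S(1) H']) (use AE(1) in \<open>auto elim: eventually_mono\<close>)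
    show "sq_integrable M Y'"
      by (rule sq_integrable_bound[OF S(2) Y']) (use AE(2) in \<open>auto elim: eventually_mono\<close>)
    show "(\<lambda>n. l2_norm N (\<lambda>z. H' (fst z) (snd z) - elementary_process (S n) (fst z) (snd z))) \<longlonglongrightarrow> 0"
    proof -
      have "l2_norm N (\<lambda>z. H' (fst z) (snd z) - elementary_process (S n) (fst z) (snd z))
        = l2_norm N (\<lambda>z. H (fst z) (snd z) - elementary_process (S n) (fst z) (snd z))" for n
        by (rule l2_norm_cong_AE)
          (use AE(1) m(1) H' elementary_sq_integrable(2)[OF S(3)[of n]] in
            \<open>auto simp: sq_integrable_def elim: eventually_mono\<close>)
      then show ?thesis using S(4) by simp
    qed
    show "(\<lambda>n. l2_norm M (\<lambda>\<omega>. Y' \<omega> - elementary_integral B (S n) \<omega>)) \<longlonglongrightarrow> 0"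
    proof -
      have "l2_norm M (\<lambda>\<omega>. Y' \<omega> - elementary_integral B (S n) \<omega>)
        = l2_norm M (\<lambda>\<omega>. Y \<omega> - elementary_integral B (S n) \<omega>)" for n
        by (rule l2_norm_cong_AE)
          (use AE(2) m(2) Y' elementary_sq_integrable(1)[OF S(3)[of n]] in
            \<open>auto simp: sq_integrable_def elim: eventually_mono\<close>)
      then show ?thesis using S(5) by simp
    qed
  qed
qed

lemma has_ito_integral_unique:
  assumes H: "has_ito_integral M F B H Y" "has_ito_integral M F B H Y'"
  shows "AE \<omega> in M. Y \<omega> = Y' \<omega>"
proof -
  note D = has_ito_integral_lincomb[OF H, of "- 1"]
  have "l2_norm M (\<lambda>\<omega>. Y \<omega> + (- 1) * Y' \<omega>) = 0"
    using has_ito_integral_norm[OF D] by (simp add: l2_norm_def)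
  from l2_norm_eq_0_AE[OF has_ito_integral_sq_integrable(2)[OF D] this] show ?thesis by simp
qed

section \<open>Existence of the integral\<close>

text \<open>Integrands in the \<open>L\<^sup>2(ds \<otimes> P)\<close>-closure of the elementary processes.\<close>
definition ito_integrable :: "(real \<Rightarrow> 'a \<Rightarrow> real) \<Rightarrow> bool" where
  "ito_integrable H \<longleftrightarrow> sq_integrable N (\<lambda>z. H (fst z) (snd z)) \<and>
     (\<forall>e>0. \<exists>S. elementary_integrand M F S \<and>
       l2_norm N (\<lambda>z. H (fst z) (snd z) - elementary_process S (fst z) (snd z)) < e)"

lemma ito_integrable_has_ito_integral:
  assumes "ito_integrable H"
  shows "\<exists>Y. has_ito_integral M F B H Y"
proof -
  have sq: "sq_integrable N (\<lambda>z. H (fst z) (snd z))" using assms by (simp add: ito_integrable_def)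
  have "\<forall>n. \<exists>S. elementary_integrand M F S \<and>
       l2_norm N (\<lambda>z. H (fst z) (snd z) - elementary_process S (fst z) (snd z)) < (1/2)^n / 2"
  proof
    fix n :: nat
    have "0 < (1/2::real)^n / 2" by simp
    then show "\<exists>S. elementary_integrand M F S \<and>
       l2_norm N (\<lambda>z. H (fst z) (snd z) - elementary_process S (fst z) (snd z)) < (1/2)^n / 2"
      using assms unfolding ito_integrable_def by blast
  qed
  then obtain S where S: "\<And>n. elementary_integrand M F (S n)"
    "\<And>n. l2_norm N (\<lambda>z. H (fst z) (snd z) - elementary_process (S n) (fst z) (snd z)) < (1/2)^n / 2"
    by metis
  note sqS = elementary_sq_integrable(2)[OF S(1)]
  have "\<exists>Y. sq_integrable M Y \<and> (\<lambda>n. l2_norm M (\<lambda>\<omega>. Y \<omega> - elementary_integral B (S n) \<omega>)) \<longlonglongrightarrow> 0"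
  proof (rule l2_complete[OF elementary_sq_integrable(1)[OF S(1)]])
    fix m n :: nat assume "n \<le> m"
    then have mn: "(1/2::real)^m \<le> (1/2)^n" by (intro power_decreasing) auto
    have "l2_norm M (\<lambda>\<omega>. elementary_integral B (S m) \<omega> - elementary_integral B (S n) \<omega>)
      \<le> l2_norm N (\<lambda>z. elementary_process (S m) (fst z) (snd z) - H (fst z) (snd z))
       + l2_norm N (\<lambda>z. H (fst z) (snd z) - elementary_process (S n) (fst z) (snd z))"
      unfolding elementary_isometry_dist[OF S(1) S(1)] by (rule l2_norm_triangle_dist[OF sqS sq sqS])
    also have "\<dots> \<le> (1/2)^n"
      using S(2)[of m] S(2)[of n] mn
        l2_norm_minus_commute[of N "\<lambda>z. elementary_process (S m) (fst z) (snd z)" "\<lambda>z. H (fst z) (snd z)"] by linarith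
    finally show "l2_norm M (\<lambda>\<omega>. elementary_integral B (S m) \<omega> - elementary_integral B (S n) \<omega>) \<le> (1/2)^n" .
  qed
  then obtain Y where Y: "sq_integrable M Y" "(\<lambda>n. l2_norm M (\<lambda>\<omega>. Y \<omega> - elementary_integral B (S n) \<omega>)) \<longlonglongrightarrow> 0"
    by blast
  have "(\<lambda>n. l2_norm N (\<lambda>z. H (fst z) (snd z) - elementary_process (S n) (fst z) (snd z))) \<longlonglongrightarrow> 0"
  proof (rule tendsto_sandwich[OF always_eventually always_eventually tendsto_const])
    show "(\<lambda>n. (1/2::real)^n / 2) \<longlonglongrightarrow> 0" by (auto intro!: tendsto_divide_zero LIMSEQ_power_zero)
    show "\<forall>n. l2_norm N (\<lambda>z. H (fst z) (snd z) - elementary_process (S n) (fst z) (snd z)) \<le> (1/2)^n / 2"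
      using S(2) by (auto intro: less_imp_le)
  qed simp
  from has_ito_integralI[OF sq Y(1) S(1) this Y(2)] show ?thesis by blast
qed

lemma ito_integrable_elementary:
  assumes "elementary_integrand M F S"
  shows "ito_integrable (elementary_process S)"
  unfolding ito_integrable_def
  using assms elementary_sq_integrable(2)[OF assms] by (auto intro!: exI[of _ S] simp: l2_norm_def)

lemma ito_integrable_lincomb:
  assumes "ito_integrable H" "ito_integrable H'"
  shows "ito_integrable (\<lambda>s \<omega>. H s \<omega> + c * H' s \<omega>)"
proof -
  obtain Y Y' where "has_ito_integral M F B H Y" "has_ito_integral M F B H' Y'"
    using assms[THEN ito_integrable_has_ito_integral] by blast
  from has_ito_integral_lincomb[OF this, of c] obtain S
    where S: "sq_integrable N (\<lambda>z. H (fst z) (snd z) + c * H' (fst z) (snd z))"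
    "\<And>n. elementary_integrand M F (S n)"
    "(\<lambda>n. l2_norm N (\<lambda>z. H (fst z) (snd z) + c * H' (fst z) (snd z) - elementary_process (S n) (fst z) (snd z))) \<longlonglongrightarrow> 0"
    by (rule has_ito_integralE) blast
  show ?thesis unfolding ito_integrable_def
  proof (intro conjI allI impI S(1))
    fix e :: real assume "0 < e"
    from order_tendstoD(2)[OF S(3) this] obtain n where
      "l2_norm N (\<lambda>z. H (fst z) (snd z) + c * H' (fst z) (snd z) - elementary_process (S n) (fst z) (snd z)) < e"
      by (auto simp: eventually_sequentially)
    then show "\<exists>S. elementary_integrand M F S \<and>
      l2_norm N (\<lambda>z. H (fst z) (snd z) + c * H' (fst z) (snd z) - elementary_process S (fst z) (snd z)) < e"
      using S(2) by blast
  qed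
qed

lemma ito_integrable_zero: "ito_integrable (\<lambda>s \<omega>. 0)"
  using ito_integrable_elementary[of "[]"] by (simp add: elementary_process_def[abs_def])

lemma ito_integrable_sum:
  assumes "finite I" "\<And>i. i \<in> I \<Longrightarrow> ito_integrable (H i)"
  shows "ito_integrable (\<lambda>s \<omega>. \<Sum>i\<in>I. c i * H i s \<omega>)"
  using assms
proof (induction I rule: finite_induct)
  case (insert i I)
  then have "ito_integrable (\<lambda>s \<omega>. (\<Sum>i\<in>I. c i * H i s \<omega>) + c i * H i s \<omega>)"
    by (intro ito_integrable_lincomb) auto
  then show ?case using insert by (simp add: add.commute)
qed (simp add: ito_integrable_zero)

lemma ito_integrable_dominated:
  assumes H: "\<And>n. ito_integrable (H n)"
    and G: "(\<lambda>z. G (fst z) (snd z)) \<in> borel_measurable N"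
    and W: "sq_integrable N W"
    and bound: "\<And>n s \<omega>. \<omega> \<in> space M \<Longrightarrow> \<bar>H n s \<omega>\<bar> \<le> \<bar>W (s, \<omega>)\<bar>"
    and lim: "\<And>s \<omega>. \<omega> \<in> space M \<Longrightarrow> (\<lambda>n. H n s \<omega>) \<longlonglongrightarrow> G s \<omega>"
  shows "ito_integrable G"
proof -
  note sqH = H[unfolded ito_integrable_def, THEN conjunct1]
  have 1: "AE z in N. (\<lambda>n. H n (fst z) (snd z)) \<longlonglongrightarrow> G (fst z) (snd z)"
    using lim by (intro AE_I2) (auto simp: space_pair_measure)
  have 2: "AE z in N. \<bar>H n (fst z) (snd z)\<bar> \<le> \<bar>W z\<bar>" for n
    using bound by (intro AE_I2) (auto simp: space_pair_measure)
  note dom = l2_norm_dominated_convergence[OF G sq_integrable_measurable[OF sqH] W 1 2]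
  show ?thesis unfolding ito_integrable_def
  proof (intro conjI allI impI dom(1))
    fix e :: real assume e: "0 < e"
    then have "0 < e / 2" by simp
    from order_tendstoD(2)[OF dom(3) this] obtain n where
      n: "l2_norm N (\<lambda>z. G (fst z) (snd z) - H n (fst z) (snd z)) < e / 2"
      by (auto simp: eventually_sequentially)
    obtain S where S: "elementary_integrand M F S"
      "l2_norm N (\<lambda>z. H n (fst z) (snd z) - elementary_process S (fst z) (snd z)) < e / 2"
      using H[of n] e unfolding ito_integrable_def by (meson half_gt_zero)
    have "l2_norm N (\<lambda>z. G (fst z) (snd z) - elementary_process S (fst z) (snd z)) < e"
      using l2_norm_triangle_dist[OF dom(1) sqH[of n] elementary_sq_integrable(2)[OF S(1)]] n S(2) by linarith
    then show "\<exists>S. elementary_integrand M F S \<and>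
      l2_norm N (\<lambda>z. G (fst z) (snd z) - elementary_process S (fst z) (snd z)) < e" using S(1) by blast
  qed
qed

end

section \<open>Integrands of the form g s * \<sigma> s\<close>

text \<open>Truncation of \<open>x\<close> to the interval \<open>[-c, c]\<close>, since elementary processes have bounded coefficients.\<close>
definition truncate_at :: "real \<Rightarrow> real \<Rightarrow> real" where
  "truncate_at c x = max (- c) (min c x)"

lemma truncate_at_measurable [measurable]: "truncate_at c \<in> borel_measurable borel"
  unfolding truncate_at_def[abs_def] by measurable

lemma abs_truncate_at_le: "0 \<le> c \<Longrightarrow> \<bar>truncate_at c x\<bar> \<le> c"
  by (auto simp: truncate_at_def)

lemma abs_truncate_at_le_abs: "0 \<le> c \<Longrightarrow> \<bar>truncate_at c x\<bar> \<le> \<bar>x\<bar>"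
  by (auto simp: truncate_at_def)

lemma truncate_at_tendsto: "(f \<longlongrightarrow> l) G \<Longrightarrow> ((\<lambda>x. truncate_at c (f x)) \<longlongrightarrow> truncate_at c l) G"
  unfolding truncate_at_def by (intro tendsto_intros)

lemma truncate_at_eq: "\<bar>x\<bar> \<le> c \<Longrightarrow> truncate_at c x = x"
  by (auto simp: truncate_at_def)

lemma ceiling_grid:
  fixes s h a :: real
  assumes "0 < h"
  shows "a + (of_int \<lceil>(s - a) / h\<rceil> - 1) * h < s" "s \<le> a + of_int \<lceil>(s - a) / h\<rceil> * h"
proof -
  define k where "k = \<lceil>(s - a) / h\<rceil>"
  have "of_int k - 1 < (s - a) / h" "(s - a) / h \<le> of_int k"
    unfolding k_def by linarith+
  then show "a + (of_int \<lceil>(s - a) / h\<rceil> - 1) * h < s" "s \<le> a + of_int \<lceil>(s - a) / h\<rceil> * h"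
    unfolding k_def[symmetric] using assms by (simp_all add: field_simps)
qed

lemma grid_tendsto:
  fixes p h :: "nat \<Rightarrow> real"
  assumes "\<And>n. p n < s" "\<And>n. s \<le> p n + h n" "h \<longlonglongrightarrow> 0"
  shows "p \<longlonglongrightarrow> s"
proof (rule tendsto_sandwich[OF always_eventually always_eventually _ tendsto_const])
  have "(\<lambda>n. s - h n) \<longlonglongrightarrow> s - 0" by (intro tendsto_intros assms)
  then show "(\<lambda>n. s - h n) \<longlonglongrightarrow> s" by simp
  show "\<forall>n. s - h n \<le> p n" using assms(2) by (simp add: algebra_simps)
  show "\<forall>n. p n \<le> s" using assms(1) by (simp add: less_imp_le)
qed

context two_sided_brownian_motion
begin

lemma volatility_left_continuous:
  assumes "volatility_process M F \<sigma>" "\<omega> \<in> space M" "\<And>n. p n < s" "p \<longlonglongrightarrow> s"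
  shows "(\<lambda>n. \<sigma> (p n) \<omega>) \<longlonglongrightarrow> \<sigma> s \<omega>"
proof -
  have "((\<lambda>s. \<sigma> s \<omega>) \<longlongrightarrow> \<sigma> s \<omega>) (at_left s)"
    using assms(1,2) by (simp add: volatility_process_def continuous_within)
  moreover have "filterlim p (at_left s) sequentially"
    unfolding filterlim_at using assms(3,4) by (auto simp: less_le)
  ultimately show ?thesis by (rule filterlim_compose)
qed

lemma volatility_measurable_F: "volatility_process M F \<sigma> \<Longrightarrow> \<sigma> t \<in> borel_measurable (F t)"
  by (simp add: volatility_process_def)

text \<open>A left continuous process is the limit of its values at the largest point of a dyadic grid strictly before
  the current time.\<close>
lemma volatility_measurable:
  assumes v: "volatility_process M F \<sigma>"
  shows "(\<lambda>z. \<sigma> (fst z) (snd z)) \<in> borel_measurable (borel \<Otimes>\<^sub>M M)"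
proof (rule borel_measurable_LIMSEQ_real)
  define h :: "nat \<Rightarrow> real" where "h n = 1 / 2 ^ n" for n
  have h: "0 < h n" for n by (simp add: h_def)
  have h0: "h \<longlonglongrightarrow> 0" unfolding h_def using LIMSEQ_power_zero[of "1/2::real"] by (simp add: power_divide)
  define p where "p n s = 0 + (of_int \<lceil>(s - 0) / h n\<rceil> - 1) * h n" for n and s :: real
  have p: "p n s < s" "s \<le> p n s + h n" for n s
    using ceiling_grid[OF h[of n], where a=0 and s=s] by (auto simp: p_def algebra_simps)
  show "(\<lambda>n. \<sigma> (p n (fst z)) (snd z)) \<longlonglongrightarrow> \<sigma> (fst z) (snd z)" if "z \<in> space (borel \<Otimes>\<^sub>M M)" for z
    using that p
    by (intro volatility_left_continuous[OF v] grid_tendsto[OF _ _ h0]) (auto simp: space_pair_measure)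
  show "(\<lambda>z. \<sigma> (p n (fst z)) (snd z)) \<in> borel_measurable (borel \<Otimes>\<^sub>M M)" for n
  proof -
    have [measurable]: "\<sigma> t \<in> borel_measurable M" for t
      by (rule F_measurable[OF volatility_measurable_F[OF v]])
    have "(\<lambda>z. (\<lambda>k z. \<sigma> (0 + (of_int k - 1) * h n) (snd z)) \<lceil>(fst z - 0) / h n\<rceil> z) \<in> borel_measurable (borel \<Otimes>\<^sub>M M)"
      by (rule measurable_compose_countable) measurable
    then show ?thesis by (simp add: p_def)
  qed
qed

lemma volatility_measurable_N:
  "volatility_process M F \<sigma> \<Longrightarrow> (\<lambda>z. \<sigma> (fst z) (snd z)) \<in> borel_measurable N"
  by (intro measurable_lebesgue_pair volatility_measurable)

lemma lebesgue_measurable_fst: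
  "g \<in> borel_measurable lebesgue \<Longrightarrow> (\<lambda>z. g (fst z)) \<in> borel_measurable N"
  by (rule measurable_compose[OF measurable_fst])

text \<open>As the second moments of \<open>\<sigma>\<close> are bounded uniformly in time, multiplication by \<open>\<sigma>\<close> is bounded from \<open>L\<^sup>2(ds)\<close>
  to \<open>L\<^sup>2(ds \<otimes> P)\<close>.\<close>
lemma volatility_sq_integrable:
  assumes v: "volatility_process M F \<sigma>"
  shows "\<exists>C\<ge>0. \<forall>g. sq_integrable lborel g \<longrightarrow> sq_integrable N (\<lambda>z. g (fst z) * \<sigma> (fst z) (snd z)) \<and>
    l2_norm N (\<lambda>z. g (fst z) * \<sigma> (fst z) (snd z)) \<le> C * l2_norm lborel g"
proof -
  have "(SUP t. \<integral>\<^sup>+\<omega>. ennreal ((\<sigma> t \<omega>)\<^sup>2) \<partial>M) < \<infinity>" using v by (simp add: volatility_process_def)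
  then obtain C where C: "0 \<le> C" "(SUP t. \<integral>\<^sup>+\<omega>. ennreal ((\<sigma> t \<omega>)\<^sup>2) \<partial>M) = ennreal C"
    unfolding infinity_ennreal_def less_top_ennreal by blast
  have bd: "(\<integral>\<^sup>+\<omega>. ennreal ((\<sigma> t \<omega>)\<^sup>2) \<partial>M) \<le> ennreal C" for t
    unfolding C(2)[symmetric] by (rule SUP_upper) simp
  have [measurable]: "\<sigma> t \<in> borel_measurable M" for t
    by (rule F_measurable[OF volatility_measurable_F[OF v]])
  show ?thesis
  proof (intro exI[of _ "sqrt C"] conjI allI impI)
    show "0 \<le> sqrt C" using C by simp
    fix g :: "real \<Rightarrow> real" assume g: "sq_integrable lborel g"
    then have gm: "g \<in> borel_measurable borel" by (simp add: sq_integrable_def)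
    then have gl: "g \<in> borel_measurable lebesgue" by (simp add: measurable_completion)
    have [measurable]: "(\<lambda>z. g (fst z) * \<sigma> (fst z) (snd z)) \<in> borel_measurable N"
      by (intro borel_measurable_times lebesgue_measurable_fst gl volatility_measurable_N v)
    have "(\<integral>\<^sup>+z. ennreal ((g (fst z) * \<sigma> (fst z) (snd z))\<^sup>2) \<partial>N)
      = (\<integral>\<^sup>+s. (\<integral>\<^sup>+\<omega>. ennreal ((g s * \<sigma> s \<omega>)\<^sup>2) \<partial>M) \<partial>lebesgue)"
      using nn_integral_fst[of "\<lambda>z. ennreal ((g (fst z) * \<sigma> (fst z) (snd z))\<^sup>2)" lebesgue, symmetric] by simp
    also have "\<dots> = (\<integral>\<^sup>+s. ennreal ((g s)\<^sup>2) * (\<integral>\<^sup>+\<omega>. ennreal ((\<sigma> s \<omega>)\<^sup>2) \<partial>M) \<partial>lebesgue)"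
    proof (rule nn_integral_cong)
      fix s
      have "ennreal ((g s * \<sigma> s \<omega>)\<^sup>2) = ennreal ((g s)\<^sup>2) * ennreal ((\<sigma> s \<omega>)\<^sup>2)" for \<omega>
        unfolding power_mult_distrib by (rule ennreal_mult) simp_all
      then show "(\<integral>\<^sup>+\<omega>. ennreal ((g s * \<sigma> s \<omega>)\<^sup>2) \<partial>M) = ennreal ((g s)\<^sup>2) * (\<integral>\<^sup>+\<omega>. ennreal ((\<sigma> s \<omega>)\<^sup>2) \<partial>M)"
        by (simp only:) (rule nn_integral_cmult, measurable)
    qed
    also have "\<dots> \<le> (\<integral>\<^sup>+s. ennreal ((g s)\<^sup>2) * ennreal C \<partial>lebesgue)"
      by (intro nn_integral_mono mult_left_mono bd) simp
    also have "\<dots> = (\<integral>\<^sup>+s. ennreal ((g s)\<^sup>2) * ennreal C \<partial>lborel)"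
      by (rule nn_integral_completion)
    also have "\<dots> = ennreal ((l2_norm lborel g)\<^sup>2) * ennreal C"
      using gm by (subst nn_integral_multc) (simp_all only: nn_integral_power2_eq[OF g], simp)
    also have "\<dots> = ennreal ((sqrt C * l2_norm lborel g)\<^sup>2)"
      using C(1) unfolding power_mult_distrib
      by (subst ennreal_mult) (simp_all add: mult.commute)
    finally have le: "(\<integral>\<^sup>+z. ennreal ((g (fst z) * \<sigma> (fst z) (snd z))\<^sup>2) \<partial>N)
      \<le> ennreal ((sqrt C * l2_norm lborel g)\<^sup>2)" .
    have "(\<integral>\<^sup>+z. ennreal ((g (fst z) * \<sigma> (fst z) (snd z))\<^sup>2) \<partial>N) < \<infinity>"
      by (rule le_less_trans[OF le]) simp
    then show sq: "sq_integrable N (\<lambda>z. g (fst z) * \<sigma> (fst z) (snd z))"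
      unfolding sq_integrable_iff_nn_integral by simp
    show "l2_norm N (\<lambda>z. g (fst z) * \<sigma> (fst z) (snd z)) \<le> sqrt C * l2_norm lborel g"
    proof (rule power2_le_imp_le)
      show "(l2_norm N (\<lambda>z. g (fst z) * \<sigma> (fst z) (snd z)))\<^sup>2 \<le> (sqrt C * l2_norm lborel g)\<^sup>2"
        using le unfolding nn_integral_power2_eq[OF sq] by (subst (asm) ennreal_le_iff) simp_all
    qed (use C(1) in simp)
  qed
qed

text \<open>Elementary processes on a uniform partition, with \<open>\<sigma>\<close> evaluated at the left endpoint of each cell so that
  the coefficients are adapted.\<close>
lemma ito_integrable_Ioc:
  assumes v: "volatility_process M F \<sigma>" and ab: "a < b" and c: "0 \<le> c"
  shows "ito_integrable (\<lambda>s \<omega>. indicator {a<..b} s * truncate_at c (\<sigma> s \<omega>))"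
proof -
  define h :: "nat \<Rightarrow> real" where "h n = (b - a) / real (Suc n)" for n
  have h: "0 < h n" for n using ab by (simp add: h_def)
  have h0: "h \<longlonglongrightarrow> 0" unfolding h_def using LIMSEQ_Suc[OF lim_const_over_n[of "b - a"]] by simp
  define p where "p n s = a + (of_int \<lceil>(s - a) / h n\<rceil> - 1) * h n" for n and s :: real
  have p: "p n s < s" "s \<le> p n s + h n" for n s
    using ceiling_grid[OF h[of n], where a=a and s=s] by (auto simp: p_def algebra_simps)
  define S where "S n = map (\<lambda>i. (a + real i * h n, a + real (Suc i) * h n, \<lambda>\<omega>. truncate_at c (\<sigma> (a + real i * h n) \<omega>))) [0..<Suc n]" for n
  have S: "elementary_integrand M F (S n)" for n
    unfolding elementary_integrand_def
  proof safe
    fix x y \<xi> assume "(x, y, \<xi>) \<in> set (S n)"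
    then obtain i where i: "x = a + real i * h n" "y = a + real (Suc i) * h n" "\<xi> = (\<lambda>\<omega>. truncate_at c (\<sigma> x \<omega>))"
      by (auto simp: S_def)
    show "x \<le> y" using h[of n] by (simp add: i algebra_simps)
    show "\<xi> \<in> borel_measurable (F x)"
      unfolding i(3) by (intro measurable_compose[OF volatility_measurable_F[OF v] truncate_at_measurable])
    show "bounded (\<xi> ` space M)"
      unfolding bounded_iff i(3) using abs_truncate_at_le[OF c] by auto
  qed
  have eq: "elementary_process (S n) s \<omega> = indicator {a<..b} s * truncate_at c (\<sigma> (p n s) \<omega>)" for n s \<omega>
  proof -
    have sum: "elementary_process (S n) s \<omega> = (\<Sum>i<Suc n. indicator {a + real i * h n<..a + real (Suc i) * h n} s
        * truncate_at c (\<sigma> (a + real i * h n) \<omega>))"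
      unfolding elementary_process_def S_def
      by (simp only: map_map comp_def interv_sum_list_conv_sum_set_nat prod.case set_upt atLeast0LessThan)
    have b: "a + real (Suc n) * h n = b" by (simp add: h_def del: of_nat_Suc)
    show ?thesis
    proof (cases "s \<in> {a<..b}")
      case True
      define k where "k = \<lceil>(s - a) / h n\<rceil>"
      have "0 < (s - a) / h n" using True h[of n] by simp
      then have k1: "1 \<le> k" unfolding k_def by linarith
      have "(s - a) / h n \<le> real (Suc n)"
        using True b h[of n] by (simp add: pos_divide_le_eq algebra_simps)
      then have k2: "k \<le> int (Suc n)" unfolding k_def by (simp add: ceiling_le_iff)
      define i where "i = nat (k - 1)"
      have i: "real i = of_int k - 1" using k1 by (simp add: i_def)
      have pi: "p n s = a + real i * h n" unfolding p_def i k_def ..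
      have "indicator {a + real j * h n<..a + real (Suc j) * h n} s * truncate_at c (\<sigma> (a + real j * h n) \<omega>)
        = (if j = i then truncate_at c (\<sigma> (p n s) \<omega>) else 0)" for j
      proof -
        have s: "a + real i * h n < s" "s \<le> a + real (Suc i) * h n"
          using p(1)[of n s] p(2)[of s n] by (auto simp: pi algebra_simps)
        have "\<not> (a + real j * h n < s \<and> s \<le> a + real (Suc j) * h n)" if "j \<noteq> i"
        proof (cases "j < i")
          case True
          then have "real (Suc j) * h n \<le> real i * h n" using h[of n] by (intro mult_right_mono) auto
          then show ?thesis using s by linarith
        next
          case False
          then have "real (Suc i) * h n \<le> real j * h n" using h[of n] that by (intro mult_right_mono) auto
          then show ?thesis using s by linarith
        qed
        then show ?thesis using s by (auto simp: pi split: split_indicator)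
      qed
      moreover have "i < Suc n" using k1 k2 by (simp add: i_def)
      ultimately show ?thesis using True unfolding sum by (simp add: sum.delta)
    next
      case False
      have "indicator {a + real i * h n<..a + real (Suc i) * h n} s = (0::real)" if "i < Suc n" for i
      proof -
        have "0 \<le> real i * h n" using h[of n] by simp
        moreover have "real (Suc i) * h n \<le> real (Suc n) * h n" using h[of n] that by (intro mult_right_mono) auto
        ultimately show ?thesis using False b by (auto split: split_indicator)
      qed
      then show ?thesis using False unfolding sum by simp
    qed
  qed
  show ?thesis
  proof (rule ito_integrable_dominated[OF ito_integrable_elementary[OF S]])
    show "sq_integrable N (\<lambda>z. c * indicator ({a<..b} \<times> space M) z)"
    proof (intro sq_integrable_cmult sq_integrable_indicator)
      show "emeasure N ({a<..b} \<times> space M) < \<infinity>"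
        using ab by (subst emeasure_pair_measure_Times) (auto simp: emeasure_space_1)
    qed auto
    show "(\<lambda>z. indicator {a<..b} (fst z) * truncate_at c (\<sigma> (fst z) (snd z))) \<in> borel_measurable N"
      by (intro borel_measurable_times lebesgue_measurable_fst measurable_compose[OF volatility_measurable_N[OF v]]
        truncate_at_measurable measurable_completion) simp
    show "\<bar>elementary_process (S n) s \<omega>\<bar> \<le> \<bar>c * indicator ({a<..b} \<times> space M) (s, \<omega>)\<bar>" if "\<omega> \<in> space M" for n s \<omega>
      using abs_truncate_at_le[OF c] that c unfolding eq by (auto split: split_indicator)
    show "(\<lambda>n. elementary_process (S n) s \<omega>) \<longlonglongrightarrow> indicator {a<..b} s * truncate_at c (\<sigma> s \<omega>)" if "\<omega> \<in> space M" for s \<omega>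
      unfolding eq
      by (intro tendsto_mult tendsto_const truncate_at_tendsto volatility_left_continuous[OF v that p(1)]
        grid_tendsto[OF p(1) p(2) h0])
  qed
qed

text \<open>A Dynkin class argument passes from intervals to Borel sets.\<close>
lemma ito_integrable_Borel:
  assumes v: "volatility_process M F \<sigma>" and ab: "a < b" and c: "0 \<le> c" and A: "A \<in> sets borel"
  shows "ito_integrable (\<lambda>s \<omega>. indicator (A \<inter> {a<..b}) s * truncate_at c (\<sigma> s \<omega>))"
proof -
  let ?E = "range (\<lambda>(a, b). {a<..b::real})"
  have E: "Int_stable ?E" "?E \<subseteq> Pow UNIV"
    by (auto simp: Int_stable_def Int_greaterThanAtMost)
  have "A \<in> sigma_sets UNIV ?E" using A by (simp add: borel_sigma_sets_Ioc)
  from E this show ?thesis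
  proof (induction rule: sigma_sets_induct_disjoint)
    case (basic A)
    then obtain x y where "A = {x<..y}" by auto
    then have A: "A \<inter> {a<..b} = {max x a<..min y b}" by auto
    show ?case
    proof (cases "max x a < min y b")
      case True
      then show ?thesis unfolding A by (rule ito_integrable_Ioc[OF v _ c])
    next
      case False
      then have "A \<inter> {a<..b} = {}" unfolding A by auto
      then show ?thesis by (simp add: ito_integrable_zero)
    qed
  next
    case empty
    show ?case by (simp add: ito_integrable_zero)
  next
    case (compl A)
    have "indicator ((UNIV - A) \<inter> {a<..b}) s * x = indicator {a<..b} s * x + (- 1) * (indicator (A \<inter> {a<..b}) s * x)" for s x :: real
      by (auto split: split_indicator)
    then show ?case
      using ito_integrable_lincomb[OF ito_integrable_Ioc[OF v ab c] compl.IH, of "- 1"] by simp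
  next
    case (union A)
    have Am: "A i \<in> sets borel" for i using union(2) by (auto simp: borel_sigma_sets_Ioc)
    show ?case
    proof (rule ito_integrable_dominated)
      show "ito_integrable (\<lambda>s \<omega>. \<Sum>i<n. 1 * (indicator (A i \<inter> {a<..b}) s * truncate_at c (\<sigma> s \<omega>)))" for n
        by (intro ito_integrable_sum union.IH) simp
      show "sq_integrable N (\<lambda>z. c * indicator ({a<..b} \<times> space M) z)"
      proof (intro sq_integrable_cmult sq_integrable_indicator)
        show "emeasure N ({a<..b} \<times> space M) < \<infinity>"
          using ab by (subst emeasure_pair_measure_Times) (auto simp: emeasure_space_1)
      qed auto
      show "(\<lambda>z. indicator (\<Union> (range A) \<inter> {a<..b}) (fst z) * truncate_at c (\<sigma> (fst z) (snd z))) \<in> borel_measurable N"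
        using Am by (intro borel_measurable_times lebesgue_measurable_fst measurable_compose[OF volatility_measurable_N[OF v]]
          truncate_at_measurable measurable_completion borel_measurable_indicator) auto
      have sum: "(\<Sum>i<n. 1 * (indicator (A i \<inter> {a<..b}) s * x)) = indicator ((\<Union>i<n. A i) \<inter> {a<..b}) s * x" for n and s x :: real
      proof -
        have "disjoint_family_on A {..<n}" using union(1) by (rule disjoint_family_on_mono[rotated]) simp
        then have "indicator (\<Union>i<n. A i) s = (\<Sum>i<n. indicator (A i) s :: real)"
          by (intro indicator_UN_disjoint) auto
        then show ?thesis unfolding indicator_inter_arith mult_1_left by (simp only: sum_distrib_right mult.assoc)
      qed
      show "\<bar>\<Sum>i<n. 1 * (indicator (A i \<inter> {a<..b}) s * truncate_at c (\<sigma> s \<omega>))\<bar> \<le> \<bar>c * indicator ({a<..b} \<times> space M) (s, \<omega>)\<bar>"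
        if "\<omega> \<in> space M" for n s \<omega>
        unfolding sum using abs_truncate_at_le[OF c] that c by (auto split: split_indicator)
      show "(\<lambda>n. \<Sum>i<n. 1 * (indicator (A i \<inter> {a<..b}) s * truncate_at c (\<sigma> s \<omega>)))
        \<longlonglongrightarrow> indicator (\<Union> (range A) \<inter> {a<..b}) s * truncate_at c (\<sigma> s \<omega>)" for s \<omega>
        unfolding sum unfolding indicator_inter_arith
        by (intro tendsto_mult tendsto_const LIMSEQ_indicator_UN)
    qed
  qed
qed

lemma ito_integrable_mult_volatility:
  assumes v: "volatility_process M F \<sigma>" and g: "sq_integrable lborel g"
  shows "ito_integrable (\<lambda>s \<omega>. g s * \<sigma> s \<omega>)"
proof -
  have gm: "g \<in> borel_measurable borel" using g by (simp add: sq_integrable_def)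
  then obtain G where G: "\<And>i. simple_function borel (G i)" "\<And>s. (\<lambda>i. G i s) \<longlonglongrightarrow> g s"
    "\<And>i s. dist (G i s) 0 \<le> 2 * dist (g s) 0"
    using borel_measurable_implies_sequence_metric[of g borel 0] by auto
  define c where "c i = real (Suc i)" for i
  have c: "0 < c i" for i by (simp add: c_def)
  \<comment> \<open>approximate \<open>g\<close> by simple functions, cut off in time and in the values of \<open>\<sigma>\<close> at the same rate\<close>
  define H where "H i s \<omega> = indicator {- c i<..c i} s * G i s * truncate_at (c i) (\<sigma> s \<omega>)" for i s \<omega>
  have "ito_integrable (H i)" for i
  proof -
    have fin: "finite (G i ` UNIV)" and meas: "G i -` {y} \<in> sets borel" for y
      using G(1)[of i] simple_functionD(2)[of borel "G i" "{y}"] by (auto simp: simple_function_def)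
    have "ito_integrable (\<lambda>s \<omega>. \<Sum>y\<in>G i ` UNIV. y * (indicator (G i -` {y} \<inter> {- c i<..c i}) s * truncate_at (c i) (\<sigma> s \<omega>)))"
      using c[of i] by (intro ito_integrable_sum fin ito_integrable_Borel v meas) auto
    also have "(\<lambda>s \<omega>. \<Sum>y\<in>G i ` UNIV. y * (indicator (G i -` {y} \<inter> {- c i<..c i}) s * truncate_at (c i) (\<sigma> s \<omega>))) = H i"
    proof (intro ext)
      fix s \<omega>
      have "y * (indicator (G i -` {y} \<inter> {- c i<..c i}) s * truncate_at (c i) (\<sigma> s \<omega>))
        = (if y = G i s then H i s \<omega> else 0)" for y
        by (auto simp: H_def split: split_indicator)
      then show "(\<Sum>y\<in>G i ` UNIV. y * (indicator (G i -` {y} \<inter> {- c i<..c i}) s * truncate_at (c i) (\<sigma> s \<omega>))) = H i s \<omega>"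
        using fin by (simp add: sum.delta)
    qed
    finally show ?thesis .
  qed
  moreover have "sq_integrable N (\<lambda>z. g (fst z) * \<sigma> (fst z) (snd z))"
    using volatility_sq_integrable[OF v] g by blast
  then have "(\<lambda>z. g (fst z) * \<sigma> (fst z) (snd z)) \<in> borel_measurable N"
    "sq_integrable N (\<lambda>z. 2 * (g (fst z) * \<sigma> (fst z) (snd z)))"
    by (auto intro: sq_integrable_measurable sq_integrable_cmult)
  moreover have "\<bar>H n s \<omega>\<bar> \<le> \<bar>2 * (g (fst (s, \<omega>)) * \<sigma> (fst (s, \<omega>)) (snd (s, \<omega>)))\<bar>" for n s \<omega>
  proof -
    have "\<bar>G n s * truncate_at (c n) (\<sigma> s \<omega>)\<bar> \<le> (2 * \<bar>g s\<bar>) * \<bar>\<sigma> s \<omega>\<bar>"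
      unfolding abs_mult using G(3)[of n s] abs_truncate_at_le_abs[of "c n" "\<sigma> s \<omega>"] c[of n]
      by (intro mult_mono) (auto simp: dist_real_def)
    then show ?thesis by (auto simp: H_def abs_mult split: split_indicator)
  qed
  moreover have "(\<lambda>n. H n s \<omega>) \<longlonglongrightarrow> g s * \<sigma> s \<omega>" for s \<omega>
  proof -
    obtain m :: nat where m: "\<bar>s\<bar> + \<bar>\<sigma> s \<omega>\<bar> < real m" using reals_Archimedean2 by blast
    have "\<forall>\<^sub>F n in sequentially. G n s * \<sigma> s \<omega> = H n s \<omega>"
      using eventually_ge_at_top[of m]
    proof eventually_elim
      case (elim n)
      then have "\<bar>s\<bar> + \<bar>\<sigma> s \<omega>\<bar> < c n" using m by (simp add: c_def)
      then show ?case by (auto simp: H_def truncate_at_eq abs_less_iff split: split_indicator)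
    qed
    moreover have "(\<lambda>n. G n s * \<sigma> s \<omega>) \<longlonglongrightarrow> g s * \<sigma> s \<omega>" by (intro tendsto_intros G)
    ultimately show ?thesis by (rule Lim_transform_eventually[rotated])
  qed
  ultimately show ?thesis by (rule ito_integrable_dominated)
qed

end

section \<open>Stochastic Fubini theorem\<close>

context two_sided_brownian_motion
begin

lemma AE_lborel_imp_AE_N:
  assumes "AE s in lborel. P s"
  shows "AE z in N. P (fst z)"
proof -
  obtain A where A: "{s \<in> space lborel. \<not> P s} \<subseteq> A" "emeasure lborel A = 0" "A \<in> sets lborel"
    using AE_E[OF assms] by blast
  show ?thesis
  proof (rule AE_I)
    show "{z \<in> space N. \<not> P (fst z)} \<subseteq> A \<times> space M" using A(1) by (auto simp: space_pair_measure)
    show "emeasure N (A \<times> space M) = 0" using A by (subst emeasure_pair_measure_Times) auto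
    show "A \<times> space M \<in> sets N" using A(3) by auto
  qed
qed

lemma has_ito_integral_ito_integral:
  assumes "has_ito_integral M F B (\<lambda>s \<omega>. indicator {..t} s * H s \<omega>) Y"
  shows "has_ito_integral M F B (\<lambda>s \<omega>. indicator {..t} s * H s \<omega>) (ito_integral M F B t H)"
  unfolding ito_integral_def
  by (rule someI[where P="has_ito_integral M F B (\<lambda>s \<omega>. indicator {..t} s * H s \<omega>)", OF assms])

text \<open>The process \<open>X r\<close> is given for each \<open>r\<close> only up to a null set, so that joint measurability is what makes the
  pathwise integral meaningful.\<close>
lemma stochastic_fubini:
  assumes v: "volatility_process M F \<sigma>"
    and mu: "sigma_finite_measure \<mu>" and sets_mu: "sets \<mu> = sets borel"
    and k: "(\<lambda>(r, s). k r s) \<in> borel_measurable (borel \<Otimes>\<^sub>M borel)"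
    and sqk: "\<And>r. sq_integrable lborel (k r)"
    and fin: "(\<integral>\<^sup>+r. ennreal (l2_norm lborel (k r)) \<partial>\<mu>) < \<infinity>"
    and X: "(\<lambda>(r, \<omega>). X r \<omega>) \<in> borel_measurable (borel \<Otimes>\<^sub>M M)"
    and ito: "\<And>r. has_ito_integral M F B (\<lambda>s \<omega>. k r s * \<sigma> s \<omega>) (X r)"
  shows "sq_integrable lborel (\<lambda>s. \<integral>r. k r s \<partial>\<mu>)"
    and "AE \<omega> in M. integrable \<mu> (\<lambda>r. X r \<omega>)"
    and "has_ito_integral M F B (\<lambda>s \<omega>. (\<integral>r. k r s \<partial>\<mu>) * \<sigma> s \<omega>) (\<lambda>\<omega>. \<integral>r. X r \<omega> \<partial>\<mu>)"
proof -
  interpret mu: sigma_finite_measure \<mu> by fact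
  have k': "(\<lambda>(r, s). k r s) \<in> borel_measurable (\<mu> \<Otimes>\<^sub>M lborel)"
    using k by (simp add: measurable_cong_sets[OF sets_pair_measure_cong[OF sets_mu sets_lborel] refl])
  have X': "(\<lambda>(r, \<omega>). X r \<omega>) \<in> borel_measurable (\<mu> \<Otimes>\<^sub>M M)"
    using X by (simp add: measurable_cong_sets[OF sets_pair_measure_cong[OF sets_mu refl] refl])
  show g: "sq_integrable lborel (\<lambda>s. \<integral>r. k r s \<partial>\<mu>)"
    by (rule l2_norm_integral_bound(2)[OF mu sigma_finite_lborel k' _ fin]) (rule sqk)
  obtain Y where Y: "has_ito_integral M F B (\<lambda>s \<omega>. (\<integral>r. k r s \<partial>\<mu>) * \<sigma> s \<omega>) Y"
    using ito_integrable_has_ito_integral[OF ito_integrable_mult_volatility[OF v g]] by blast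
  define h where "h r z = k r (fst z) * \<sigma> (fst z) (snd z)" for r z
  obtain C where C: "0 \<le> C" "\<And>g. sq_integrable lborel g \<Longrightarrow>
    l2_norm N (\<lambda>z. g (fst z) * \<sigma> (fst z) (snd z)) \<le> C * l2_norm lborel g"
    using volatility_sq_integrable[OF v] by blast
  have hG: "(\<integral>r. h r z \<partial>\<mu>) = (\<integral>r. k r (fst z) \<partial>\<mu>) * \<sigma> (fst z) (snd z)" for z
    unfolding h_def by simp
  have main: "AE \<omega> in M. integrable \<mu> (\<lambda>r. X r \<omega>) \<and> Y \<omega> = (\<integral>r. X r \<omega> \<partial>\<mu>)"
  proof (rule isometry_commutes_with_integral[OF mu sigma_finite_N sigma_finite_measure_axioms _ X'])
    show "(\<lambda>(r, z). h r z) \<in> borel_measurable (\<mu> \<Otimes>\<^sub>M N)"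
    proof -
      have id: "(\<lambda>x. x) \<in> measurable lebesgue (borel :: real measure)" by (rule measurable_completion) simp
      have "(\<lambda>w. (fst w, fst (snd w))) \<in> measurable (\<mu> \<Otimes>\<^sub>M N) (borel \<Otimes>\<^sub>M borel)"
        by (intro measurable_Pair measurable_compose[OF measurable_compose[OF measurable_snd measurable_fst] id])
          (simp add: measurable_cong_sets[OF refl sets_mu[symmetric]])
      from measurable_compose[OF this k]
      have "(\<lambda>w. k (fst w) (fst (snd w))) \<in> borel_measurable (\<mu> \<Otimes>\<^sub>M N)" by simp
      moreover have "(\<lambda>w. \<sigma> (fst (snd w)) (snd (snd w))) \<in> borel_measurable (\<mu> \<Otimes>\<^sub>M N)"
        by (rule measurable_compose[OF measurable_snd volatility_measurable_N[OF v]])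
      ultimately show ?thesis unfolding h_def split_beta' by (rule borel_measurable_times)
    qed
    show "sq_integrable N (h r)" for r
      using has_ito_integral_sq_integrable(1)[OF ito] by (simp add: h_def[abs_def])
    show "sq_integrable M (X r)" for r by (rule has_ito_integral_sq_integrable(2)[OF ito])
    have "(\<integral>\<^sup>+r. ennreal (l2_norm N (h r)) \<partial>\<mu>) \<le> (\<integral>\<^sup>+r. ennreal C * ennreal (l2_norm lborel (k r)) \<partial>\<mu>)"
    proof (rule nn_integral_mono)
      fix r
      have "ennreal (l2_norm N (h r)) \<le> ennreal (C * l2_norm lborel (k r))"
        unfolding h_def[abs_def] by (intro ennreal_leI C(2) sqk)
      then show "ennreal (l2_norm N (h r)) \<le> ennreal C * ennreal (l2_norm lborel (k r))"
        using C(1) by (simp add: ennreal_mult)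
    qed
    also have "\<dots> = ennreal C * (\<integral>\<^sup>+r. ennreal (l2_norm lborel (k r)) \<partial>\<mu>)"
    proof (rule nn_integral_cmult)
      note [measurable] = k'
      show "(\<lambda>r. ennreal (l2_norm lborel (k r))) \<in> borel_measurable \<mu>"
        unfolding l2_norm_def by measurable
    qed
    also have "\<dots> < \<infinity>" using fin by (simp add: ennreal_mult_less_top)
    finally show "(\<integral>\<^sup>+r. ennreal (l2_norm N (h r)) \<partial>\<mu>) < \<infinity>" .
    show "expectation (\<lambda>\<omega>. X r \<omega> * X r' \<omega>) = (\<integral>z. h r z * h r' z \<partial>N)" for r r'
      using has_ito_integral_isometry[OF ito[of r] ito[of r']] by (simp add: h_def)
    show "sq_integrable M Y" by (rule has_ito_integral_sq_integrable(2)[OF Y])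
    show "expectation (\<lambda>\<omega>. Y \<omega> * X r \<omega>) = (\<integral>z. (\<integral>r. h r z \<partial>\<mu>) * h r z \<partial>N)" for r
      unfolding hG using has_ito_integral_isometry[OF Y ito[of r]] by (simp add: h_def)
    show "expectation (\<lambda>\<omega>. Y \<omega> * Y \<omega>) = (\<integral>z. (\<integral>r. h r z \<partial>\<mu>) * (\<integral>r. h r z \<partial>\<mu>) \<partial>N)"
      unfolding hG using has_ito_integral_isometry[OF Y Y] by simp
  qed
  then show "AE \<omega> in M. integrable \<mu> (\<lambda>r. X r \<omega>)" by eventually_elim simp
  show "has_ito_integral M F B (\<lambda>s \<omega>. (\<integral>r. k r s \<partial>\<mu>) * \<sigma> s \<omega>) (\<lambda>\<omega>. \<integral>r. X r \<omega> \<partial>\<mu>)"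
  proof (rule has_ito_integral_cong_AE[OF Y])
    show "(\<lambda>z. (\<integral>r. k r (fst z) \<partial>\<mu>) * \<sigma> (fst z) (snd z)) \<in> borel_measurable N"
      by (rule sq_integrable_measurable[OF has_ito_integral_sq_integrable(1)[OF Y]])
    have "(\<lambda>(\<omega>, r). X r \<omega>) \<in> borel_measurable (M \<Otimes>\<^sub>M \<mu>)"
      using X' by (subst measurable_pair_swap_iff) simp
    then show "(\<lambda>\<omega>. \<integral>r. X r \<omega> \<partial>\<mu>) \<in> borel_measurable M"
      by (rule mu.borel_measurable_lebesgue_integral)
    show "AE \<omega> in M. Y \<omega> = (\<integral>r. X r \<omega> \<partial>\<mu>)" using main by eventually_elim simp
  qed simp
qed

lemma vmv_process_has_ito_integral:
  assumes v: "volatility_process M F \<sigma>" and K: "volterra_kernel K" and X: "vmv_process M F B K \<sigma> X"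
  shows "has_ito_integral M F B (\<lambda>s \<omega>. K r s * \<sigma> s \<omega>) (X r)"
proof -
  have eq: "indicator {..r} s * (K r s * \<sigma> s \<omega>) = K r s * \<sigma> s \<omega>" for s \<omega>
    using volterra_kernel_eq_0[OF K, of r s] by (cases "s \<le> r") auto
  obtain Y where "has_ito_integral M F B (\<lambda>s \<omega>. K r s * \<sigma> s \<omega>) Y"
    using ito_integrable_has_ito_integral[OF ito_integrable_mult_volatility[OF v volterra_kernel_sq_integrable[OF K]]] by blast
  then have Z: "has_ito_integral M F B (\<lambda>s \<omega>. K r s * \<sigma> s \<omega>) (ito_integral M F B r (\<lambda>s \<omega>. K r s * \<sigma> s \<omega>))"
    using has_ito_integral_ito_integral[of r "\<lambda>s \<omega>. K r s * \<sigma> s \<omega>" Y] unfolding eq by blast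
  have "(\<lambda>(t, \<omega>). X t \<omega>) \<in> borel_measurable (borel \<Otimes>\<^sub>M M)" using X by (simp add: vmv_process_def)
  then have "X r \<in> borel_measurable M" using measurable_Pair2[of "\<lambda>(t, \<omega>). X t \<omega>" borel M borel r] by simp
  moreover have "AE \<omega> in M. ito_integral M F B r (\<lambda>s \<omega>. K r s * \<sigma> s \<omega>) \<omega> = X r \<omega>"
  proof -
    have "AE \<omega> in M. X r \<omega> = ito_integral M F B r (\<lambda>s \<omega>. K r s * \<sigma> s \<omega>) \<omega>"
      using X by (simp add: vmv_process_def)
    then show ?thesis by eventually_elim simp
  qed
  ultimately show ?thesis
    by (intro has_ito_integral_cong_AE[OF Z])
      (auto intro: sq_integrable_measurable[OF has_ito_integral_sq_integrable(1)[OF Z]])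
qed

lemma vmv_stochastic_fubini:
  assumes v: "volatility_process M F \<sigma>" and K: "volterra_kernel K" and X: "vmv_process M F B K \<sigma> X"
    and mu: "sigma_finite_measure \<mu>" and sets_mu: "sets \<mu> = sets borel"
    and fin: "(\<integral>\<^sup>+r. indicator {..t} r * ennreal (l2_norm lborel (K r)) \<partial>\<mu>) < \<infinity>"
  shows "sq_integrable lborel (\<lambda>s. LINT r:{s<..t}|\<mu>. K r s)"
    and "AE \<omega> in M. set_integrable \<mu> {..t} (\<lambda>r. X r \<omega>)"
    and "has_ito_integral M F B (\<lambda>s \<omega>. (LINT r:{s<..t}|\<mu>. K r s) * \<sigma> s \<omega>) (\<lambda>\<omega>. LINT r:{..t}|\<mu>. X r \<omega>)"
proof -
  note Km = volterra_kernel_measurable[OF K]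
  note sqK = volterra_kernel_sq_integrable[OF K]
  \<comment> \<open>the integral over \<open>(s, t]\<close> excludes \<open>r = s\<close>; for fixed \<open>r\<close> this changes the integrand only at the single time \<open>s = r\<close>\<close>
  define k where "k r s = (if s < r \<and> r \<le> t then K r s else 0)" for r s
  define X' where "X' r \<omega> = (if r \<le> t then X r \<omega> else 0)" for r \<omega>
  have k_eq: "k r s = indicator {s<..t} r *\<^sub>R K r s" for r s by (auto simp: k_def)
  have X'_eq: "X' r \<omega> = indicator {..t} r *\<^sub>R X r \<omega>" for r \<omega> by (auto simp: X'_def)
  have km: "(\<lambda>(r, s). k r s) \<in> borel_measurable (borel \<Otimes>\<^sub>M borel)"
  proof -
    note [measurable] = Km
    show ?thesis unfolding k_def by measurable
  qed
  have kr: "k r \<in> borel_measurable borel" for r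
  proof -
    note [measurable] = km
    show ?thesis by measurable
  qed
  have sqk: "sq_integrable lborel (k r)" for r
    by (rule sq_integrable_bound[OF sqK[of r]]) (use kr[of r] in \<open>auto simp: k_def\<close>)
  have l2k: "ennreal (l2_norm lborel (k r)) \<le> indicator {..t} r * ennreal (l2_norm lborel (K r))" for r
  proof (cases "r \<le> t")
    case True
    have "l2_norm lborel (k r) \<le> l2_norm lborel (K r)"
      unfolding l2_norm_def
      by (intro real_sqrt_le_mono integral_mono) (use sqk[of r] sqK[of r] in \<open>auto simp: sq_integrable_def k_def\<close>)
    then show ?thesis using True by (simp add: ennreal_leI)
  qed (simp add: k_def l2_norm_def)
  have fin': "(\<integral>\<^sup>+r. ennreal (l2_norm lborel (k r)) \<partial>\<mu>) < \<infinity>"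
    by (rule le_less_trans[OF nn_integral_mono fin]) (rule l2k)
  have Xm: "(\<lambda>(r, \<omega>). X r \<omega>) \<in> borel_measurable (borel \<Otimes>\<^sub>M M)" using X by (simp add: vmv_process_def)
  have X'm: "(\<lambda>(r, \<omega>). X' r \<omega>) \<in> borel_measurable (borel \<Otimes>\<^sub>M M)"
  proof -
    note [measurable] = Xm
    show ?thesis unfolding X'_def by measurable
  qed
  have ito: "has_ito_integral M F B (\<lambda>s \<omega>. k r s * \<sigma> s \<omega>) (X' r)" for r
  proof -
    obtain c :: real where c: "c = (if r \<le> t then 1 else 0)" by simp
    have Z: "has_ito_integral M F B (\<lambda>s \<omega>. 0 + c * (K r s * \<sigma> s \<omega>)) (\<lambda>\<omega>. 0 + c * X r \<omega>)"
    proof (rule has_ito_integral_lincomb[OF _ vmv_process_has_ito_integral[OF v K X]])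
      show "has_ito_integral M F B (\<lambda>s \<omega>. 0) (\<lambda>\<omega>. 0)"
        by (rule has_ito_integralI[where S="\<lambda>n. []"]) (simp_all add: l2_norm_def)
    qed
    show ?thesis
    proof (rule has_ito_integral_cong_AE[OF Z])
      have "sq_integrable N (\<lambda>z. k r (fst z) * \<sigma> (fst z) (snd z))"
        using volatility_sq_integrable[OF v] sqk[of r] by blast
      then show "(\<lambda>z. k r (fst z) * \<sigma> (fst z) (snd z)) \<in> borel_measurable N"
        by (rule sq_integrable_measurable)
      have "(\<lambda>\<omega>. 0 + c * X r \<omega>) = X' r" by (auto simp: X'_def c)
      then show "X' r \<in> borel_measurable M" "AE \<omega> in M. 0 + c * X r \<omega> = X' r \<omega>"
        using sq_integrable_measurable[OF has_ito_integral_sq_integrable(2)[OF Z]] by (auto simp: fun_eq_iff)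
      have "AE z in N. fst z \<noteq> r" by (rule AE_lborel_imp_AE_N[OF AE_lborel_singleton])
      then show "AE z in N. 0 + c * (K r (fst z) * \<sigma> (fst z) (snd z)) = k r (fst z) * \<sigma> (fst z) (snd z)"
      proof eventually_elim
        case (elim z)
        then show ?case using volterra_kernel_eq_0[OF K, of r "fst z"] by (auto simp: c k_def)
      qed
    qed
  qed
  note res = stochastic_fubini[OF v mu sets_mu km sqk fin' X'm ito]
  show "sq_integrable lborel (\<lambda>s. LINT r:{s<..t}|\<mu>. K r s)"
    using res(1) by (simp add: set_lebesgue_integral_def k_eq)
  show "AE \<omega> in M. set_integrable \<mu> {..t} (\<lambda>r. X r \<omega>)"
    using res(2) by (simp add: set_integrable_def X'_eq)
  show "has_ito_integral M F B (\<lambda>s \<omega>. (LINT r:{s<..t}|\<mu>. K r s) * \<sigma> s \<omega>) (\<lambda>\<omega>. LINT r:{..t}|\<mu>. X r \<omega>)"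
    using res(3) by (simp add: set_lebesgue_integral_def k_eq X'_eq)
qed

lemma vmv_integral_eq_stieltjes:
  assumes v: "volatility_process M F \<sigma>" and K: "volterra_kernel K" and X: "vmv_process M F B K \<sigma> X"
    and bv: "locally_bounded_variation f" and contf: "continuous_on UNIV f"
    and lim: "AE s in lborel. s < t \<longrightarrow> ((\<lambda>u. (f u - f s) * K u s) \<longlongrightarrow> 0) (at_right s)"
    and fin: "(\<integral>\<^sup>+r. indicator {..t} r * ennreal (l2_norm lborel (K r)) \<partial>total_variation_measure f) < \<infinity>"
  shows "f \<in> wiener_integrands K t"
    and "AE \<omega> in M. stieltjes_integrable f {..t} (\<lambda>s. X s \<omega>) \<and>
      vmv_integral M F B K \<sigma> t f \<omega> = f t * X t \<omega> - stieltjes_integral f {..t} (\<lambda>s. X s \<omega>)"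
proof -
  note sf = variation_measure_sigma_finite[OF bv contf]
  let ?P = "positive_variation_measure f" and ?Q = "negative_variation_measure f"
  have finP: "(\<integral>\<^sup>+r. indicator {..t} r * ennreal (l2_norm lborel (K r)) \<partial>?P) < \<infinity>"
    by (rule le_less_trans[OF nn_integral_mono_measure_le fin]) (simp_all add: variation_measure_le[OF bv contf])
  have finQ: "(\<integral>\<^sup>+r. indicator {..t} r * ennreal (l2_norm lborel (K r)) \<partial>?Q) < \<infinity>"
    by (rule le_less_trans[OF nn_integral_mono_measure_le fin]) (simp_all add: variation_measure_le[OF bv contf])
  note T = vmv_stochastic_fubini[OF v K X sf(1) variation_measure_simps(1) fin]
  note P = vmv_stochastic_fubini[OF v K X sf(2) variation_measure_simps(2) finP]
  note Q = vmv_stochastic_fubini[OF v K X sf(3) variation_measure_simps(3) finQ]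
  define G where "G s = stieltjes_integral f {s<..t} (\<lambda>r. K r s)" for s
  have sqG: "sq_integrable lborel G"
    unfolding G_def[abs_def] stieltjes_integral_def by (rule sq_integrable_diff[OF P(1) Q(1)])
  have "(\<lambda>s. indicator {..t} s * G s) = G"
    by (auto simp: G_def stieltjes_integral_def set_lebesgue_integral_def fun_eq_iff split: split_indicator)
  then show wi: "f \<in> wiener_integrands K t"
    unfolding wiener_integrands_iff[OF K bv contf lim] square_integrable_upto_iff
    using sq_integrable_lborel_imp_lebesgue[OF sqG] by (simp add: G_def[abs_def])
  let ?R = "\<lambda>\<omega>. f t * X t \<omega> - stieltjes_integral f {..t} (\<lambda>s. X s \<omega>)"
  have "has_ito_integral M F B (\<lambda>s \<omega>. G s * \<sigma> s \<omega> + (- f t) * (K t s * \<sigma> s \<omega>))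
      (\<lambda>\<omega>. stieltjes_integral f {..t} (\<lambda>s. X s \<omega>) + (- f t) * X t \<omega>)"
    using has_ito_integral_lincomb[OF has_ito_integral_lincomb[OF P(3) Q(3), of "- 1"]
        vmv_process_has_ito_integral[OF v K X], of "- f t"]
    by (simp add: G_def stieltjes_integral_def left_diff_distrib)
  \<comment> \<open>adding \<open>- 2\<close> times the integral to itself changes its sign\<close>
  from has_ito_integral_lincomb[OF this this, of "- 2"]
  have Z: "has_ito_integral M F B (\<lambda>s \<omega>. (f t * K t s - G s) * \<sigma> s \<omega>) ?R"
    by (simp add: algebra_simps)
  have "has_ito_integral M F B (\<lambda>s \<omega>. indicator {..t} s * (kernel_operator K f t s * \<sigma> s \<omega>)) ?R"
  proof (rule has_ito_integral_cong_AE[OF Z])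
    have "sq_integrable lebesgue (\<lambda>s. indicator {..t} s * kernel_operator K f t s)"
      using wi by (simp add: wiener_integrands_def square_integrable_upto_iff)
    then have "(\<lambda>z. indicator {..t} (fst z) * kernel_operator K f t (fst z)) \<in> borel_measurable N"
      by (intro lebesgue_measurable_fst sq_integrable_measurable)
    from borel_measurable_times[OF this volatility_measurable_N[OF v]]
    show "(\<lambda>z. indicator {..t} (fst z) * (kernel_operator K f t (fst z) * \<sigma> (fst z) (snd z))) \<in> borel_measurable N"
      by (simp add: mult.assoc)
    show "?R \<in> borel_measurable M"
      by (rule sq_integrable_measurable[OF has_ito_integral_sq_integrable(2)[OF Z]])
    have "AE s in lborel. f t * K t s - G s = indicator {..t} s * kernel_operator K f t s"
      using kernel_operator_eq[OF K bv contf lim] AE_lborel_singleton[of t]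
    proof eventually_elim
      case (elim s)
      then show ?case
        using volterra_kernel_eq_0[OF K, of t s]
        by (cases "s < t") (auto simp: G_def stieltjes_integral_def set_lebesgue_integral_def)
    qed
    from AE_lborel_imp_AE_N[OF this]
    show "AE z in N. (f t * K t (fst z) - G (fst z)) * \<sigma> (fst z) (snd z)
      = indicator {..t} (fst z) * (kernel_operator K f t (fst z) * \<sigma> (fst z) (snd z))"
      by eventually_elim simp
  qed simp
  from has_ito_integral_unique[OF has_ito_integral_ito_integral[OF this] this] T(2)
  show "AE \<omega> in M. stieltjes_integrable f {..t} (\<lambda>s. X s \<omega>) \<and>
      vmv_integral M F B K \<sigma> t f \<omega> = f t * X t \<omega> - stieltjes_integral f {..t} (\<lambda>s. X s \<omega>)"
    by eventually_elim (simp add: stieltjes_integrable_def vmv_integral_def)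
qed

end

section \<open>Wiener integrals against volatility modulated Volterra processes\<close>

theorem proposition2:
  fixes M :: "'a measure" and F :: "real \<Rightarrow> 'a measure"
    and B \<sigma> X :: "real \<Rightarrow> 'a \<Rightarrow> real"
    and K :: "real \<Rightarrow> real \<Rightarrow> real" and f :: "real \<Rightarrow> real" and t :: real
  assumes "two_sided_brownian_motion M F B"
    and "volterra_kernel K"
    and "volatility_process M F \<sigma>"
    and "vmv_process M F B K \<sigma> X"
    and "continuous_on UNIV f"
    and "locally_bounded_variation f"
    and "AE s in lborel. s < t \<longrightarrow> ((\<lambda>u. (f u - f s) * K u s) \<longlongrightarrow> 0) (at_right s)"
  shows "(f \<in> wiener_integrands K t \<longleftrightarrow>
            (AE s in lborel. s < t \<longrightarrow> stieltjes_integrable f {s<..t} (\<lambda>r. K r s)) \<and>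
            square_integrable_upto t (\<lambda>s. stieltjes_integral f {s<..t} (\<lambda>r. K r s))) \<and>
         ((\<integral>\<^sup>+s\<in>{..t}. ennreal (sqrt (LINT r:{..s}|lborel. (K s r)\<^sup>2)) \<partial>total_variation_measure f) < \<infinity> \<longrightarrow>
            f \<in> wiener_integrands K t \<and>
            (AE \<omega> in M. stieltjes_integrable f {..t} (\<lambda>s. X s \<omega>) \<and>
               vmv_integral M F B K \<sigma> t f \<omega>
                 = f t * X t \<omega> - stieltjes_integral f {..t} (\<lambda>s. X s \<omega>)))"
proof (intro conjI impI)
  interpret two_sided_brownian_motion M F B by fact
  note K = assms(2) and v = assms(3) and X = assms(4) and contf = assms(5) and bv = assms(6) and lim = assms(7)
  show "f \<in> wiener_integrands K t \<longleftrightarrow>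
      (AE s in lborel. s < t \<longrightarrow> stieltjes_integrable f {s<..t} (\<lambda>r. K r s)) \<and>
      square_integrable_upto t (\<lambda>s. stieltjes_integral f {s<..t} (\<lambda>r. K r s))"
    using wiener_integrands_iff[OF K bv contf lim] volterra_kernel_stieltjes_integrable[OF K bv contf] by simp
  assume "(\<integral>\<^sup>+s\<in>{..t}. ennreal (sqrt (LINT r:{..s}|lborel. (K s r)\<^sup>2)) \<partial>total_variation_measure f) < \<infinity>"
  moreover have "sqrt (LINT r:{..s}|lborel. (K s r)\<^sup>2) = l2_norm lborel (K s)" for s
  proof -
    have "indicator {..s} r *\<^sub>R (K s r)\<^sup>2 = (K s r)\<^sup>2" for r
      using volterra_kernel_eq_0[OF K, of s r] by (cases "r \<le> s") auto
    then show ?thesis unfolding l2_norm_def set_lebesgue_integral_def by (simp only:)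
  qed
  ultimately have fin: "(\<integral>\<^sup>+r. indicator {..t} r * ennreal (l2_norm lborel (K r)) \<partial>total_variation_measure f) < \<infinity>"
    by (simp add: mult.commute)
  show "f \<in> wiener_integrands K t"
    by (rule vmv_integral_eq_stieltjes(1)[OF v K X bv contf lim fin])
  show "AE \<omega> in M. stieltjes_integrable f {..t} (\<lambda>s. X s \<omega>) \<and>
      vmv_integral M F B K \<sigma> t f \<omega> = f t * X t \<omega> - stieltjes_integral f {..t} (\<lambda>s. X s \<omega>)"
    by (rule vmv_integral_eq_stieltjes(2)[OF v K X bv contf lim fin])
qed

end
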